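(* Let $\mathbb X$ be a connected Riemann surface. The space of all projective structures on $\mathbb X$ is in a natural bijection with the subset of the space of all holomorphic connections on $J^2(T\mathbb X)$ defined by all connections $\mathcal D$ satisfying the following four conditions: (1) $\mathcal D$ is an oper connection; (2) $F_{\mathcal D}=\mathrm{Id}_{J^2(T\mathbb X)}$; (3) the connection on $\bigwedge^3J^2(T\mathbb X)$ induced by $\mathcal D$ coincides with the trivial connection on $\bigwedge^3J^2(T\mathbb X)$; and (4) if $s$ and $t$ are locally defined holomorphic sections of $T\mathbb X$ such that the sections of $J^2(T\mathbb X)$ corresponding to $s$ and $t$ are flat with respect to $\mathcal D$, then the section of $J^2(T\mathbb X)$ corresponding to the Lie bracket $[s,t]$ is also flat with respect to $\mathcal D$.
   Context: $\mathbb V$ is a two-dimensional complex vector space and $\mathbb P(\mathbb V)$ the projective line of its one-dimensional subspaces. A projective structure on $\mathbb X$ is an equivalence class of holomorphic atlases $\{(U_i,\phi_i)\}$, $\phi_i:U_i\to\mathbb P(\mathbb V)$ holomorphic embeddings, such that on each connected component of $U_i\cap U_j$ the map $\phi_j\circ\phi_i^{-1}$ is the restriction of an element of $\mathrm{PGL}(\mathbb V)$; two atlases are equivalent if their union is again such an atlas. $T\mathbb X$ and $K_{\mathbb X}$ are the holomorphic tangent and cotangent bundles. $J^k(W)$ is the bundle of $k$-jets of holomorphic sections of $W$, with exact sequence $0\to K_{\mathbb X}^{\otimes k}\otimes W\to J^k(W)\to J^{k-1}(W)\to0$. The section of $J^2(T\mathbb X)$ corresponding to a vector field is its $2$-jet.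 For $W=T\mathbb X$ these sequences read $0\to\mathcal O_{\mathbb X}\to J^1(T\mathbb X)\to T\mathbb X\to0$ and $0\to K_{\mathbb X}\to J^2(T\mathbb X)\to J^1(T\mathbb X)\to0$; they give the identification $\bigwedge^3J^2(T\mathbb X)=\mathcal O_{\mathbb X}$, and the trivial connection is the one given by the de Rham differential. Oper connections. The two sequences give a filtration by holomorphic subbundles $K_{\mathbb X}=\ker(J^2(T\mathbb X)\to J^1(T\mathbb X))\subset F_2=\ker(J^2(T\mathbb X)\to T\mathbb X)\subset J^2(T\mathbb X)$, with $F_2/K_{\mathbb X}=\mathcal O_{\mathbb X}$ and $J^2(T\mathbb X)/F_2=T\mathbb X$. For a holomorphic connection $\mathcal D$ on $J^2(T\mathbb X)$ mapping $K_{\mathbb X}$ into $F_2\otimes K_{\mathbb X}$, the second fundamental form of $K_{\mathbb X}$ is the induced $\mathcal O_{\mathbb X}$-linear map $K_{\mathbb X}\to(F_2/K_{\mathbb X})\otimes K_{\mathbb X}$, and that of $F_2$ is given by the induced $\mathcal O_{\mathbb X}$-linear map $F_2/K_{\mathbb X}\to(J^2(T\mathbb X)/F_2)\otimes K_{\mathbb X}$. $\mathcal D$ is an oper connection if: $\mathcal D(K_{\mathbb X})=F_2\otimes K_{\mathbb X}$; the second fundamental form of $K_{\mathbb X}$, a section of $\mathrm{Hom}(K_{\mathbb X},\mathcal O_{\mathbb X})\otimes K_{\mathbb X}=\mathcal O_{\mathbb X}$, coincides with the constant function $1$; and the section of $\mathrm{Hom}(F_2/K_{\mathbb X},J^2(T\mathbb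 X)/F_2)\otimes K_{\mathbb X}=\mathcal O_{\mathbb X}$ giving the second fundamental form of $F_2$ coincides with the constant function $1$. The endomorphism $F_{\mathcal D}$ of $J^2(T\mathbb X)$: for $v\in J^2(T\mathbb X)_x$, let $\widetilde v$ be the $\mathcal D$-flat section of $J^2(T\mathbb X)$ on a simply connected neighborhood of $x$ with $\widetilde v(x)=v$, and let $p_0:J^2(T\mathbb X)\to T\mathbb X$ be the natural projection; $F_{\mathcal D}(v)\in J^2(T\mathbb X)_x$ is the element defined by ($2$-jet at $x$ of) the vector field $p_0(\widetilde v)$. *)

theory Defs
  imports "HOL-Analysis.Analysis"
begin

section \<open>The projective line of a complex vector space\<close>

text \<open>
  A vector space \<open>V\<close> is given by a scalar multiplication \<open>sc\<close> on a type \<open>'v\<close>.  The complex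
  structure of the projective line is given by its affine coordinates \<open>[w] \<mapsto> \<beta> w / \<alpha> w\<close>, defined
  where the linear functional \<open>\<alpha>\<close> does not vanish.
\<close>

abbreviation functional :: "(complex \<Rightarrow> 'v::ab_group_add \<Rightarrow> 'v) \<Rightarrow> ('v \<Rightarrow> complex) \<Rightarrow> bool" where
  "functional sc \<alpha> \<equiv> Vector_Spaces.linear sc (*) \<alpha>"

definition projective_line :: "(complex \<Rightarrow> 'v::ab_group_add \<Rightarrow> 'v) \<Rightarrow> 'v set set" where
  "projective_line sc = {L. module.subspace sc L \<and> vector_space.dim sc L = 1}"

definition PGL :: "(complex \<Rightarrow> 'v::ab_group_add \<Rightarrow> 'v) \<Rightarrow> ('v set \<Rightarrow> 'v set) set" where
  "PGL sc = {image g | g. Vector_Spaces.linear sc sc g \<and> bij g}"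

definition affine_coord :: "('v \<Rightarrow> complex) \<Rightarrow> ('v \<Rightarrow> complex) \<Rightarrow> 'v set \<Rightarrow> complex" where
  "affine_coord \<alpha> \<beta> L = (THE q. \<exists>w\<in>L. \<alpha> w \<noteq> 0 \<and> q = \<beta> w / \<alpha> w)"


section \<open>Riemann surfaces\<close>

type_synonym 'a chart = "'a set \<times> ('a \<Rightarrow> complex)"

locale riemann_surface =
  fixes X :: "'a topology" and A :: "'a chart set"
  assumes Hausdorff: "Hausdorff_space X"
    and covering: "(\<Union>c\<in>A. fst c) = topspace X"
    and chart: "(U, \<phi>) \<in> A \<Longrightarrow> openin X U \<and> open (\<phi> ` U) \<and>
                  homeomorphic_map (subtopology X U) (top_of_set (\<phi> ` U)) \<phi>"
    and compatible: "(U, \<phi>) \<in> A \<Longrightarrow> (U', \<psi>) \<in> A \<Longrightarrow>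
                  (\<psi> \<circ> inv_into U \<phi>) holomorphic_on \<phi> ` (U \<inter> U')"

text \<open>
  A tangent vector at \<open>x\<close> is the family of its components in the charts around \<open>x\<close>, and a \<open>k\<close>-jet at
  \<open>x\<close> is the family of the derivatives of order \<open>\<le> k\<close> of the components of a vector field.  Both
  families are \<open>0\<close> outside their proper index range, so that equality of functions is equality of
  tangent vectors or jets.
\<close>

type_synonym 'a tvec = "'a chart \<Rightarrow> complex"
type_synonym 'a jet = "'a chart \<Rightarrow> nat \<Rightarrow> complex"

context riemann_surface
begin

definition charts_at :: "'a \<Rightarrow> 'a chart set" where
  "charts_at x = {c \<in> A. x \<in> fst c}"

definition in_chart :: "'a chart \<Rightarrow> ('a \<Rightarrow> complex) \<Rightarrow> complex \<Rightarrow> complex" where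
  "in_chart c f = f \<circ> inv_into (fst c) (snd c)"

definition holo_fun :: "'a set \<Rightarrow> ('a \<Rightarrow> complex) \<Rightarrow> bool" where
  "holo_fun W f \<longleftrightarrow> openin X W \<and> (\<forall>c\<in>A. in_chart c f holomorphic_on snd c ` (W \<inter> fst c))"


subsection \<open>Vector fields and one-forms\<close>

definition tangent :: "'a \<Rightarrow> 'a tvec set" where
  "tangent x = {v. (\<forall>c. c \<notin> charts_at x \<longrightarrow> v c = 0) \<and>
     (\<forall>c\<in>charts_at x. \<forall>d\<in>charts_at x. v d = deriv (in_chart c (snd d)) (snd c x) * v c)}"

text \<open>The coordinate vector \<open>\<partial>/\<partial>z\<close> at \<open>x\<close>, where \<open>z\<close> is the coordinate of the chart \<open>c\<close>.\<close>

definition coord_vec :: "'a chart \<Rightarrow> 'a \<Rightarrow> 'a tvec" where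
  "coord_vec c x = (\<lambda>d. if d \<in> charts_at x then deriv (in_chart c (snd d)) (snd c x) else 0)"

text \<open>The value \<open>df\<^sub>x(v)\<close>; it does not depend on the chart chosen at \<open>x\<close>.\<close>

definition differential :: "('a \<Rightarrow> complex) \<Rightarrow> 'a \<Rightarrow> 'a tvec \<Rightarrow> complex" where
  "differential f x v =
     (let c = (SOME c. c \<in> charts_at x) in deriv (in_chart c f) (snd c x) * v c)"

definition holo_vf :: "'a set \<Rightarrow> ('a \<Rightarrow> 'a tvec) \<Rightarrow> bool" where
  "holo_vf W s \<longleftrightarrow> openin X W \<and> (\<forall>x\<in>W. s x \<in> tangent x) \<and>
     (\<forall>c\<in>A. in_chart c (\<lambda>y. s y c) holomorphic_on snd c ` (W \<inter> fst c))"

definition lie_bracket :: "('a \<Rightarrow> 'a tvec) \<Rightarrow> ('a \<Rightarrow> 'a tvec) \<Rightarrow> 'a \<Rightarrow> 'a tvec" where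
  "lie_bracket s t x = (\<lambda>c. if c \<in> charts_at x
     then s x c * deriv (in_chart c (\<lambda>y. t y c)) (snd c x)
        - t x c * deriv (in_chart c (\<lambda>y. s y c)) (snd c x)
     else 0)"

definition cotangent :: "'a \<Rightarrow> ('a tvec \<Rightarrow> complex) set" where
  "cotangent x = {\<theta>. (\<forall>v. v \<notin> tangent x \<longrightarrow> \<theta> v = 0) \<and>
     (\<forall>u\<in>tangent x. \<forall>v\<in>tangent x. \<forall>a b. \<theta> (\<lambda>c. a * u c + b * v c) = a * \<theta> u + b * \<theta> v)}"

definition holo_form :: "'a set \<Rightarrow> ('a \<Rightarrow> 'a tvec \<Rightarrow> complex) \<Rightarrow> bool" where
  "holo_form W \<theta> \<longleftrightarrow> openin X W \<and> (\<forall>x\<in>W. \<theta> x \<in> cotangent x) \<and>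
     (\<forall>W' s. W' \<subseteq> W \<longrightarrow> holo_vf W' s \<longrightarrow> holo_fun W' (\<lambda>x. \<theta> x (s x)))"


subsection \<open>Jets of vector fields\<close>

definition jet :: "nat \<Rightarrow> ('a \<Rightarrow> 'a tvec) \<Rightarrow> 'a \<Rightarrow> 'a jet" where
  "jet k s x = (\<lambda>c i. if c \<in> charts_at x \<and> i \<le> k
     then (deriv ^^ i) (in_chart c (\<lambda>y. s y c)) (snd c x) else 0)"

definition J :: "nat \<Rightarrow> 'a \<Rightarrow> 'a jet set" where
  "J k x = {jet k s x | W s. holo_vf W s \<and> x \<in> W}"

text \<open>The projections \<open>J\<^sup>m(TX) \<rightarrow> J\<^sup>k(TX)\<close> for \<open>k \<le> m\<close>, and \<open>J\<^sup>m(TX) \<rightarrow> TX\<close>.\<close>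

definition trunc :: "nat \<Rightarrow> 'a jet \<Rightarrow> 'a jet" where
  "trunc k j = (\<lambda>c i. if i \<le> k then j c i else 0)"

definition p0 :: "'a jet \<Rightarrow> 'a tvec" where
  "p0 j = (\<lambda>c. j c 0)"

definition K2 :: "'a \<Rightarrow> 'a jet set" where
  "K2 x = {j \<in> J 2 x. trunc 1 j = (\<lambda>_ _. 0)}"

definition F2 :: "'a \<Rightarrow> 'a jet set" where
  "F2 x = {j \<in> J 2 x. p0 j = (\<lambda>_. 0)}"

definition holo_section :: "'a set \<Rightarrow> ('a \<Rightarrow> 'a jet) \<Rightarrow> bool" where
  "holo_section W \<sigma> \<longleftrightarrow> openin X W \<and> (\<forall>x\<in>W. \<sigma> x \<in> J 2 x) \<and>
     (\<forall>c\<in>A. \<forall>i\<le>2. in_chart c (\<lambda>y. \<sigma> y c i) holomorphic_on snd c ` (W \<inter> fst c))"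

text \<open>
  The inclusion of \<open>K\<^sup>k \<otimes> TX\<close> into \<open>J\<^sup>k(TX)\<close>.  Since \<open>K = I/I\<^sup>2\<close> for the ideal \<open>I\<close> of the diagonal,
  and a \<open>k\<close>-jet at \<open>x\<close> is a class in the second variable \<open>y\<close> modulo \<open>I\<^sup>k\<^sup>+\<^sup>1\<close>, there is a choice of
  sign (which of \<open>f(x) - f(y)\<close> and \<open>f(y) - f(x)\<close> represents \<open>df\<close>) and of normalization of
  \<open>K\<^sup>k \<cong> I\<^sup>k/I\<^sup>k\<^sup>+\<^sup>1\<close>.  The convention used here is that \<open>dz\<^sup>k \<otimes> \<partial>/\<partial>z\<close> goes to the jet at \<open>x\<close> of
  \<open>(z(x) - z)\<^sup>k / k! \<cdot> \<partial>/\<partial>z\<close>.  It is chosen because it makes both second fundamental forms of the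
  connection whose flat sections are the jets of \<open>\<partial>/\<partial>z\<close>, \<open>z \<partial>/\<partial>z\<close>, \<open>z\<^sup>2 \<partial>/\<partial>z\<close> equal to \<open>1\<close>: on
  the derivatives \<open>(a\<^sub>0, a\<^sub>1, a\<^sub>2)\<close> this connection is \<open>(a\<^sub>0' - a\<^sub>1, a\<^sub>1' - a\<^sub>2, a\<^sub>2')\<close>.  With
  \<open>(z - z(x))\<^sup>k\<close> in place of \<open>(z(x) - z)\<^sup>k / k!\<close> they would be \<open>-2\<close> and \<open>-1\<close>.
\<close>

definition kernel_jet :: "nat \<Rightarrow> 'a chart \<Rightarrow> 'a \<Rightarrow> 'a jet" where
  "kernel_jet k c x = jet k (\<lambda>y d. (snd c x - snd c y) ^ k / fact k * coord_vec c y d) x"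

text \<open>
  The resulting identifications \<open>O = K \<otimes> TX = ker (J\<^sup>1 \<rightarrow> TX)\<close> and
  \<open>K = K\<^sup>2 \<otimes> TX = ker (J\<^sup>2 \<rightarrow> J\<^sup>1)\<close>, where \<open>dz \<otimes> \<partial>/\<partial>z = 1\<close>; they do not depend on the chart.
  The quotient \<open>F2/K2\<close> is identified with \<open>ker (J\<^sup>1 \<rightarrow> TX)\<close> by \<open>trunc 1\<close>.
\<close>

definition O_incl :: "'a \<Rightarrow> complex \<Rightarrow> 'a jet" where
  "O_incl x a = (let c = (SOME c. c \<in> charts_at x) in (\<lambda>d i. a * kernel_jet 1 c x d i))"

definition K_incl :: "'a \<Rightarrow> ('a tvec \<Rightarrow> complex) \<Rightarrow> 'a jet" where
  "K_incl x \<theta> = (let c = (SOME c. c \<in> charts_at x) in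
     (\<lambda>d i. \<theta> (coord_vec c x) * kernel_jet 2 c x d i))"


subsection \<open>Holomorphic connections on the bundle of two-jets\<close>

text \<open>The fibre at \<open>x\<close> of \<open>E \<otimes> K\<close>, for a subbundle \<open>E\<close> of \<open>J\<^sup>2(TX)\<close>: linear maps \<open>T\<^sub>x X \<rightarrow> E\<^sub>x\<close>.\<close>

definition hom_tangent :: "'a \<Rightarrow> 'a jet set \<Rightarrow> ('a tvec \<Rightarrow> 'a jet) set" where
  "hom_tangent x E = {\<omega>. (\<forall>v. v \<notin> tangent x \<longrightarrow> \<omega> v = (\<lambda>_ _. 0)) \<and> (\<forall>v\<in>tangent x. \<omega> v \<in> E) \<and>
     (\<forall>u\<in>tangent x. \<forall>v\<in>tangent x. \<forall>a b.
        \<omega> (\<lambda>c. a * u c + b * v c) = (\<lambda>c i. a * \<omega> u c i + b * \<omega> v c i))}"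

text \<open>
  A connection is a morphism of sheaves \<open>J\<^sup>2(TX) \<rightarrow> J\<^sup>2(TX) \<otimes> K\<close>, given by its action on germs:
  \<open>D \<sigma> x\<close> depends only on the germ of \<open>\<sigma>\<close> at \<open>x\<close>, and is \<open>0\<close> by convention if \<open>\<sigma>\<close> is not a holomorphic
  section near \<open>x\<close>.  Hence equality of functions is equality of connections.
\<close>

type_synonym 'b connection = "('b \<Rightarrow> 'b jet) \<Rightarrow> 'b \<Rightarrow> 'b tvec \<Rightarrow> 'b jet"

definition holomorphic_connection :: "'a connection \<Rightarrow> bool" where
  "holomorphic_connection D \<longleftrightarrow>
     (\<forall>\<sigma> x. \<not> (\<exists>W. x \<in> W \<and> holo_section W \<sigma>) \<longrightarrow> D \<sigma> x = (\<lambda>_ _ _. 0)) \<and>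
     (\<forall>W \<sigma> \<tau>. holo_section W \<sigma> \<longrightarrow> holo_section W \<tau> \<longrightarrow> (\<forall>x\<in>W. \<sigma> x = \<tau> x) \<longrightarrow>
        (\<forall>x\<in>W. D \<sigma> x = D \<tau> x)) \<and>
     (\<forall>W \<sigma>. holo_section W \<sigma> \<longrightarrow>
        (\<forall>x\<in>W. D \<sigma> x \<in> hom_tangent x (J 2 x)) \<and>
        (\<forall>W' s. W' \<subseteq> W \<longrightarrow> holo_vf W' s \<longrightarrow> holo_section W' (\<lambda>x. D \<sigma> x (s x)))) \<and>
     (\<forall>W \<sigma> \<tau>. holo_section W \<sigma> \<longrightarrow> holo_section W \<tau> \<longrightarrow> (\<forall>x\<in>W. \<forall>v\<in>tangent x.
        D (\<lambda>y c i. \<sigma> y c i + \<tau> y c i) x v = (\<lambda>c i. D \<sigma> x v c i + D \<tau> x v c i))) \<and>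
     (\<forall>W f \<sigma>. holo_fun W f \<longrightarrow> holo_section W \<sigma> \<longrightarrow> (\<forall>x\<in>W. \<forall>v\<in>tangent x.
        D (\<lambda>y c i. f y * \<sigma> y c i) x v =
          (\<lambda>c i. f x * D \<sigma> x v c i + differential f x v * \<sigma> x c i)))"

definition flat :: "'a connection \<Rightarrow> 'a set \<Rightarrow> ('a \<Rightarrow> 'a jet) \<Rightarrow> bool" where
  "flat D W \<sigma> \<longleftrightarrow> holo_section W \<sigma> \<and> (\<forall>x\<in>W. \<forall>v\<in>tangent x. D \<sigma> x v = (\<lambda>_ _. 0))"

text \<open>
  The function \<open>h\<close> represents the second fundamental form of \<open>K2\<close>, respectively of \<open>F2\<close>, under
  \<open>Hom(K, F2/K) \<otimes> K = Hom(K, O) \<otimes> K = O\<close> and \<open>Hom(F2/K, J\<^sup>2/F2) \<otimes> K = Hom(O, TX) \<otimes> K = O\<close>.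
\<close>

definition sff_K2 :: "'a connection \<Rightarrow> ('a \<Rightarrow> complex) \<Rightarrow> bool" where
  "sff_K2 D h \<longleftrightarrow> (\<forall>W \<theta>. holo_form W \<theta> \<longrightarrow> (\<forall>x\<in>W. \<forall>v\<in>tangent x.
     trunc 1 (D (\<lambda>y. K_incl y (\<theta> y)) x v) = O_incl x (h x * \<theta> x v)))"

definition sff_F2 :: "'a connection \<Rightarrow> ('a \<Rightarrow> complex) \<Rightarrow> bool" where
  "sff_F2 D h \<longleftrightarrow> (\<forall>W \<sigma> g. holo_section W \<sigma> \<longrightarrow> holo_fun W g \<longrightarrow>
     (\<forall>y\<in>W. \<sigma> y \<in> F2 y \<and> trunc 1 (\<sigma> y) = O_incl y (g y)) \<longrightarrow>
     (\<forall>x\<in>W. \<forall>v\<in>tangent x. p0 (D \<sigma> x v) = (\<lambda>c. h x * g x * v c)))"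

text \<open>The condition \<open>D(K) = F2 \<otimes> K\<close> is an equality of subbundles, hence read in each fibre.\<close>

definition oper_connection :: "'a connection \<Rightarrow> bool" where
  "oper_connection D \<longleftrightarrow>
     (\<forall>x\<in>topspace X.
        {D \<sigma> x | W \<sigma>. x \<in> W \<and> holo_section W \<sigma> \<and> (\<forall>y\<in>W. \<sigma> y \<in> K2 y)} = hom_tangent x (F2 x)) \<and>
     sff_K2 D (\<lambda>_. 1) \<and> sff_F2 D (\<lambda>_. 1)"

definition F_endo :: "'a connection \<Rightarrow> 'a \<Rightarrow> 'a jet \<Rightarrow> 'a jet" where
  "F_endo D x j = (THE k. \<exists>W \<sigma>. x \<in> W \<and> flat D W \<sigma> \<and> \<sigma> x = j \<and> k = jet 2 (\<lambda>y. p0 (\<sigma> y)) x)"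

text \<open>
  Linear maps \<open>\<And>\<^sup>3 J\<^sup>2(TX)\<^sub>x \<rightarrow> \<complex>\<close> are the alternating trilinear forms.  The identification
  \<open>\<And>\<^sup>3 J\<^sup>2(TX) = TX \<otimes> O \<otimes> K = O\<close> given by the two exact sequences is \<open>det_triv\<close>.
\<close>

definition alternating3 :: "'a \<Rightarrow> ('a jet \<Rightarrow> 'a jet \<Rightarrow> 'a jet \<Rightarrow> complex) \<Rightarrow> bool" where
  "alternating3 x \<omega> \<longleftrightarrow>
     (\<forall>j k l. \<not> (j \<in> J 2 x \<and> k \<in> J 2 x \<and> l \<in> J 2 x) \<longrightarrow> \<omega> j k l = 0) \<and>
     (\<forall>j\<in>J 2 x. \<forall>j'\<in>J 2 x. \<forall>k\<in>J 2 x. \<forall>l\<in>J 2 x. \<forall>a b.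
        \<omega> (\<lambda>c i. a * j c i + b * j' c i) k l = a * \<omega> j k l + b * \<omega> j' k l \<and>
        \<omega> k (\<lambda>c i. a * j c i + b * j' c i) l = a * \<omega> k j l + b * \<omega> k j' l \<and>
        \<omega> k l (\<lambda>c i. a * j c i + b * j' c i) = a * \<omega> k l j + b * \<omega> k l j') \<and>
     (\<forall>j\<in>J 2 x. \<forall>k\<in>J 2 x. \<omega> j j k = 0 \<and> \<omega> j k k = 0 \<and> \<omega> j k j = 0)"

definition det_triv :: "'a \<Rightarrow> 'a jet \<Rightarrow> 'a jet \<Rightarrow> 'a jet \<Rightarrow> complex" where
  "det_triv x = (THE \<omega>. alternating3 x \<omega> \<and>
     (\<forall>j\<in>J 2 x. \<forall>k\<in>F2 x. \<forall>a. \<forall>\<theta>\<in>cotangent x. trunc 1 k = O_incl x a \<longrightarrow>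
        \<omega> j k (K_incl x \<theta>) = \<theta> (p0 j) * a))"

text \<open>
  The connection induced on \<open>\<And>\<^sup>3 J\<^sup>2(TX)\<close> maps \<open>\<rho> \<and> \<sigma> \<and> \<tau>\<close> to
  \<open>D\<rho> \<and> \<sigma> \<and> \<tau> + \<rho> \<and> D\<sigma> \<and> \<tau> + \<rho> \<and> \<sigma> \<and> D\<tau>\<close>; it has to be the differential \<open>d\<close> under \<open>det_triv\<close>.
\<close>

definition induces_trivial_det :: "'a connection \<Rightarrow> bool" where
  "induces_trivial_det D \<longleftrightarrow> (\<forall>W \<rho> \<sigma> \<tau>. holo_section W \<rho> \<longrightarrow> holo_section W \<sigma> \<longrightarrow> holo_section W \<tau> \<longrightarrow>
     (\<forall>x\<in>W. \<forall>v\<in>tangent x.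
        det_triv x (D \<rho> x v) (\<sigma> x) (\<tau> x) + det_triv x (\<rho> x) (D \<sigma> x v) (\<tau> x)
          + det_triv x (\<rho> x) (\<sigma> x) (D \<tau> x v)
        = differential (\<lambda>y. det_triv y (\<rho> y) (\<sigma> y) (\<tau> y)) x v))"

definition flat_fields_bracket_closed :: "'a connection \<Rightarrow> bool" where
  "flat_fields_bracket_closed D \<longleftrightarrow> (\<forall>W s t. holo_vf W s \<longrightarrow> holo_vf W t \<longrightarrow>
     flat D W (jet 2 s) \<longrightarrow> flat D W (jet 2 t) \<longrightarrow> flat D W (jet 2 (lie_bracket s t)))"


subsection \<open>Projective structures\<close>

text \<open>
  A holomorphic embedding of an open set in the projective line is an injective holomorphic
  immersion; as the dimensions agree, it is then a homeomorphism onto an open image.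
\<close>

definition holo_embedding ::
    "(complex \<Rightarrow> 'v::ab_group_add \<Rightarrow> 'v) \<Rightarrow> 'a set \<Rightarrow> ('a \<Rightarrow> 'v set) \<Rightarrow> bool" where
  "holo_embedding sc U f \<longleftrightarrow> openin X U \<and> f ` U \<subseteq> projective_line sc \<and> inj_on f U \<and>
     (\<forall>\<alpha> \<beta>. functional sc \<alpha> \<longrightarrow> functional sc \<beta> \<longrightarrow>
        holo_fun {x \<in> U. \<exists>w\<in>f x. \<alpha> w \<noteq> 0} (affine_coord \<alpha> \<beta> \<circ> f)) \<and>
     (\<forall>x\<in>U. \<exists>\<alpha> \<beta>. functional sc \<alpha> \<and> functional sc \<beta> \<and> (\<exists>w\<in>f x. \<alpha> w \<noteq> 0) \<and>
        (\<exists>v\<in>tangent x. differential (affine_coord \<alpha> \<beta> \<circ> f) x v \<noteq> 0))"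

definition projective_atlas ::
    "(complex \<Rightarrow> 'v::ab_group_add \<Rightarrow> 'v) \<Rightarrow> ('a set \<times> ('a \<Rightarrow> 'v set)) set \<Rightarrow> bool" where
  "projective_atlas sc P \<longleftrightarrow> (\<Union>(U, f)\<in>P. U) = topspace X \<and>
     (\<forall>(U, f)\<in>P. holo_embedding sc U f) \<and>
     (\<forall>(U, f)\<in>P. \<forall>(U', g)\<in>P. \<forall>C\<in>connected_components_of (subtopology X (U \<inter> U')).
        \<exists>T\<in>PGL sc. \<forall>L\<in>f ` C. (g \<circ> inv_into U f) L = T L)"

definition projective_structures ::
    "(complex \<Rightarrow> 'v::ab_group_add \<Rightarrow> 'v) \<Rightarrow> ('a set \<times> ('a \<Rightarrow> 'v set)) set set set" where
  "projective_structures sc = {P. projective_atlas sc P} //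
     {(P, Q). projective_atlas sc P \<and> projective_atlas sc Q \<and> projective_atlas sc (P \<union> Q)}"

text \<open>
  \<open>s\<close> is the pullback by \<open>f\<close> of the vector field on the projective line generated by the
  endomorphism \<open>B\<close> of \<open>V\<close>; the value of this field at \<open>L\<close> is the velocity at \<open>t = 0\<close> of the curve
  \<open>(1 + t B) L\<close>.
\<close>

definition pulls_back ::
    "(complex \<Rightarrow> 'v::ab_group_add \<Rightarrow> 'v) \<Rightarrow> 'a set \<Rightarrow> ('a \<Rightarrow> 'v set) \<Rightarrow> ('v \<Rightarrow> 'v) \<Rightarrow>
      ('a \<Rightarrow> 'a tvec) \<Rightarrow> bool" where
  "pulls_back sc U f B s \<longleftrightarrow> holo_vf U s \<and>
     (\<forall>x\<in>U. \<forall>\<alpha> \<beta>. functional sc \<alpha> \<longrightarrow> functional sc \<beta> \<longrightarrow> (\<exists>w\<in>f x. \<alpha> w \<noteq> 0) \<longrightarrow>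
        differential (affine_coord \<alpha> \<beta> \<circ> f) x (s x) =
          deriv (\<lambda>t. affine_coord \<alpha> \<beta> ((\<lambda>w. w + sc t (B w)) ` f x)) 0)"

text \<open>
  The connection of a projective structure: in each projective chart, it is the pullback of the
  trivial connection on \<open>P(V) \<times> sl(V) = J\<^sup>2(TP(V))\<close>, whose flat sections are the two-jets of the
  vector fields given by \<open>sl(V)\<close>.  Scalars act trivially on the projective line, so all
  endomorphisms of \<open>V\<close> give the same fields as those of trace zero.
\<close>

definition structure_connection ::
    "(complex \<Rightarrow> 'v::ab_group_add \<Rightarrow> 'v) \<Rightarrow> ('a set \<times> ('a \<Rightarrow> 'v set)) set set \<Rightarrow> 'a connection" where
  "structure_connection sc \<PP> = (THE D. holomorphic_connection D \<and>
     (\<forall>P\<in>\<PP>. \<forall>(U, f)\<in>P. \<forall>B s. Vector_Spaces.linear sc sc B \<longrightarrow> pulls_back sc U f B s \<longrightarrow>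
        flat D U (jet 2 s)))"

end

end

theory Submission
  imports Defs "HOL-Complex_Analysis.Complex_Analysis"
begin

text \<open>
  In an affine coordinate \<open>h\<close> of a projective chart, the vector fields generated by the projective
  group are spanned by \<open>h\<^sup>i / h'\<close> for \<open>i = 0, 1, 2\<close>.  Their two-jets form a frame, with constant
  determinant, whose span does not depend on the chart of the projective structure; the connection
  for which these frames are flat is the one attached to the structure, and the four conditions can
  be read off the frames.  If two projective charts, with coordinates \<open>h\<close> and \<open>k\<close> vanishing at a
  point, have the same flat fields, then comparing jets at that point gives
  \<open>k/k' = h/h' + a h\<^sup>2/h'\<close> and \<open>k\<^sup>2/k' = b h\<^sup>2/h'\<close>, so \<open>k = b h / (1 + a h)\<close>.  Conversely, conditions
  (2)-(4) provide a local basis of flat fields which is a Lie algebra isomorphic to that of the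
  fields \<open>1\<close>, \<open>z\<close>, \<open>z\<^sup>2\<close>, and the quotient of its first two members is an affine coordinate.
\<close>

text \<open>All statements about atlases pass through one relation, \<open>adapted_to D P\<close>:
  the jets of all fields pulled back along the charts of \<open>P\<close> are flat for
  \<open>D\<close>. Each atlas has exactly one adapted connection, and two atlases are equivalent
  iff these connections agree (\<open>atlas_union_iff\<close>). This makes the connection depend on
  the class only and gives injectivity; surjectivity is the existence of an atlas adapted to a given
  \<open>D\<close>. Flat sections have to come from somewhere: in one direction they are the frames
  declared flat in the gluing, in the other they are extracted from condition (2), as
  \<open>F_endo\<close> is a definite description. In a chart, a connection with a flat frame of
  jets is a scalar equation a''' = q0 a + q1 a' + q2 a'' (\<open>third_order\<close>). The shift of
  order in its first two rows yields the oper condition and condition (2); q2 is the logarithmic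
  derivative of the Wronskian, so a constant Wronskian gives condition (3). The constant 2 that
  recurs is the Wronskian of 1, z, z^2.\<close>

lemma sum_lessThan_3: "(\<Sum>i<3. f i) = f 0 + f (Suc 0) + f (2::nat)"
  for f :: "nat \<Rightarrow> 'b::comm_monoid_add"
  by (simp add: eval_nat_numeral)

lemma all_lessThan_3: "(\<forall>i<3. P i) \<longleftrightarrow> P 0 \<and> P (Suc 0) \<and> P (2::nat)"
  by (auto simp: less_Suc_eq numeral_3_eq_3 numeral_2_eq_2)

section \<open>Holomorphic functions and their derivatives in charts\<close>

context riemann_surface
begin

text \<open>The derivative with respect to the coordinate of \<open>c\<close>, taken as a function
  on the surface again, so that it can be iterated and the rules of calculus can be stated without
  inverse charts.\<close>

definition cd :: "'a chart \<Rightarrow> ('a \<Rightarrow> complex) \<Rightarrow> 'a \<Rightarrow> complex" where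
  "cd c F x = deriv (in_chart c F) (snd c x)"

lemma charts_at_iff: "c \<in> charts_at x \<longleftrightarrow> c \<in> A \<and> x \<in> fst c"
  by (simp add: charts_at_def)

lemma charts_atD [dest]: "c \<in> charts_at x \<Longrightarrow> c \<in> A" "c \<in> charts_at x \<Longrightarrow> x \<in> fst c"
  by (simp_all add: charts_at_def)

lemma open_chart_domain: "c \<in> A \<Longrightarrow> openin X (fst c)"
  using chart[of "fst c" "snd c"] by simp

lemma homeomorphic_chart:
  "c \<in> A \<Longrightarrow> homeomorphic_map (subtopology X (fst c)) (top_of_set (snd c ` fst c)) (snd c)"
  using chart[of "fst c" "snd c"] by simp

lemma open_chart_range: "c \<in> A \<Longrightarrow> open (snd c ` fst c)"
  using chart[of "fst c" "snd c"] by simp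

lemma inj_on_chart: "c \<in> A \<Longrightarrow> inj_on (snd c) (fst c)"
  using homeomorphic_imp_injective_map[OF homeomorphic_chart] openin_subset[OF open_chart_domain]
  by (metis Int_absorb1 topspace_subtopology)

lemma charts_at_nonempty: "x \<in> topspace X \<Longrightarrow> \<exists>c. c \<in> charts_at x"
  unfolding charts_at_def using covering by blast

lemma chart_exists: "openin X W \<Longrightarrow> x \<in> W \<Longrightarrow> \<exists>c. c \<in> charts_at x"
  using charts_at_nonempty openin_subset by blast

lemma open_chart_image:
  assumes "c \<in> A" "openin X W"
  shows "open (snd c ` (W \<inter> fst c))"
proof -
  have "openin (subtopology X (fst c)) (W \<inter> fst c)"
    using assms by (simp add: openin_subtopology_Int)
  then have "openin (top_of_set (snd c ` fst c)) (snd c ` (W \<inter> fst c))"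
    using homeomorphic_imp_open_map[OF homeomorphic_chart[OF assms(1)]] by (simp add: open_map_def)
  then show ?thesis
    using open_chart_range[OF assms(1)] openin_open_trans by blast
qed

lemma open_chart_preimage:
  assumes "c \<in> A" "open S"
  shows "openin X {y \<in> fst c. snd c y \<in> S}"
proof -
  have sub: "fst c \<subseteq> topspace X"
    using openin_subset[OF open_chart_domain[OF assms(1)]] .
  have "continuous_map (subtopology X (fst c)) (top_of_set (snd c ` fst c)) (snd c)"
    using homeomorphic_imp_continuous_map[OF homeomorphic_chart[OF assms(1)]] .
  moreover have "openin (top_of_set (snd c ` fst c)) (snd c ` fst c \<inter> S)"
    using assms(2) by auto
  ultimately have "openin (subtopology X (fst c))
      {y \<in> topspace (subtopology X (fst c)). snd c y \<in> snd c ` fst c \<inter> S}"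
    by (rule openin_continuous_map_preimage)
  moreover have "{y \<in> topspace (subtopology X (fst c)). snd c y \<in> snd c ` fst c \<inter> S}
      = {y \<in> fst c. snd c y \<in> S}"
    using sub by auto
  ultimately show ?thesis
    using openin_trans_full[OF _ open_chart_domain[OF assms(1)]] by metis
qed

lemma inv_chart [simp]: "c \<in> A \<Longrightarrow> y \<in> fst c \<Longrightarrow> inv_into (fst c) (snd c) (snd c y) = y"
  using inj_on_chart inv_into_f_f by metis

lemma in_chart_eval [simp]: "c \<in> A \<Longrightarrow> y \<in> fst c \<Longrightarrow> in_chart c F (snd c y) = F y"
  by (simp add: in_chart_def)

lemma holo_funD:
  "holo_fun W F \<Longrightarrow> openin X W"
  "holo_fun W F \<Longrightarrow> c \<in> A \<Longrightarrow> in_chart c F holomorphic_on snd c ` (W \<inter> fst c)"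
  by (auto simp: holo_fun_def)

text \<open>One chart containing W is enough: in any other chart the expression of F is composed
  with a transition map, holomorphic by \<open>compatible\<close>.\<close>

lemma holo_funI_chart:
  assumes c: "c \<in> A" and W: "openin X W" "W \<subseteq> fst c"
    and hol: "in_chart c F holomorphic_on snd c ` W"
  shows "holo_fun W F"
  unfolding holo_fun_def
proof (intro conjI ballI W(1))
  fix d assume d: "d \<in> A"
  have "(snd c \<circ> inv_into (fst d) (snd d)) holomorphic_on snd d ` (fst d \<inter> fst c)"
    using compatible[of "fst d" "snd d" "fst c" "snd c"] c d by simp
  then have "(snd c \<circ> inv_into (fst d) (snd d)) holomorphic_on snd d ` (W \<inter> fst d)"
    by (rule holomorphic_on_subset) (use W in auto)
  then have "(in_chart c F \<circ> (snd c \<circ> inv_into (fst d) (snd d))) holomorphic_on snd d ` (W \<inter> fst d)"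
    by (rule holomorphic_on_compose_gen[OF _ hol]) (use d in auto)
  then show "in_chart d F holomorphic_on snd d ` (W \<inter> fst d)"
    by (rule holomorphic_transform) (use W c d in \<open>auto simp: in_chart_def\<close>)
qed

lemma holo_fun_subset: "holo_fun W F \<Longrightarrow> openin X W' \<Longrightarrow> W' \<subseteq> W \<Longrightarrow> holo_fun W' F"
  unfolding holo_fun_def by (meson Int_mono holomorphic_on_subset image_mono order_refl)

lemma holo_fun_cong:
  assumes "holo_fun W F" "\<And>x. x \<in> W \<Longrightarrow> F x = G x"
  shows "holo_fun W G"
  unfolding holo_fun_def
proof (intro conjI ballI)
  show "openin X W" using assms(1) by (rule holo_funD)
  fix c assume c: "c \<in> A"
  show "in_chart c G holomorphic_on snd c ` (W \<inter> fst c)"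
    by (rule holomorphic_transform[OF holo_funD(2)[OF assms(1) c]]) (use c assms(2) in auto)
qed

lemma holo_fun_localI:
  assumes W: "openin X W" and loc: "\<And>x. x \<in> W \<Longrightarrow> \<exists>N. x \<in> N \<and> holo_fun N F"
  shows "holo_fun W F"
  unfolding holo_fun_def
proof (intro conjI ballI W)
  fix c assume c: "c \<in> A"
  \<comment> \<open>Analyticity is a condition at each point, so it can be checked on the small sets
    given by \<open>loc\<close>; it implies holomorphy.\<close>
  have "in_chart c F analytic_on snd c ` (W \<inter> fst c)"
    unfolding analytic_on_def
  proof
    fix z assume "z \<in> snd c ` (W \<inter> fst c)"
    then obtain x where x: "x \<in> W" "x \<in> fst c" "z = snd c x" by auto
    obtain N where N: "x \<in> N" "holo_fun N F" using loc x by blast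
    have "open (snd c ` (N \<inter> fst c))" "z \<in> snd c ` (N \<inter> fst c)"
      using open_chart_image[OF c holo_funD(1)[OF N(2)]] N x by auto
    then obtain e where "e > 0" "ball z e \<subseteq> snd c ` (N \<inter> fst c)"
      using open_contains_ball by blast
    then show "\<exists>e>0. in_chart c F holomorphic_on ball z e"
      using holo_funD(2)[OF N(2) c] holomorphic_on_subset by blast
  qed
  then show "in_chart c F holomorphic_on snd c ` (W \<inter> fst c)"
    by (rule analytic_imp_holomorphic)
qed

lemma holo_fun_const: "openin X W \<Longrightarrow> holo_fun W (\<lambda>_. k)"
  by (auto simp: holo_fun_def in_chart_def o_def)

lemma holo_fun_add: "holo_fun W F \<Longrightarrow> holo_fun W G \<Longrightarrow> holo_fun W (\<lambda>x. F x + G x)"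
  and holo_fun_diff: "holo_fun W F \<Longrightarrow> holo_fun W G \<Longrightarrow> holo_fun W (\<lambda>x. F x - G x)"
  and holo_fun_mult: "holo_fun W F \<Longrightarrow> holo_fun W G \<Longrightarrow> holo_fun W (\<lambda>x. F x * G x)"
  and holo_fun_uminus: "holo_fun W F \<Longrightarrow> holo_fun W (\<lambda>x. - F x)"
  and holo_fun_power: "holo_fun W F \<Longrightarrow> holo_fun W (\<lambda>x. F x ^ n)"
  unfolding holo_fun_def in_chart_def o_def by (auto intro!: holomorphic_intros)

lemma holo_fun_divide:
  assumes "holo_fun W F" "holo_fun W G" "\<And>x. x \<in> W \<Longrightarrow> G x \<noteq> 0"
  shows "holo_fun W (\<lambda>x. F x / G x)"
  unfolding holo_fun_def
proof (intro conjI ballI)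
  show "openin X W" using assms(1) by (rule holo_funD)
  fix c assume c: "c \<in> A"
  have "(\<lambda>z. in_chart c F z / in_chart c G z) holomorphic_on snd c ` (W \<inter> fst c)"
    using assms c by (intro holomorphic_intros holo_funD) auto
  then show "in_chart c (\<lambda>x. F x / G x) holomorphic_on snd c ` (W \<inter> fst c)"
    by (simp add: in_chart_def o_def)
qed

lemma holo_fun_sum: "openin X W \<Longrightarrow> (\<And>i. i \<in> I \<Longrightarrow> holo_fun W (F i)) \<Longrightarrow> holo_fun W (\<lambda>x. \<Sum>i\<in>I. F i x)"
  by (induction I rule: infinite_finite_induct) (auto intro: holo_fun_const holo_fun_add)

lemma holo_fun_chart: "c \<in> A \<Longrightarrow> holo_fun (fst c) (snd c)"
  by (rule holo_funI_chart[OF _ open_chart_domain], auto)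
     (rule holomorphic_transform[of "\<lambda>z. z"], auto)

text \<open>Used to shrink a domain to where a Wronskian or a denominator does not vanish; openness
  is proved in a chart, where holomorphic functions are continuous.\<close>

lemma holo_fun_open_nonzero:
  assumes F: "holo_fun W F"
  shows "openin X {x \<in> W. F x \<noteq> 0}"
proof (subst openin_subopen, intro ballI)
  fix x assume x: "x \<in> {x \<in> W. F x \<noteq> 0}"
  have W: "openin X W" using F by (rule holo_funD)
  then obtain c where c: "c \<in> A" "x \<in> fst c"
    using x openin_subset[OF W] charts_at_nonempty[of x] by blast
  let ?Z = "snd c ` (W \<inter> fst c)"
  have "open (in_chart c F -` (- {0}) \<inter> ?Z)"
    using holo_funD(2)[OF F c(1)] open_chart_image[OF c(1) W]
    by (metis continuous_open_preimage holomorphic_on_imp_continuous_on open_Compl closed_singleton Int_commute)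
  then have op: "openin X {y \<in> fst c. snd c y \<in> in_chart c F -` (- {0}) \<inter> ?Z}"
    by (rule open_chart_preimage[OF c(1)])
  show "\<exists>T. openin X T \<and> x \<in> T \<and> T \<subseteq> {x \<in> W. F x \<noteq> 0}"
    by (rule exI, rule conjI, rule op) (use x c inj_on_chart[OF c(1)] in \<open>auto simp: inj_on_def\<close>)
qed

lemma cd_has_derivative:
  assumes "holo_fun W F" "x \<in> W" "c \<in> charts_at x"
  shows "(in_chart c F has_field_derivative cd c F x) (at (snd c x))"
  unfolding cd_def using assms
  by (intro holomorphic_derivI[OF holo_funD(2)[OF assms(1)] open_chart_image[OF _ holo_funD(1)[OF assms(1)]]])
     auto

lemma holo_fun_cd:
  assumes F: "holo_fun W F" and c: "c \<in> A"
  shows "holo_fun (W \<inter> fst c) (cd c F)"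
proof (rule holo_funI_chart[OF c])
  show op: "openin X (W \<inter> fst c)" using holo_funD(1)[OF F] open_chart_domain[OF c] by blast
  have "deriv (in_chart c F) holomorphic_on snd c ` (W \<inter> fst c)"
    using holo_funD[OF F] open_chart_image c by (intro holomorphic_deriv) auto
  then show "in_chart c (cd c F) holomorphic_on snd c ` (W \<inter> fst c)"
    by (rule holomorphic_transform) (use c in \<open>auto simp: cd_def\<close>)
qed auto

text \<open>Carries identities from open sets of the surface to the filter \<open>nhds\<close> in
  the plane, as \<open>deriv_cong_ev\<close> wants them.\<close>

lemma eventually_chart:
  assumes "openin X N" "x \<in> N" "c \<in> charts_at x"
  shows "eventually (\<lambda>z. \<exists>y\<in>N. y \<in> fst c \<and> z = snd c y) (nhds (snd c x))"
proof -
  have "open (snd c ` (N \<inter> fst c))" "snd c x \<in> snd c ` (N \<inter> fst c)"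
    using open_chart_image assms by auto
  then show ?thesis
    by (auto intro!: eventually_nhds[THEN iffD2] exI[of _ "snd c ` (N \<inter> fst c)"])
qed

lemma cd_cong:
  assumes "openin X N" "x \<in> N" "c \<in> charts_at x" "\<And>y. y \<in> N \<Longrightarrow> y \<in> fst c \<Longrightarrow> F y = G y"
  shows "cd c F x = cd c G x"
  unfolding cd_def
  by (rule deriv_cong_ev[OF eventually_mono[OF eventually_chart[OF assms(1-3)]] refl])
     (use assms in auto)

lemma cd_const: "cd c (\<lambda>_. k) x = 0"
  by (simp add: cd_def in_chart_def o_def)

lemma cd_add:
  assumes "holo_fun W F" "holo_fun W G" "x \<in> W" "c \<in> charts_at x"
  shows "cd c (\<lambda>y. F y + G y) x = cd c F x + cd c G x"
  using DERIV_imp_deriv[OF DERIV_add[OF cd_has_derivative[OF assms(1,3,4)] cd_has_derivative[OF assms(2,3,4)]]]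
  by (simp add: cd_def in_chart_def o_def)

lemma cd_diff:
  assumes "holo_fun W F" "holo_fun W G" "x \<in> W" "c \<in> charts_at x"
  shows "cd c (\<lambda>y. F y - G y) x = cd c F x - cd c G x"
  using DERIV_imp_deriv[OF DERIV_diff[OF cd_has_derivative[OF assms(1,3,4)] cd_has_derivative[OF assms(2,3,4)]]]
  by (simp add: cd_def in_chart_def o_def)

lemma cd_uminus:
  assumes "holo_fun W F" "x \<in> W" "c \<in> charts_at x"
  shows "cd c (\<lambda>y. - F y) x = - cd c F x"
  using DERIV_imp_deriv[OF DERIV_minus[OF cd_has_derivative[OF assms]]]
  by (simp add: cd_def in_chart_def o_def)

lemma cd_mult:
  assumes "holo_fun W F" "holo_fun W G" "x \<in> W" "c \<in> charts_at x"
  shows "cd c (\<lambda>y. F y * G y) x = cd c F x * G x + F x * cd c G x"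
  using DERIV_imp_deriv[OF DERIV_mult[OF cd_has_derivative[OF assms(1,3,4)] cd_has_derivative[OF assms(2,3,4)]]] assms
  by (simp add: cd_def in_chart_def o_def charts_at_iff)

lemma cd_cmult:
  assumes "holo_fun W F" "x \<in> W" "c \<in> charts_at x"
  shows "cd c (\<lambda>y. k * F y) x = k * cd c F x"
  using cd_mult[OF holo_fun_const[OF holo_funD(1)[OF assms(1)]] assms(1) assms(2,3), of k] by (simp add: cd_const)

lemma cd_divide:
  assumes "holo_fun W F" "holo_fun W G" "x \<in> W" "c \<in> charts_at x" "G x \<noteq> 0"
  shows "cd c (\<lambda>y. F y / G y) x = (cd c F x * G x - F x * cd c G x) / (G x * G x)"
proof -
  have [simp]: "c \<in> A" "x \<in> fst c" using assms by auto
  have "in_chart c G (snd c x) \<noteq> 0" using assms by simp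
  from DERIV_imp_deriv[OF DERIV_divide[OF cd_has_derivative[OF assms(1,3,4)] cd_has_derivative[OF assms(2,3,4)] this]]
  show ?thesis by (simp add: cd_def in_chart_def o_def)
qed

lemma cd_sum:
  assumes "openin X W" "\<And>i. i \<in> I \<Longrightarrow> holo_fun W (F i)" "x \<in> W" "c \<in> charts_at x"
  shows "cd c (\<lambda>y. \<Sum>i\<in>I. F i y) x = (\<Sum>i\<in>I. cd c (F i) x)"
  using assms
proof (induction I rule: infinite_finite_induct)
  case (insert i I)
  then show ?case
    by (simp add: cd_add[OF _ holo_fun_sum[OF assms(1), of I F]])
qed (simp_all add: cd_const)

lemma cd_self: "c \<in> charts_at x \<Longrightarrow> cd c (snd c) x = 1"
proof -
  assume c: "c \<in> charts_at x"
  have "eventually (\<lambda>z. in_chart c (snd c) z = z) (nhds (snd c x))"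
    by (rule eventually_mono[OF eventually_chart[OF open_chart_domain _ c]]) (use c in auto)
  from deriv_cong_ev[OF this refl] show ?thesis by (simp add: cd_def)
qed

lemma cd_chain:
  assumes F: "holo_fun W F" and x: "x \<in> W" and c: "c \<in> charts_at x" and d: "d \<in> charts_at x"
  shows "cd c F x = cd c (snd d) x * cd d F x"
proof -
  have [simp]: "c \<in> A" "d \<in> A" "x \<in> fst c" "x \<in> fst d" using c d by auto
  have "((in_chart d F \<circ> in_chart c (snd d)) has_field_derivative cd d F x * cd c (snd d) x) (at (snd c x))"
    by (rule DERIV_chain)
       (use cd_has_derivative[OF F x d] cd_has_derivative[OF holo_fun_chart, of d x c] c d in auto)
  moreover have "eventually (\<lambda>z. (in_chart d F \<circ> in_chart c (snd d)) z = in_chart c F z) (nhds (snd c x))"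
    by (rule eventually_mono[OF eventually_chart[OF open_chart_domain[of d] _ c]]) (use c d in auto)
  ultimately show ?thesis
    using DERIV_imp_deriv deriv_cong_ev by (metis cd_def mult.commute)
qed

text \<open>Differentiating the coordinate of \<open>c\<close> through \<open>d\<close> by the chain
  rule writes 1 as a product with this factor.\<close>

lemma transition_nonzero:
  assumes "c \<in> charts_at x" "d \<in> charts_at x"
  shows "cd c (snd d) x \<noteq> 0"
  using cd_chain[OF holo_fun_chart _ assms, of c] cd_self[OF assms(1)] charts_atD[OF assms(1)] by force

text \<open>The chart image of W contains a disc, and convexity gives a constant there. Only a
  neighbourhood of x can be claimed, since W may be disconnected.\<close>

lemma cd_zero_imp_const:
  assumes F: "holo_fun W F" and x: "x \<in> W" and c: "c \<in> charts_at x"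
    and z: "\<And>y. y \<in> W \<Longrightarrow> y \<in> fst c \<Longrightarrow> cd c F y = 0"
  shows "\<exists>N. openin X N \<and> x \<in> N \<and> N \<subseteq> W \<and> (\<forall>y\<in>N. F y = F x)"
proof -
  have [simp]: "c \<in> A" "x \<in> fst c" using c by auto
  have W: "openin X W" using F by (rule holo_funD)
  have "open (snd c ` (W \<inter> fst c))" "snd c x \<in> snd c ` (W \<inter> fst c)"
    using open_chart_image W x by auto
  then obtain e where e: "e > 0" "ball (snd c x) e \<subseteq> snd c ` (W \<inter> fst c)"
    using open_contains_ball by blast
  have "\<exists>k. \<forall>y \<in> ball (snd c x) e. in_chart c F y = k"
  proof (rule has_field_derivative_zero_constant)
    fix w assume w: "w \<in> ball (snd c x) e"
    then obtain y where y: "y \<in> W" "y \<in> fst c" "w = snd c y" using e by auto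
    have "(in_chart c F has_field_derivative 0) (at w)"
      using cd_has_derivative[OF F y(1), of c] z[OF y(1,2)] y by (simp add: charts_at_iff)
    then show "(in_chart c F has_field_derivative 0) (at w within ball (snd c x) e)"
      by (rule has_field_derivative_at_within)
  qed simp
  then obtain k where k: "\<And>y. y \<in> ball (snd c x) e \<Longrightarrow> in_chart c F y = k" by blast
  let ?N = "{y \<in> fst c. snd c y \<in> ball (snd c x) e} \<inter> W"
  have F': "F y = k" if "y \<in> ?N" for y using k[of "snd c y"] that by simp
  have "x \<in> ?N" using e x by simp
  moreover have "openin X ?N" using open_chart_preimage[of c "ball (snd c x) e"] W by (intro openin_Int) simp_all
  ultimately show ?thesis using F' by (intro exI[of _ ?N]) auto
qed

section \<open>Tangent vectors, vector fields and holomorphic sections\<close>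

lemma charts_at_topspace: "c \<in> charts_at x \<Longrightarrow> x \<in> topspace X"
  using openin_subset[OF open_chart_domain] charts_atD by blast

lemma openin_chart_Int: "openin X W \<Longrightarrow> c \<in> A \<Longrightarrow> openin X (W \<inter> fst c)"
  using open_chart_domain by blast

lemma tangent_iff:
  "v \<in> tangent x \<longleftrightarrow> (\<forall>c. c \<notin> charts_at x \<longrightarrow> v c = 0) \<and>
     (\<forall>c\<in>charts_at x. \<forall>d\<in>charts_at x. v d = cd c (snd d) x * v c)"
  by (simp add: tangent_def cd_def)

lemma tangent_transition:
  "v \<in> tangent x \<Longrightarrow> c \<in> charts_at x \<Longrightarrow> d \<in> charts_at x \<Longrightarrow> v d = cd c (snd d) x * v c"
  unfolding tangent_iff by blast

lemma tangent_zero: "v \<in> tangent x \<Longrightarrow> c \<notin> charts_at x \<Longrightarrow> v c = 0"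
  unfolding tangent_iff by blast

lemma tangent_eqI:
  assumes "u \<in> tangent x" "v \<in> tangent x" "c \<in> charts_at x" "u c = v c"
  shows "u = v"
proof
  fix d show "u d = v d"
    by (cases "d \<in> charts_at x") (metis assms tangent_transition, metis assms tangent_zero)
qed

lemma tangentI:
  "(\<And>c. c \<notin> charts_at x \<Longrightarrow> v c = 0) \<Longrightarrow>
    (\<And>c d. c \<in> charts_at x \<Longrightarrow> d \<in> charts_at x \<Longrightarrow> v d = cd c (snd d) x * v c) \<Longrightarrow> v \<in> tangent x"
  unfolding tangent_iff by blast

lemma tangent_lin:
  assumes "u \<in> tangent x" "v \<in> tangent x"
  shows "(\<lambda>c. a * u c + b * v c) \<in> tangent x"
proof (rule tangentI)
  fix c d assume cd: "c \<in> charts_at x" "d \<in> charts_at x"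
  show "a * u d + b * v d = cd c (snd d) x * (a * u c + b * v c)"
    unfolding tangent_transition[OF assms(1) cd] tangent_transition[OF assms(2) cd]
    by (simp add: algebra_simps)
qed (simp add: tangent_zero[OF assms(1)] tangent_zero[OF assms(2)])

lemma tangent_scale: "u \<in> tangent x \<Longrightarrow> (\<lambda>c. a * u c) \<in> tangent x"
  using tangent_lin[of u x u a 0] by simp

lemma transition_cocycle:
  assumes "c \<in> charts_at x" "d \<in> charts_at x" "e \<in> charts_at x"
  shows "cd c (snd e) x = cd d (snd e) x * cd c (snd d) x"
  using cd_chain[OF holo_fun_chart[of e] _ assms(1,2)] charts_atD[OF assms(3)] by (simp add: mult.commute)

lemma coord_vec_eq: "coord_vec c x d = (if d \<in> charts_at x then cd c (snd d) x else 0)"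
  by (simp add: coord_vec_def cd_def)

lemma coord_vec_self: "c \<in> charts_at x \<Longrightarrow> coord_vec c x c = 1"
  by (simp add: coord_vec_eq cd_self)

lemma coord_vec_tangent: "c \<in> charts_at x \<Longrightarrow> coord_vec c x \<in> tangent x"
  by (rule tangentI) (auto simp: coord_vec_eq intro: transition_cocycle)

lemma tangent_eq_coord_vec:
  assumes "v \<in> tangent x" "c \<in> charts_at x"
  shows "v = (\<lambda>d. v c * coord_vec c x d)"
  by (rule tangent_eqI[OF assms(1) tangent_scale[OF coord_vec_tangent] assms(2)])
     (use assms in \<open>simp_all add: coord_vec_self\<close>)

lemma holo_fun_in_chartI:
  assumes "c \<in> A" "openin X W" "in_chart c F holomorphic_on snd c ` (W \<inter> fst c)"
  shows "holo_fun (W \<inter> fst c) F"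
  using assms by (intro holo_funI_chart[of c] openin_chart_Int) auto

lemma holo_fun_in_chart_iff:
  assumes "c \<in> A" "openin X W"
  shows "in_chart c F holomorphic_on snd c ` (W \<inter> fst c) \<longleftrightarrow> holo_fun (W \<inter> fst c) F"
  using holo_fun_in_chartI[OF assms] holo_funD(2)[of "W \<inter> fst c" F c] assms by (auto simp: Int_assoc)

lemma holo_vf_iff:
  "holo_vf W s \<longleftrightarrow> openin X W \<and> (\<forall>x\<in>W. s x \<in> tangent x) \<and> (\<forall>c\<in>A. holo_fun (W \<inter> fst c) (\<lambda>y. s y c))"
  unfolding holo_vf_def using holo_fun_in_chart_iff by blast

lemma holo_section_iff:
  "holo_section W \<sigma> \<longleftrightarrow> openin X W \<and> (\<forall>x\<in>W. \<sigma> x \<in> J 2 x) \<and>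
     (\<forall>c\<in>A. \<forall>i\<le>2. holo_fun (W \<inter> fst c) (\<lambda>y. \<sigma> y c i))"
  unfolding holo_section_def using holo_fun_in_chart_iff by blast

lemma holo_vfD:
  "holo_vf W s \<Longrightarrow> openin X W"
  "holo_vf W s \<Longrightarrow> x \<in> W \<Longrightarrow> s x \<in> tangent x"
  "holo_vf W s \<Longrightarrow> c \<in> A \<Longrightarrow> holo_fun (W \<inter> fst c) (\<lambda>y. s y c)"
  by (auto simp: holo_vf_iff)

lemma holo_sectionD:
  "holo_section W \<sigma> \<Longrightarrow> openin X W"
  "holo_section W \<sigma> \<Longrightarrow> x \<in> W \<Longrightarrow> \<sigma> x \<in> J 2 x"
  "holo_section W \<sigma> \<Longrightarrow> c \<in> A \<Longrightarrow> i \<le> 2 \<Longrightarrow> holo_fun (W \<inter> fst c) (\<lambda>y. \<sigma> y c i)"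
  by (auto simp: holo_section_iff)

lemma holo_vf_subset: "holo_vf W s \<Longrightarrow> openin X W' \<Longrightarrow> W' \<subseteq> W \<Longrightarrow> holo_vf W' s"
  unfolding holo_vf_def by (meson Int_mono holomorphic_on_subset image_mono order_refl subsetD)

lemma holo_section_subset: "holo_section W s \<Longrightarrow> openin X W' \<Longrightarrow> W' \<subseteq> W \<Longrightarrow> holo_section W' s"
  unfolding holo_section_def by (meson Int_mono holomorphic_on_subset image_mono order_refl subsetD)

lemma holo_vf_localI:
  assumes W: "openin X W"
    and loc: "\<And>x. x \<in> W \<Longrightarrow> \<exists>N t. x \<in> N \<and> holo_vf N t \<and> (\<forall>y\<in>N. s y = t y)"
  shows "holo_vf W s"
  unfolding holo_vf_iff
proof (intro conjI ballI W)
  fix x assume "x \<in> W"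
  then show "s x \<in> tangent x" using loc holo_vfD(2) by metis
next
  fix c assume c: "c \<in> A"
  show "holo_fun (W \<inter> fst c) (\<lambda>y. s y c)"
  proof (rule holo_fun_localI[OF openin_chart_Int[OF W c]])
    fix x assume x: "x \<in> W \<inter> fst c"
    obtain N t where N: "x \<in> N" "holo_vf N t" "\<forall>y\<in>N. s y = t y" using loc[OF IntD1[OF x]] by (elim exE conjE)
    have "holo_fun (N \<inter> fst c) (\<lambda>y. s y c)"
      by (rule holo_fun_cong[OF holo_vfD(3)[OF N(2) c]]) (use N in auto)
    then show "\<exists>N. x \<in> N \<and> holo_fun N (\<lambda>y. s y c)" using x N by blast
  qed
qed

lemma holo_section_localI:
  assumes W: "openin X W"
    and loc: "\<And>x. x \<in> W \<Longrightarrow> \<exists>N t. x \<in> N \<and> holo_section N t \<and> (\<forall>y\<in>N. s y = t y)"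
  shows "holo_section W s"
  unfolding holo_section_iff
proof (intro conjI ballI allI impI W)
  fix x assume "x \<in> W"
  then show "s x \<in> J 2 x" using loc holo_sectionD(2) by metis
next
  fix c and i :: nat assume c: "c \<in> A" and i: "i \<le> 2"
  show "holo_fun (W \<inter> fst c) (\<lambda>y. s y c i)"
  proof (rule holo_fun_localI[OF openin_chart_Int[OF W c]])
    fix x assume x: "x \<in> W \<inter> fst c"
    obtain N t where N: "x \<in> N" "holo_section N t" "\<forall>y\<in>N. s y = t y" using loc[OF IntD1[OF x]] by (elim exE conjE)
    have "holo_fun (N \<inter> fst c) (\<lambda>y. s y c i)"
      by (rule holo_fun_cong[OF holo_sectionD(3)[OF N(2) c i]]) (use N in auto)
    then show "\<exists>N. x \<in> N \<and> holo_fun N (\<lambda>y. s y c i)" using x N by blast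
  qed
qed

lemma holo_section_cong:
  assumes "holo_section W s" "\<And>y. y \<in> W \<Longrightarrow> s y = t y"
  shows "holo_section W t"
  by (rule holo_section_localI[OF holo_sectionD(1)[OF assms(1)]]) (use assms in metis)

lemma holo_fun_transition:
  "c \<in> A \<Longrightarrow> d \<in> A \<Longrightarrow> holo_fun (fst c \<inter> fst d) (cd c (snd d))"
  using holo_fun_cd[OF holo_fun_chart] by (metis Int_commute)

lemma holo_vf_coord:
  assumes c: "c \<in> A" and F: "holo_fun N F" and N: "N \<subseteq> fst c"
  shows "holo_vf N (\<lambda>y d. F y * coord_vec c y d)"
  unfolding holo_vf_iff
proof (intro conjI ballI)
  show op: "openin X N" using F by (rule holo_funD)
  fix x assume "x \<in> N"
  then show "(\<lambda>d. F x * coord_vec c x d) \<in> tangent x"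
    using c N by (intro tangent_scale coord_vec_tangent) (auto simp: charts_at_iff)
next
  fix d assume d: "d \<in> A"
  have op: "openin X (N \<inter> fst d)" using holo_funD(1)[OF F] d by (rule openin_chart_Int)
  have "holo_fun (N \<inter> fst d) (\<lambda>y. F y * cd c (snd d) y)"
    by (intro holo_fun_mult holo_fun_subset[OF F op] holo_fun_subset[OF holo_fun_transition[OF c d] op])
       (use N in auto)
  then show "holo_fun (N \<inter> fst d) (\<lambda>y. F y * coord_vec c y d)"
    by (rule holo_fun_cong) (use d in \<open>auto simp: coord_vec_eq charts_at_iff\<close>)
qed

lemma holo_vf_comb:
  fixes s :: "nat \<Rightarrow> 'a \<Rightarrow> 'a tvec"
  assumes W: "openin X W" and s: "\<And>i. i < 3 \<Longrightarrow> holo_vf W (s i)"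
    and f: "\<And>i. i < 3 \<Longrightarrow> holo_fun W (f i)"
  shows "holo_vf W (\<lambda>y c. \<Sum>i<3. f i y * s i y c)"
  unfolding holo_vf_iff
proof (intro conjI ballI W)
  fix x assume x: "x \<in> W"
  have "(\<lambda>c. 1 * (1 * (f 0 x * s 0 x c) + 1 * (f 1 x * s 1 x c)) + 1 * (f 2 x * s 2 x c)) \<in> tangent x"
    by (intro tangent_lin tangent_scale holo_vfD(2)[OF s x]) auto
  then show "(\<lambda>c. \<Sum>i<3. f i x * s i x c) \<in> tangent x"
    by (simp add: sum_lessThan_3)
next
  fix c assume c: "c \<in> A"
  show "holo_fun (W \<inter> fst c) (\<lambda>y. \<Sum>i<3. f i y * s i y c)"
    by (intro holo_fun_sum holo_fun_mult holo_vfD(3)[OF s c] holo_fun_subset[OF f] openin_chart_Int W c) auto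
qed

section \<open>Jets in coordinates\<close>

lemma jet_0: "c \<in> charts_at x \<Longrightarrow> jet k s x c 0 = s x c"
  by (simp add: jet_def charts_at_iff)

lemma jet_1: "c \<in> charts_at x \<Longrightarrow> 1 \<le> k \<Longrightarrow> jet k s x c (Suc 0) = cd c (\<lambda>y. s y c) x"
  by (simp add: jet_def cd_def)

lemma jet_2: "c \<in> charts_at x \<Longrightarrow> 2 \<le> k \<Longrightarrow> jet k s x c 2 = cd c (cd c (\<lambda>y. s y c)) x"
proof -
  assume c: "c \<in> charts_at x" and k: "2 \<le> k"
  have "deriv (deriv (in_chart c (\<lambda>y. s y c))) (snd c x) = cd c (cd c (\<lambda>y. s y c)) x"
    unfolding cd_def[of c "cd c _"]
    by (rule deriv_cong_ev[OF eventually_mono[OF eventually_chart[OF open_chart_domain _ c]]])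
       (use c in \<open>auto simp: cd_def\<close>)
  then show ?thesis using c k by (simp add: jet_def numeral_2_eq_2)
qed

lemma jet_outside: "c \<notin> charts_at x \<or> \<not> i \<le> k \<Longrightarrow> jet k s x c i = 0"
  by (auto simp: jet_def)

lemma cd_jet:
  assumes c: "c \<in> charts_at x"
  shows "cd c (\<lambda>y. jet 2 s y c 0) x = jet 2 s x c (Suc 0)" "cd c (\<lambda>y. jet 2 s y c (Suc 0)) x = jet 2 s x c 2"
proof -
  have cA: "c \<in> A" "x \<in> fst c" using c by auto
  note cong = cd_cong[OF open_chart_domain[OF cA(1)] cA(2) c]
  show "cd c (\<lambda>y. jet 2 s y c 0) x = jet 2 s x c (Suc 0)"
    unfolding jet_1[OF c, of 2, simplified] by (rule cong) (simp add: jet_0 charts_at_iff cA)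
  show "cd c (\<lambda>y. jet 2 s y c (Suc 0)) x = jet 2 s x c 2"
    unfolding jet_2[OF c order_refl] by (rule cong) (simp add: jet_1 charts_at_iff cA)
qed

lemma jet_cong:
  assumes "openin X N" "x \<in> N" "\<And>y. y \<in> N \<Longrightarrow> s y = t y"
  shows "jet 2 s x = jet 2 t x"
proof (intro ext)
  fix c and i :: nat
  have eq: "cd c (\<lambda>y. s y c) y = cd c (\<lambda>y. t y c) y" if "c \<in> charts_at y" "y \<in> N" for y
    by (rule cd_cong[OF assms(1) that(2,1)]) (use assms in auto)
  have "cd c (cd c (\<lambda>y. s y c)) x = cd c (cd c (\<lambda>y. t y c)) x" if "c \<in> charts_at x"
    by (rule cd_cong[OF assms(1,2) that eq]) (use that in \<open>auto simp: charts_at_iff\<close>)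
  then have "jet 2 s x c i = jet 2 t x c i" if "c \<in> charts_at x" "i = 0 \<or> i = Suc 0 \<or> i = 2"
    using that assms eq by (auto simp: jet_0 jet_1 jet_2)
  then show "jet 2 s x c i = jet 2 t x c i"
    using jet_outside[of c x i 2] by (metis One_nat_def Suc_1 le_Suc_eq le_zero_eq)
qed

text \<open>With w the coordinate of \<open>d\<close> as a function of that of \<open>c\<close>,
  this is w''/w', the inhomogeneous term in the change of first derivatives.\<close>

definition tr1 :: "'a chart \<Rightarrow> 'a chart \<Rightarrow> 'a \<Rightarrow> complex" where
  "tr1 c d y = cd c (cd c (snd d)) y / cd c (snd d) y"

lemma holo_fun_tr1: "c \<in> A \<Longrightarrow> d \<in> A \<Longrightarrow> holo_fun (fst c \<inter> fst d) (tr1 c d)"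
  unfolding tr1_def
  using holo_fun_cd[OF holo_fun_transition, of c d c] transition_nonzero
  by (intro holo_fun_divide holo_fun_transition) (auto simp: Int_assoc Int_commute charts_at_iff)

lemma holo_fun_cd_tr1: "c \<in> A \<Longrightarrow> d \<in> A \<Longrightarrow> holo_fun (fst c \<inter> fst d) (cd c (tr1 c d))"
  using holo_fun_cd[OF holo_fun_tr1, of c d c] by (simp add: Int_ac)

text \<open>Differentiate s_d = w' s_c in the coordinate of \<open>c\<close> and divide by w' to
  obtain the derivative in that of \<open>d\<close>; a second round gives the last formula. Together
  these are the cocycle of the bundle of 2-jets.\<close>

lemma field_transition:
  assumes s: "holo_vf W s" and x: "x \<in> W" and c: "c \<in> charts_at x" and d: "d \<in> charts_at x"
  shows "s x d = cd c (snd d) x * s x c"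
    and "cd d (\<lambda>y. s y d) x = tr1 c d x * s x c + cd c (\<lambda>y. s y c) x"
    and "cd d (cd d (\<lambda>y. s y d)) x =
      (cd c (tr1 c d) x * s x c + tr1 c d x * cd c (\<lambda>y. s y c) x + cd c (cd c (\<lambda>y. s y c)) x) / cd c (snd d) x"
proof -
  have cA: "c \<in> A" "d \<in> A" using c d by auto
  let ?N = "W \<inter> (fst c \<inter> fst d)"
  have op: "openin X ?N"
    using holo_vfD(1)[OF s] open_chart_domain cA by blast
  have hc: "holo_fun ?N (\<lambda>y. s y c)" and hd: "holo_fun ?N (\<lambda>y. s y d)"
    using holo_fun_subset[OF holo_vfD(3)[OF s cA(1)] op] holo_fun_subset[OF holo_vfD(3)[OF s cA(2)] op]
    by blast+
  have hcc: "holo_fun ?N (cd c (\<lambda>y. s y c))" and hdd: "holo_fun ?N (cd d (\<lambda>y. s y d))"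
    using holo_fun_subset[OF holo_fun_cd[OF holo_vfD(3)[OF s cA(1)] cA(1)] op]
      holo_fun_subset[OF holo_fun_cd[OF holo_vfD(3)[OF s cA(2)] cA(2)] op] by blast+
  have ht: "holo_fun ?N (cd c (snd d))" and hr: "holo_fun ?N (tr1 c d)"
    using holo_fun_subset[OF holo_fun_transition[OF cA] op] holo_fun_subset[OF holo_fun_tr1[OF cA] op] by blast+
  have ch: "c \<in> charts_at y" "d \<in> charts_at y" if "y \<in> ?N" for y
    using that cA by (auto simp: charts_at_iff)
  have 0: "s y d = cd c (snd d) y * s y c" if "y \<in> ?N" for y
    using tangent_transition[OF holo_vfD(2)[OF s] ch[OF that]] that by auto
  have 1: "cd d (\<lambda>y. s y d) y = tr1 c d y * s y c + cd c (\<lambda>y. s y c) y" if y: "y \<in> ?N" for y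
  proof -
    have "cd c (\<lambda>y. s y d) y = cd c (\<lambda>y. cd c (snd d) y * s y c) y"
      by (rule cd_cong[OF op y ch(1)[OF y]]) (rule 0)
    also have "\<dots> = cd c (cd c (snd d)) y * s y c + cd c (snd d) y * cd c (\<lambda>y. s y c) y"
      by (rule cd_mult[OF ht hc y ch(1)[OF y]])
    finally show ?thesis
      using cd_chain[OF hd y ch[OF y]] transition_nonzero[OF ch[OF y]] by (simp add: tr1_def field_simps)
  qed
  have 2: "cd d (cd d (\<lambda>y. s y d)) y =
      (cd c (tr1 c d) y * s y c + tr1 c d y * cd c (\<lambda>y. s y c) y + cd c (cd c (\<lambda>y. s y c)) y) / cd c (snd d) y"
    if y: "y \<in> ?N" for y
  proof -
    have "cd c (cd d (\<lambda>y. s y d)) y = cd c (\<lambda>y. tr1 c d y * s y c + cd c (\<lambda>y. s y c) y) y"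
      by (rule cd_cong[OF op y ch(1)[OF y]]) (rule 1)
    also have "\<dots> = cd c (tr1 c d) y * s y c + tr1 c d y * cd c (\<lambda>y. s y c) y + cd c (cd c (\<lambda>y. s y c)) y"
      using cd_add[OF holo_fun_mult[OF hr hc] hcc y ch(1)[OF y]] cd_mult[OF hr hc y ch(1)[OF y]] by simp
    finally show ?thesis
      using cd_chain[OF hdd y ch[OF y]] transition_nonzero[OF ch[OF y]] by (simp add: field_simps)
  qed
  have xN: "x \<in> ?N" using x c d by auto
  show "s x d = cd c (snd d) x * s x c"
    and "cd d (\<lambda>y. s y d) x = tr1 c d x * s x c + cd c (\<lambda>y. s y c) x"
    and "cd d (cd d (\<lambda>y. s y d)) x =
      (cd c (tr1 c d) x * s x c + tr1 c d x * cd c (\<lambda>y. s y c) x + cd c (cd c (\<lambda>y. s y c)) x) / cd c (snd d) x"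
    using 0[OF xN] 1[OF xN] 2[OF xN] by auto
qed

text \<open>The jet with derivatives a0, a1, a2 in the chart \<open>c\<close>. The entries in other
  charts copy \<open>field_transition\<close>, so a chart turns 2-jets at x into triples of
  numbers.\<close>

definition jet_of :: "'a chart \<Rightarrow> complex \<Rightarrow> complex \<Rightarrow> complex \<Rightarrow> 'a \<Rightarrow> 'a jet" where
  "jet_of c a0 a1 a2 x = (\<lambda>d i. if d \<in> charts_at x then
     (if i = 0 then cd c (snd d) x * a0
      else if i = 1 then tr1 c d x * a0 + a1
      else if i = 2 then (cd c (tr1 c d) x * a0 + tr1 c d x * a1 + a2) / cd c (snd d) x
      else 0) else 0)"

lemma J_eq_jet_of:
  assumes j: "j \<in> J 2 x" and c: "c \<in> charts_at x"
  shows "j = jet_of c (j c 0) (j c (Suc 0)) (j c 2) x"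
proof -
  obtain W s where s: "holo_vf W s" "x \<in> W" "j = jet 2 s x" using j by (auto simp: J_def)
  show ?thesis
  proof (intro ext)
    fix d and i :: nat
    show "j d i = jet_of c (j c 0) (j c (Suc 0)) (j c 2) x d i"
    proof (cases "d \<in> charts_at x \<and> i \<le> 2")
      case True
      then consider "i = 0" | "i = Suc 0" | "i = 2" by linarith
      then show ?thesis
        using True c field_transition[OF s(1,2) c, of d]
        by cases (simp_all add: jet_of_def s(3) jet_0 jet_1 jet_2)
    next
      case False
      then show ?thesis using jet_outside[of d x i 2] by (auto simp: jet_of_def s(3))
    qed
  qed
qed

lemma J_topspace: "j \<in> J k x \<Longrightarrow> x \<in> topspace X"
  using holo_vfD(1) openin_subset by (fastforce simp: J_def)

lemma J_eqI:
  assumes "j \<in> J 2 x" "k \<in> J 2 x" "c \<in> charts_at x"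
    and "j c 0 = k c 0" "j c (Suc 0) = k c (Suc 0)" "j c 2 = k c 2"
  shows "j = k"
  using J_eq_jet_of[OF assms(1,3)] J_eq_jet_of[OF assms(2,3)] assms by metis

lemma J_outside: "j \<in> J 2 x \<Longrightarrow> c \<notin> charts_at x \<or> \<not> i \<le> 2 \<Longrightarrow> j c i = 0"
  using jet_outside[of c x i 2] by (auto simp: J_def)

lemma jet_coord_field:
  assumes c: "c \<in> charts_at x" and F: "holo_fun N F" "x \<in> N" and d: "d \<in> charts_at x"
  shows "jet k (\<lambda>y d. F y * coord_vec c y d) x d 0 = F x * cd c (snd d) x"
    and "1 \<le> k \<Longrightarrow> jet k (\<lambda>y d. F y * coord_vec c y d) x d (Suc 0) = tr1 c d x * F x + cd c F x"
    and "2 \<le> k \<Longrightarrow> jet k (\<lambda>y d. F y * coord_vec c y d) x d 2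
      = (cd c (tr1 c d) x * F x + tr1 c d x * cd c F x + cd c (cd c F) x) / cd c (snd d) x"
proof -
  let ?s = "\<lambda>y d. F y * coord_vec c y d"
  have cA: "c \<in> A" "x \<in> fst c" using c by auto
  have op: "openin X (N \<inter> fst c)" using holo_funD(1)[OF F(1)] cA(1) by (rule openin_chart_Int)
  have s: "holo_vf (N \<inter> fst c) ?s"
    using holo_vf_coord[OF cA(1) holo_fun_subset[OF F(1) op]] by auto
  have xN: "x \<in> N \<inter> fst c" using F c by auto
  have 1: "cd c (\<lambda>y. ?s y c) y = cd c F y" if "y \<in> N \<inter> fst c" for y
    by (rule cd_cong[OF op that]) (use cA that in \<open>auto simp: charts_at_iff coord_vec_self\<close>)
  have 2: "cd c (cd c (\<lambda>y. ?s y c)) x = cd c (cd c F) x"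
    by (rule cd_cong[OF op xN c 1]) auto
  show "jet k ?s x d 0 = F x * cd c (snd d) x"
    using d by (simp add: jet_0 coord_vec_eq)
  show "jet k ?s x d (Suc 0) = tr1 c d x * F x + cd c F x" if "1 \<le> k"
    using that jet_1[OF d, of k ?s] field_transition(2)[OF s xN c d] 1[OF xN] coord_vec_self[OF c] by simp
  show "jet k ?s x d 2
      = (cd c (tr1 c d) x * F x + tr1 c d x * cd c F x + cd c (cd c F) x) / cd c (snd d) x" if "2 \<le> k"
    using that jet_2[OF d, of k ?s] field_transition(3)[OF s xN c d] 1[OF xN] 2 coord_vec_self[OF c] by simp
qed

text \<open>The jet is realized by the coordinate field multiplied by the Taylor polynomial with
  coefficients a0, a1, a2/2.\<close>

lemma jet_of_in_J:
  assumes c: "c \<in> charts_at x"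
  shows "jet_of c a0 a1 a2 x \<in> J 2 x"
proof -
  have cA: "c \<in> A" "x \<in> fst c" using c by auto
  have op: "openin X (fst c)" using open_chart_domain cA by blast
  define k where "k = a2 / 2"
  define F where "F = (\<lambda>y. a0 + (a1 * (snd c y - snd c x) + k * (snd c y - snd c x) ^ 2))"
  have hl: "holo_fun (fst c) (\<lambda>y. snd c y - snd c x)"
    by (intro holo_fun_diff holo_fun_chart holo_fun_const op cA)
  have F: "holo_fun (fst c) F"
    unfolding F_def by (intro holo_fun_add holo_fun_mult holo_fun_power hl holo_fun_const op)
  have dl: "cd c (\<lambda>y. snd c y - snd c x) y = 1" if "y \<in> fst c" for y
    using cd_diff[OF holo_fun_chart holo_fun_const[OF op] that] cA that
    by (simp add: charts_at_iff cd_const cd_self)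
  have 1: "cd c F y = a1 + a2 * (snd c y - snd c x)" if y: "y \<in> fst c" for y
  proof -
    have cy: "c \<in> charts_at y" using y cA by (simp add: charts_at_iff)
    show ?thesis
      unfolding F_def power2_eq_square
      using y by (simp add: cd_add[OF _ _ y cy] cd_cmult[OF _ y cy] cd_mult[OF _ _ y cy] dl cd_const
          holo_fun_add holo_fun_mult hl holo_fun_const op) (simp add: k_def)
  qed
  have 2: "cd c (cd c F) x = a2"
  proof -
    have "cd c (cd c F) x = cd c (\<lambda>y. a1 + a2 * (snd c y - snd c x)) x"
      by (rule cd_cong[OF op cA(2) c 1])
    also have "\<dots> = a2"
      using cA by (simp add: cd_add[OF _ _ cA(2) c] cd_cmult[OF _ cA(2) c] dl cd_const
          holo_fun_add holo_fun_mult hl holo_fun_const op)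
    finally show ?thesis .
  qed
  let ?s = "\<lambda>y d. F y * coord_vec c y d"
  have "jet 2 ?s x = jet_of c a0 a1 a2 x"
  proof (intro ext)
    fix d and i :: nat
    show "jet 2 ?s x d i = jet_of c a0 a1 a2 x d i"
    proof (cases "d \<in> charts_at x \<and> i \<le> 2")
      case True
      then consider "i = 0" | "i = Suc 0" | "i = 2" by linarith
      then show ?thesis
        using True 1[OF cA(2)] 2
        by cases (simp_all add: jet_of_def jet_coord_field[OF c F cA(2)], simp_all add: F_def)
    next
      case False
      then show ?thesis using jet_outside[of d x i 2] by (auto simp: jet_of_def)
    qed
  qed
  moreover have "holo_vf (fst c) ?s" using holo_vf_coord[OF cA(1) F] by simp
  ultimately show ?thesis using cA(2) unfolding J_def by (metis (mono_tags, lifting) mem_Collect_eq)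
qed

lemma tr1_self: "c \<in> charts_at x \<Longrightarrow> tr1 c c x = 0"
proof -
  assume c: "c \<in> charts_at x"
  have "cd c (cd c (snd c)) x = cd c (\<lambda>_. 1) x"
    by (rule cd_cong[OF open_chart_domain _ c]) (use c in \<open>auto simp: cd_self charts_at_iff\<close>)
  then show ?thesis by (simp add: tr1_def cd_const)
qed

lemma cd_tr1_self: "c \<in> charts_at x \<Longrightarrow> cd c (tr1 c c) x = 0"
proof -
  assume c: "c \<in> charts_at x"
  have "cd c (tr1 c c) x = cd c (\<lambda>_. 0) x"
    by (rule cd_cong[OF open_chart_domain _ c]) (use c in \<open>auto simp: tr1_self charts_at_iff\<close>)
  then show ?thesis by (simp add: cd_const)
qed

lemma jet_of_self:
  assumes "c \<in> charts_at x"
  shows "jet_of c a0 a1 a2 x c 0 = a0" "jet_of c a0 a1 a2 x c (Suc 0) = a1" "jet_of c a0 a1 a2 x c 2 = a2"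
  using assms by (simp_all add: jet_of_def cd_self tr1_self cd_tr1_self)

lemma jet_of_lin:
  "(\<lambda>d i. a * jet_of c a0 a1 a2 x d i + b * jet_of c b0 b1 b2 x d i)
     = jet_of c (a * a0 + b * b0) (a * a1 + b * b1) (a * a2 + b * b2) x"
  by (intro ext) (simp add: jet_of_def add_divide_distrib algebra_simps)

text \<open>\<open>J 2 x\<close> is a set of jets of fields on varying neighbourhoods; its linear
  structure is read off the triples of derivatives in one chart.\<close>

lemma J_lin:
  assumes "j \<in> J 2 x" "k \<in> J 2 x"
  shows "(\<lambda>c i. a * j c i + b * k c i) \<in> J 2 x"
proof -
  obtain c where c: "c \<in> charts_at x" using charts_at_nonempty J_topspace[OF assms(1)] by blast
  show ?thesis
    by (subst J_eq_jet_of[OF assms(1) c], subst J_eq_jet_of[OF assms(2) c]) (simp only: jet_of_lin jet_of_in_J[OF c])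
qed

lemma J_scale: "j \<in> J 2 x \<Longrightarrow> (\<lambda>c i. a * j c i) \<in> J 2 x"
  using J_lin[of j x j a 0] by simp

lemma J_comb:
  fixes S :: "nat \<Rightarrow> 'a jet"
  shows "(\<And>n. n < 3 \<Longrightarrow> S n \<in> J 2 x) \<Longrightarrow> (\<lambda>c i. \<Sum>n<3. a n * S n c i) \<in> J 2 x"
  using J_lin[OF J_lin[of "S 0" x "S 1" "a 0" "a 1"], of "S 2" 1 "a 2"] by (simp add: sum_lessThan_3)

lemma J_zero: "x \<in> topspace X \<Longrightarrow> (\<lambda>_ _. 0) \<in> J 2 x"
  using charts_at_nonempty J_scale[OF jet_of_in_J, of _ x 0] by fastforce

lemma holo_section_comb:
  fixes S :: "nat \<Rightarrow> 'a \<Rightarrow> 'a jet"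
  assumes W: "openin X W" and s: "\<And>i. i < 3 \<Longrightarrow> holo_section W (S i)"
    and f: "\<And>i. i < 3 \<Longrightarrow> holo_fun W (f i)"
  shows "holo_section W (\<lambda>y c k. \<Sum>i<3. f i y * S i y c k)"
  unfolding holo_section_iff
proof (intro conjI ballI allI impI W)
  fix x assume x: "x \<in> W"
  then show "(\<lambda>c k. \<Sum>i<3. f i x * S i x c k) \<in> J 2 x"
    by (intro J_comb holo_sectionD(2)[OF s])
next
  fix c and k :: nat assume c: "c \<in> A" and k: "k \<le> 2"
  show "holo_fun (W \<inter> fst c) (\<lambda>y. \<Sum>i<3. f i y * S i y c k)"
    by (intro holo_fun_sum holo_fun_mult holo_sectionD(3)[OF s c k] holo_fun_subset[OF f] openin_chart_Int W c) auto
qed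

lemma holo_section_lin:
  assumes "holo_section W \<sigma>" "holo_section W \<tau>" "holo_fun W f" "holo_fun W g"
  shows "holo_section W (\<lambda>y c k. f y * \<sigma> y c k + g y * \<tau> y c k)"
proof -
  \<comment> \<open>Padded with a zero coefficient to fit the three-term lemma.\<close>
  have "holo_section W (\<lambda>y c k. \<Sum>i<3. (if i = 0 then f else if i = 1 then g else (\<lambda>_. 0)) y *
      (if i = (0::nat) then \<sigma> else if i = 1 then \<tau> else \<sigma>) y c k)"
    using holo_sectionD(1)[OF assms(1)] by (intro holo_section_comb) (auto intro: assms holo_fun_const)
  then show ?thesis by (simp add: sum_lessThan_3)
qed

lemma holo_section_jet_of:
  assumes c: "c \<in> A" and N: "N \<subseteq> fst c"
    and a: "holo_fun N a0" "holo_fun N a1" "holo_fun N a2"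
  shows "holo_section N (\<lambda>y. jet_of c (a0 y) (a1 y) (a2 y) y)"
  unfolding holo_section_iff
proof (intro conjI ballI allI impI)
  show op: "openin X N" using a(1) by (rule holo_funD)
  fix x assume "x \<in> N"
  then show "jet_of c (a0 x) (a1 x) (a2 x) x \<in> J 2 x"
    using jet_of_in_J[of c x] c N by (auto simp: charts_at_iff)
next
  fix d and i :: nat assume d: "d \<in> A" and i: "i \<le> 2"
  have op: "openin X (N \<inter> fst d)" using holo_funD(1)[OF a(1)] d by (rule openin_chart_Int)
  have sub: "N \<inter> fst d \<subseteq> fst c \<inter> fst d" using N by auto
  note h = holo_fun_subset[OF a(1) op Int_lower1] holo_fun_subset[OF a(2) op Int_lower1]
    holo_fun_subset[OF a(3) op Int_lower1] holo_fun_subset[OF holo_fun_transition[OF c d] op sub]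
    holo_fun_subset[OF holo_fun_tr1[OF c d] op sub] holo_fun_subset[OF holo_fun_cd_tr1[OF c d] op sub]
  have 0: "holo_fun (N \<inter> fst d) (\<lambda>x. cd c (snd d) x * a0 x)"
    "holo_fun (N \<inter> fst d) (\<lambda>x. tr1 c d x * a0 x + a1 x)"
    "holo_fun (N \<inter> fst d) (\<lambda>x. (cd c (tr1 c d) x * a0 x + tr1 c d x * a1 x + a2 x) / cd c (snd d) x)"
    using transition_nonzero[of c _ d] c d N
    by (auto intro!: holo_fun_divide holo_fun_add holo_fun_mult h simp: charts_at_iff)
  consider "i = 0" | "i = 1" | "i = 2" using i by linarith
  then show "holo_fun (N \<inter> fst d) (\<lambda>y. jet_of c (a0 y) (a1 y) (a2 y) y d i)"
    by cases (rule holo_fun_cong, rule 0, use d in \<open>auto simp: jet_of_def charts_at_iff\<close>)+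
qed

lemma holo_section_jet:
  assumes s: "holo_vf W s"
  shows "holo_section W (jet 2 s)"
  unfolding holo_section_iff
proof (intro conjI ballI allI impI)
  show op: "openin X W" using s by (rule holo_vfD)
  fix x assume "x \<in> W"
  then show "jet 2 s x \<in> J 2 x" using s by (auto simp: J_def)
next
  fix c and i :: nat assume c: "c \<in> A" and i: "i \<le> 2"
  have h: "holo_fun (W \<inter> fst c) (\<lambda>y. s y c)" using holo_vfD(3)[OF s c] .
  have h1: "holo_fun (W \<inter> fst c) (cd c (\<lambda>y. s y c))" using holo_fun_cd[OF h c] by (simp add: Int_assoc)
  have h2: "holo_fun (W \<inter> fst c) (cd c (cd c (\<lambda>y. s y c)))" using holo_fun_cd[OF h1 c] by (simp add: Int_assoc)
  consider "i = 0" | "i = 1" | "i = 2" using i by linarith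
  then show "holo_fun (W \<inter> fst c) (\<lambda>y. jet 2 s y c i)"
  proof cases
    case 1 then show ?thesis using holo_fun_cong[OF h] c by (auto simp: jet_0 charts_at_iff)
  next
    case 2 then show ?thesis using holo_fun_cong[OF h1] c by (auto simp: jet_1 charts_at_iff)
  next
    case 3 then show ?thesis using holo_fun_cong[OF h2] c by (auto simp: jet_2 charts_at_iff)
  qed
qed

lemma p0_tangent:
  assumes "j \<in> J 2 x"
  shows "p0 j \<in> tangent x"
proof -
  obtain W s where s: "holo_vf W s" "x \<in> W" "j = jet 2 s x" using assms by (auto simp: J_def)
  have "p0 j = s x"
  proof
    fix c show "p0 j c = s x c"
      using tangent_zero[OF holo_vfD(2)[OF s(1,2)], of c] jet_0[of c x 2 s] jet_outside[of c x 0 2 s]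
      by (cases "c \<in> charts_at x") (auto simp: p0_def s(3))
  qed
  then show ?thesis using holo_vfD(2)[OF s(1,2)] by simp
qed

lemma holo_vf_p0: "holo_section W \<sigma> \<Longrightarrow> holo_vf W (\<lambda>y. p0 (\<sigma> y))"
  unfolding holo_vf_iff using holo_sectionD p0_tangent by (auto simp: p0_def)

lemma jet_comb:
  fixes s :: "nat \<Rightarrow> 'a \<Rightarrow> 'a tvec"
  assumes W: "openin X W" and s: "\<And>i. i < 3 \<Longrightarrow> holo_vf W (s i)" and x: "x \<in> W"
  shows "jet 2 (\<lambda>y c. \<Sum>i<3. a i * s i y c) x = (\<lambda>c k. \<Sum>i<3. a i * jet 2 (s i) x c k)"
proof -
  obtain c where c: "c \<in> charts_at x" using chart_exists[OF W] x by blast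
  have cA: "c \<in> A" "x \<in> fst c" using c by auto
  have op: "openin X (W \<inter> fst c)" by (rule openin_chart_Int[OF W cA(1)])
  have xW: "x \<in> W \<inter> fst c" using x cA by auto
  let ?t = "\<lambda>y c. \<Sum>i<3. a i * s i y c"
  have t: "holo_vf W ?t" by (rule holo_vf_comb[OF W s]) (auto intro: holo_fun_const[OF W])
  have h: "holo_fun (W \<inter> fst c) (\<lambda>y. a i * s i y c)" if "i < 3" for i
    using holo_vfD(3)[OF s[OF that] cA(1)] by (intro holo_fun_mult holo_fun_const op)
  have h1: "holo_fun (W \<inter> fst c) (cd c (\<lambda>y. s i y c))" if "i < 3" for i
    using holo_fun_cd[OF holo_vfD(3)[OF s[OF that] cA(1)] cA(1)] by (simp add: Int_assoc)
  have h1': "holo_fun (W \<inter> fst c) (\<lambda>y. a i * cd c (\<lambda>y. s i y c) y)" if "i < 3" for i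
    using h1[OF that] by (intro holo_fun_mult holo_fun_const op)
  have 1: "cd c (\<lambda>y. ?t y c) y = (\<Sum>i<3. a i * cd c (\<lambda>y. s i y c) y)" if y: "y \<in> W \<inter> fst c" for y
  proof -
    have cy: "c \<in> charts_at y" using y cA by (simp add: charts_at_iff)
    have "cd c (\<lambda>y. ?t y c) y = (\<Sum>i<3. cd c (\<lambda>y. a i * s i y c) y)"
      by (rule cd_sum[OF op _ y cy]) (simp add: h)
    also have "\<dots> = (\<Sum>i<3. a i * cd c (\<lambda>y. s i y c) y)"
      using cd_cmult[OF holo_vfD(3)[OF s cA(1)] y cy] by simp
    finally show ?thesis .
  qed
  have "cd c (cd c (\<lambda>y. ?t y c)) x = cd c (\<lambda>y. \<Sum>i<3. a i * cd c (\<lambda>y. s i y c) y) x"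
    by (rule cd_cong[OF op xW c 1])
  also have "\<dots> = (\<Sum>i<3. a i * cd c (cd c (\<lambda>y. s i y c)) x)"
  proof -
    have "cd c (\<lambda>y. \<Sum>i<3. a i * cd c (\<lambda>y. s i y c) y) x = (\<Sum>i<3. cd c (\<lambda>y. a i * cd c (\<lambda>y. s i y c) y) x)"
      by (rule cd_sum[OF op _ xW c]) (simp add: h1')
    also have "\<dots> = (\<Sum>i<3. a i * cd c (cd c (\<lambda>y. s i y c)) x)"
      using cd_cmult[OF h1 xW c] by simp
    finally show ?thesis .
  qed
  finally have 2: "cd c (cd c (\<lambda>y. ?t y c)) x = (\<Sum>i<3. a i * cd c (cd c (\<lambda>y. s i y c)) x)" .
  show ?thesis
  proof (rule J_eqI[OF _ _ c])
    show "jet 2 ?t x \<in> J 2 x" using t x by (auto simp: J_def)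
    show "(\<lambda>c k. \<Sum>i<3. a i * jet 2 (s i) x c k) \<in> J 2 x"
      by (rule J_comb) (use s x in \<open>auto simp: J_def\<close>)
  qed (use c 1[OF xW] 2 in \<open>simp_all add: jet_0 jet_1 jet_2\<close>)
qed

text \<open>The chart chosen inside \<open>differential\<close> drops out: the factor in the chain
  rule for f is the one by which v changes.\<close>

lemma differential_eq:
  assumes f: "holo_fun W f" "x \<in> W" and v: "v \<in> tangent x" and c: "c \<in> charts_at x"
  shows "differential f x v = cd c f x * v c"
proof -
  define d where "d = (SOME c. c \<in> charts_at x)"
  have d: "d \<in> charts_at x" unfolding d_def using c by (rule someI)
  have "differential f x v = cd d f x * v d"
    by (simp add: differential_def Let_def cd_def d_def)
  also have "\<dots> = cd c f x * v c"
    using cd_chain[OF f c d] tangent_transition[OF v c d] by simp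
  finally show ?thesis .
qed

section \<open>The determinant\<close>

lemma J_transition:
  assumes "j \<in> J 2 x" "c \<in> charts_at x" "d \<in> charts_at x"
  shows "j d 0 = cd c (snd d) x * j c 0"
    and "j d (Suc 0) = tr1 c d x * j c 0 + j c (Suc 0)"
    and "j d 2 = (cd c (tr1 c d) x * j c 0 + tr1 c d x * j c (Suc 0) + j c 2) / cd c (snd d) x"
  by (subst J_eq_jet_of[OF assms(1,2)], simp add: jet_of_def assms(3))+

text \<open>For the 2-jets of three vector fields this is the Wronskian of their components in
  \<open>c\<close>.\<close>

definition det3 :: "'a chart \<Rightarrow> 'a jet \<Rightarrow> 'a jet \<Rightarrow> 'a jet \<Rightarrow> complex" where
  "det3 c j k l = j c 0 * (k c (Suc 0) * l c 2 - k c 2 * l c (Suc 0))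
     - j c (Suc 0) * (k c 0 * l c 2 - k c 2 * l c 0)
     + j c 2 * (k c 0 * l c (Suc 0) - k c (Suc 0) * l c 0)"

text \<open>On triples of derivatives the change of chart is triangular with diagonal w', 1, 1/w',
  hence of determinant 1.\<close>

lemma det3_transition:
  assumes "j \<in> J 2 x" "k \<in> J 2 x" "l \<in> J 2 x" and c: "c \<in> charts_at x" and d: "d \<in> charts_at x"
  shows "det3 d j k l = det3 c j k l"
  using transition_nonzero[OF c d]
  unfolding det3_def J_transition[OF assms(1) c d] J_transition[OF assms(2) c d] J_transition[OF assms(3) c d]
  by (simp add: field_simps)

lemma holo_fun_det3:
  assumes c: "c \<in> A" and \<rho>: "holo_section W \<rho>" and \<sigma>: "holo_section W \<sigma>" and \<tau>: "holo_section W \<tau>"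
  shows "holo_fun (W \<inter> fst c) (\<lambda>y. det3 c (\<rho> y) (\<sigma> y) (\<tau> y))"
  unfolding det3_def
  by (intro holo_fun_add holo_fun_diff holo_fun_mult holo_sectionD(3)[OF \<rho> c]
      holo_sectionD(3)[OF \<sigma> c] holo_sectionD(3)[OF \<tau> c]) simp_all

text \<open>(z(x) - z) d/dz has value 0 and first derivative -1 at x. When the value vanishes, the
  first derivative is the same in all charts.\<close>

lemma O_incl_eq: "x \<in> topspace X \<Longrightarrow> O_incl x a = (\<lambda>d i. if d \<in> charts_at x \<and> i = 1 then - a else 0)"
proof -
  assume x: "x \<in> topspace X"
  define c where "c = (SOME c. c \<in> charts_at x)"
  have c: "c \<in> charts_at x" unfolding c_def using charts_at_nonempty[OF x] by (rule someI_ex)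
  have cA: "c \<in> A" "x \<in> fst c" using c by auto
  let ?F = "\<lambda>y. snd c x - snd c y"
  have F: "holo_fun (fst c) ?F"
    using cA by (intro holo_fun_diff holo_fun_const holo_fun_chart open_chart_domain)
  have dF: "cd c ?F x = -1"
    using cd_diff[OF holo_fun_const holo_fun_chart cA(2) c, of "snd c x"] cA
    by (simp add: open_chart_domain cd_const cd_self[OF c])
  have k: "kernel_jet 1 c x = jet 1 (\<lambda>y d. ?F y * coord_vec c y d) x"
    by (simp add: kernel_jet_def)
  have "a * kernel_jet 1 c x d i = (if d \<in> charts_at x \<and> i = 1 then - a else 0)" for d and i :: nat
  proof (cases "d \<in> charts_at x \<and> i \<le> 1")
    case True
    then consider "i = 0" | "i = Suc 0" by linarith
    then show ?thesis
      using True unfolding k by cases (simp_all add: jet_coord_field[OF c F cA(2)] dF)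
  next
    case False
    then show ?thesis unfolding k using jet_outside[of d x i 1] by auto
  qed
  then show ?thesis by (auto simp: O_incl_def Let_def c_def[symmetric])
qed

text \<open>(z(x) - z)^2 / 2 has second derivative 1 and no lower terms at x: the factorial cancels,
  and the sign is lost in even order.\<close>

lemma kernel_jet_2:
  assumes c: "c \<in> charts_at x"
  shows "kernel_jet 2 c x = jet_of c 0 0 1 x"
proof -
  have cA: "c \<in> A" "x \<in> fst c" using c by auto
  let ?G = "\<lambda>y. snd c x - snd c y"
  define F where "F = (\<lambda>y. (1/2) * (?G y * ?G y))"
  have op: "openin X (fst c)" by (rule open_chart_domain[OF cA(1)])
  have G: "holo_fun (fst c) ?G"
    using cA op by (intro holo_fun_diff holo_fun_const holo_fun_chart)
  have dG: "cd c ?G y = -1" if "y \<in> fst c" for y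
    using cd_diff[OF holo_fun_const holo_fun_chart that, of c "snd c x"] cA op that
    by (simp add: cd_const cd_self charts_at_iff)
  have F: "holo_fun (fst c) F"
    unfolding F_def by (intro holo_fun_mult holo_fun_const op G)
  have 1: "cd c F y = - ?G y" if y: "y \<in> fst c" for y
  proof -
    have cy: "c \<in> charts_at y" using y cA by (simp add: charts_at_iff)
    show ?thesis
      unfolding F_def cd_cmult[OF holo_fun_mult[OF G G] y cy] cd_mult[OF G G y cy] dG[OF y] by simp
  qed
  have "cd c (cd c F) x = cd c (\<lambda>y. - ?G y) x"
    by (rule cd_cong[OF op cA(2) c 1])
  then have 2: "cd c (cd c F) x = 1"
    using cd_uminus[OF G cA(2) c] dG[OF cA(2)] by simp
  have k: "kernel_jet 2 c x = jet 2 (\<lambda>y d. F y * coord_vec c y d) x"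
    by (simp add: kernel_jet_def F_def power2_eq_square numeral_2_eq_2)
  have F0: "F x = 0" by (simp add: F_def)
  show ?thesis
  proof (intro ext)
    fix d and i :: nat
    show "kernel_jet 2 c x d i = jet_of c 0 0 1 x d i"
    proof (cases "d \<in> charts_at x \<and> i \<le> 2")
      case True
      then consider "i = 0" | "i = Suc 0" | "i = 2" by linarith
      then show ?thesis
        using True 1[OF cA(2)] 2 F0 unfolding k
        by cases (simp_all add: jet_of_def jet_coord_field[OF c F cA(2)])
    next
      case False
      then show ?thesis unfolding k using jet_outside[of d x i 2] by (auto simp: jet_of_def)
    qed
  qed
qed

lemma cotangent_scale:
  assumes "\<theta> \<in> cotangent x" "u \<in> tangent x"
  shows "\<theta> (\<lambda>c. a * u c) = a * \<theta> u"
proof -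
  have "\<theta> (\<lambda>c. a * u c + 0 * u c) = a * \<theta> u + 0 * \<theta> u"
    using assms unfolding cotangent_def by blast
  then show ?thesis by simp
qed

lemma cotangent_eq:
  assumes "\<theta> \<in> cotangent x" "v \<in> tangent x" "c \<in> charts_at x"
  shows "\<theta> v = v c * \<theta> (coord_vec c x)"
  using cotangent_scale[OF assms(1) coord_vec_tangent[OF assms(3)], of "v c"]
    tangent_eq_coord_vec[OF assms(2,3)] by simp

text \<open>For a jet with zero 1-jet the second derivative changes by 1/w', as does the value of
  \<theta> on the coordinate vector; so all choices of chart in \<open>K_incl\<close> give the same
  jet.\<close>

lemma K_incl_eq:
  assumes \<theta>: "\<theta> \<in> cotangent x" and d: "d \<in> charts_at x"
  shows "K_incl x \<theta> = jet_of d 0 0 (\<theta> (coord_vec d x)) x"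
proof -
  define c where "c = (SOME c. c \<in> charts_at x)"
  have c: "c \<in> charts_at x" unfolding c_def using d by (rule someI)
  have "K_incl x \<theta> = (\<lambda>e i. \<theta> (coord_vec c x) * jet_of c 0 0 1 x e i)"
    by (simp add: K_incl_def Let_def c_def[symmetric] kernel_jet_2[OF c])
  also have "\<dots> = jet_of c 0 0 (\<theta> (coord_vec c x)) x"
    using jet_of_lin[of "\<theta> (coord_vec c x)" c 0 0 1 x 0 0 0 0] by simp
  also have "\<dots> = jet_of d 0 0 (\<theta> (coord_vec d x)) x"
    by (subst J_eq_jet_of[OF jet_of_in_J[OF c] d])
       (use c d transition_nonzero[OF c d] cotangent_eq[OF \<theta> coord_vec_tangent[OF c] d] in
         \<open>simp add: jet_of_def[of c] coord_vec_eq\<close>)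
  finally show ?thesis .
qed

text \<open>The fibre has dimension three, so alternating trilinear forms on it are multiples of the
  determinant. This is what makes the description of \<open>det_triv\<close> single-valued.\<close>

lemma alternating3_expand:
  assumes \<omega>: "alternating3 x \<omega>" and c: "c \<in> charts_at x"
    and j: "j \<in> J 2 x" and k: "k \<in> J 2 x" and l: "l \<in> J 2 x"
  shows "\<omega> j k l = det3 c j k l * \<omega> (jet_of c 1 0 0 x) (jet_of c 0 1 0 x) (jet_of c 0 0 1 x)"
proof -
  define e0 e1 e2 where "e0 = jet_of c 1 0 0 x" and "e1 = jet_of c 0 1 0 x" and "e2 = jet_of c 0 0 1 x"
  have e: "e0 \<in> J 2 x" "e1 \<in> J 2 x" "e2 \<in> J 2 x"
    unfolding e0_def e1_def e2_def by (rule jet_of_in_J[OF c])+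
  have L: "\<omega> (\<lambda>c i. a * j c i + b * j' c i) k l = a * \<omega> j k l + b * \<omega> j' k l"
      "\<omega> k (\<lambda>c i. a * j c i + b * j' c i) l = a * \<omega> k j l + b * \<omega> k j' l"
      "\<omega> k l (\<lambda>c i. a * j c i + b * j' c i) = a * \<omega> k l j + b * \<omega> k l j'"
    if "j \<in> J 2 x" "j' \<in> J 2 x" "k \<in> J 2 x" "l \<in> J 2 x" for j j' k l a b
    using \<omega> that unfolding alternating3_def by blast+
  have alt: "\<omega> j j k = 0" "\<omega> j k k = 0" "\<omega> j k j = 0" if "j \<in> J 2 x" "k \<in> J 2 x" for j k
    using \<omega> that unfolding alternating3_def by blast+
  \<comment> \<open>Polarization: the form vanishes on j + k, j + k, l.\<close>
  have sw1: "\<omega> k j l = - \<omega> j k l" if "j \<in> J 2 x" "k \<in> J 2 x" "l \<in> J 2 x" for j k l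
  proof -
    have s: "(\<lambda>c i. 1 * j c i + 1 * k c i) \<in> J 2 x" using that by (intro J_lin)
    show ?thesis
      using alt(1)[OF s that(3)] unfolding L(1)[OF that(1,2) s that(3)]
      unfolding L(2)[OF that(1,2,1,3)] L(2)[OF that(1,2,2,3)] using alt(1) that
      by (simp add: add_eq_0_iff2)
  qed
  have sw2: "\<omega> j l k = - \<omega> j k l" if "j \<in> J 2 x" "k \<in> J 2 x" "l \<in> J 2 x" for j k l
  proof -
    have s: "(\<lambda>c i. 1 * k c i + 1 * l c i) \<in> J 2 x" using that by (intro J_lin)
    show ?thesis
      using alt(2)[OF that(1) s] unfolding L(2)[OF that(2,3,1) s]
      unfolding L(3)[OF that(2,3,1,2)] L(3)[OF that(2,3,1,3)] using alt(2) that
      by (simp add: add_eq_0_iff2)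
  qed
  \<comment> \<open>Nested two-term combinations, with the factor 1 written out, so that
    \<open>L\<close> applies twice.\<close>
  have dec: "jet_of c a0 a1 a2 x = (\<lambda>d i. 1 * (\<lambda>d i. a0 * e0 d i + a1 * e1 d i) d i + a2 * e2 d i)" for a0 a1 a2
    unfolding e0_def e1_def e2_def by (intro ext) (simp add: jet_of_def add_divide_distrib mult.commute)
  have l1: "\<omega> (jet_of c a0 a1 a2 x) k l = a0 * \<omega> e0 k l + a1 * \<omega> e1 k l + a2 * \<omega> e2 k l"
    and l2: "\<omega> k (jet_of c a0 a1 a2 x) l = a0 * \<omega> k e0 l + a1 * \<omega> k e1 l + a2 * \<omega> k e2 l"
    and l3: "\<omega> k l (jet_of c a0 a1 a2 x) = a0 * \<omega> k l e0 + a1 * \<omega> k l e1 + a2 * \<omega> k l e2"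
    if "k \<in> J 2 x" "l \<in> J 2 x" for k l a0 a1 a2
    unfolding dec
    using L[OF J_lin[OF e(1,2)] e(3) that, of 1 a0 a1 a2] L[OF e(1,2) that, of a0 a1] by simp_all
  define w where "w = \<omega> e0 e1 e2"
  have perm: "\<omega> e0 e1 e2 = w" "\<omega> e1 e0 e2 = - w" "\<omega> e0 e2 e1 = - w"
    "\<omega> e2 e0 e1 = w" "\<omega> e1 e2 e0 = w" "\<omega> e2 e1 e0 = - w"
    using sw1[OF e(1,2,3)] sw2[OF e(1,2,3)] sw1[OF e(1,3,2)] sw2[OF e(2,1,3)] sw1[OF e(2,3,1)] 
    by (simp_all add: w_def)
  have "\<omega> (jet_of c j0 j1 j2 x) (jet_of c k0 k1 k2 x) (jet_of c m0 m1 m2 x) =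
      (j0 * (k1 * m2 - k2 * m1) - j1 * (k0 * m2 - k2 * m0) + j2 * (k0 * m1 - k1 * m0)) * w"
    for j0 j1 j2 k0 k1 k2 m0 m1 m2
    by (simp add: l1 l2 l3 e jet_of_in_J[OF c] perm alt) (simp add: algebra_simps)
  from this[of "j c 0" "j c (Suc 0)" "j c 2" "k c 0" "k c (Suc 0)" "k c 2" "l c 0" "l c (Suc 0)" "l c 2"]
  show ?thesis
    unfolding J_eq_jet_of[OF j c, symmetric] J_eq_jet_of[OF k c, symmetric] J_eq_jet_of[OF l c, symmetric]
    by (simp add: det3_def w_def e0_def e1_def e2_def)
qed

text \<open>The sign stems from \<open>O_incl\<close>: the generator 1 of O has first derivative -1,
  while the lifts of the generators of TX and K have the entry 1.\<close>

lemma det_triv_eq: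
  assumes c: "c \<in> charts_at x" and "j \<in> J 2 x" "k \<in> J 2 x" "l \<in> J 2 x"
  shows "det_triv x j k l = - det3 c j k l"
proof -
  have xX: "x \<in> topspace X" using c by (rule charts_at_topspace)
  define \<omega>0 where "\<omega>0 = (\<lambda>j k l. if j \<in> J 2 x \<and> k \<in> J 2 x \<and> l \<in> J 2 x then - det3 c j k l else 0)"
  let ?P = "\<lambda>\<omega>. alternating3 x \<omega> \<and> (\<forall>j\<in>J 2 x. \<forall>k\<in>F2 x. \<forall>a. \<forall>\<theta>\<in>cotangent x. trunc 1 k = O_incl x a \<longrightarrow>
        \<omega> j k (K_incl x \<theta>) = \<theta> (p0 j) * a)"
  have alt: "alternating3 x \<omega>0"
    unfolding alternating3_def
  proof (intro conjI allI impI ballI)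
    fix j k l assume "\<not> (j \<in> J 2 x \<and> k \<in> J 2 x \<and> l \<in> J 2 x)"
    then show "\<omega>0 j k l = 0" by (simp only: \<omega>0_def if_False)
  next
    fix j j' k l a b assume h: "j \<in> J 2 x" "j' \<in> J 2 x" "k \<in> J 2 x" "l \<in> J 2 x"
    note [simp] = h J_lin[OF h(1,2)]
    show "\<omega>0 (\<lambda>c i. a * j c i + b * j' c i) k l = a * \<omega>0 j k l + b * \<omega>0 j' k l"
      "\<omega>0 k (\<lambda>c i. a * j c i + b * j' c i) l = a * \<omega>0 k j l + b * \<omega>0 k j' l"
      "\<omega>0 k l (\<lambda>c i. a * j c i + b * j' c i) = a * \<omega>0 k l j + b * \<omega>0 k l j'"
      by (simp_all add: \<omega>0_def det3_def) (simp_all add: algebra_simps)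
  next
    fix j k assume h: "j \<in> J 2 x" "k \<in> J 2 x"
    then show "\<omega>0 j j k = 0" "\<omega>0 j k k = 0" "\<omega>0 j k j = 0"
      by (simp_all add: \<omega>0_def det3_def algebra_simps)
  qed
  have norm: "\<omega>0 j k (K_incl x \<theta>) = \<theta> (p0 j) * a"
    if j: "j \<in> J 2 x" and k: "k \<in> F2 x" and \<theta>: "\<theta> \<in> cotangent x" and tr: "trunc 1 k = O_incl x a" for j k a \<theta>
  proof -
    have kJ: "k \<in> J 2 x" and k0: "k c 0 = 0" using k by (auto simp: F2_def p0_def dest: fun_cong)
    have k1: "k c (Suc 0) = - a"
      using fun_cong[OF fun_cong[OF tr, of c], of 1] c xX by (simp add: trunc_def O_incl_eq)
    have "\<theta> (p0 j) = j c 0 * \<theta> (coord_vec c x)"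
      using cotangent_eq[OF \<theta> p0_tangent[OF j] c] by (simp add: p0_def)
    then show ?thesis
      using j kJ k0 k1 K_incl_eq[OF \<theta> c] jet_of_in_J[OF c] by (simp add: \<omega>0_def det3_def jet_of_self[OF c])
  qed
  have "\<omega> = \<omega>0" if P: "?P \<omega>" for \<omega>
  proof -
    \<comment> \<open>\<open>?f\<close> is the jet lifting 1 in O, and \<theta> below is dz; the
      prescribed value on \<open>?e0\<close>, \<open>?f\<close> and \<open>K_incl x \<theta>\<close>
      fixes the free multiple.\<close>
    let ?e0 = "jet_of c 1 0 0 x" and ?e1 = "jet_of c 0 1 0 x" and ?e2 = "jet_of c 0 0 1 x" and ?f = "jet_of c 0 (-1) 0 x"
    define \<theta> where "\<theta> = (\<lambda>v. if v \<in> tangent x then v c else 0)"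
    have \<theta>: "\<theta> \<in> cotangent x" by (auto simp: \<theta>_def cotangent_def tangent_lin)
    have f: "?f \<in> F2 x" using jet_of_in_J[OF c] by (auto simp: F2_def p0_def jet_of_def)
    have tr: "trunc 1 ?f = O_incl x 1"
      by (intro ext) (auto simp: trunc_def O_incl_eq[OF xX] jet_of_def)
    have "\<omega> ?e0 ?f (K_incl x \<theta>) = \<theta> (p0 ?e0) * 1"
      using P f \<theta> tr jet_of_in_J[OF c] by blast
    then have "\<omega> ?e0 ?f ?e2 = 1"
      unfolding K_incl_eq[OF \<theta> c]
      using p0_tangent[OF jet_of_in_J[OF c]] coord_vec_tangent[OF c]
      by (simp add: \<theta>_def coord_vec_self[OF c]) (simp add: p0_def jet_of_self[OF c])
    moreover have "\<omega> ?e0 ?f ?e2 = - \<omega> ?e0 ?e1 ?e2"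
      using alternating3_expand[OF conjunct1[OF P] c jet_of_in_J[OF c] jet_of_in_J[OF c] jet_of_in_J[OF c], of 1 0 0 0 "-1" 0 0 0 1]
      by (simp add: det3_def jet_of_self[OF c])
    ultimately have w: "\<omega> ?e0 ?e1 ?e2 = -1" by (metis minus_minus)
    show ?thesis
    proof (intro ext)
      fix j k l
      show "\<omega> j k l = \<omega>0 j k l"
      proof (cases "j \<in> J 2 x \<and> k \<in> J 2 x \<and> l \<in> J 2 x")
        case True
        then show ?thesis
          using alternating3_expand[OF conjunct1[OF P] c, of j k l] w by (simp add: \<omega>0_def)
      next
        case False
        then show ?thesis using conjunct1[OF P] unfolding alternating3_def \<omega>0_def by auto
      qed
    qed
  qed
  then have "det_triv x = \<omega>0"
    unfolding det_triv_def using alt norm by (intro the_equality) blast+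
  then show ?thesis using assms by (simp add: \<omega>0_def)
qed

section \<open>Frames of the bundle of 2-jets\<close>

definition frame :: "'a set \<Rightarrow> (nat \<Rightarrow> 'a \<Rightarrow> 'a jet) \<Rightarrow> bool" where
  "frame W S \<longleftrightarrow> (\<forall>i<3. holo_section W (S i)) \<and>
     (\<forall>y\<in>W. \<forall>c\<in>charts_at y. det3 c (S 0 y) (S 1 y) (S 2 y) \<noteq> 0)"

lemma frameD:
  "frame W S \<Longrightarrow> i < 3 \<Longrightarrow> holo_section W (S i)"
  "frame W S \<Longrightarrow> y \<in> W \<Longrightarrow> c \<in> charts_at y \<Longrightarrow> det3 c (S 0 y) (S (Suc 0) y) (S 2 y) \<noteq> 0"
  "frame W S \<Longrightarrow> openin X W"
  using holo_sectionD(1)[of W "S 0"] by (auto simp: frame_def)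

text \<open>Cramer's rule: the coefficients are quotients of determinants of sections, hence
  holomorphic on the domain of a chart.\<close>

lemma frame_expand:
  assumes fr: "frame W S" and \<sigma>: "holo_section W' \<sigma>" and x: "x \<in> W" "x \<in> W'"
  shows "\<exists>N f. openin X N \<and> x \<in> N \<and> N \<subseteq> W \<inter> W' \<and> (\<forall>i<3. holo_fun N (f i)) \<and>
    (\<forall>y\<in>N. \<sigma> y = (\<lambda>d k. \<Sum>i<3. f i y * S i y d k))"
proof -
  obtain c where c: "c \<in> charts_at x"
    using chart_exists[OF frameD(3)[OF fr]] x by blast
  have cA: "c \<in> A" "x \<in> fst c" using c by auto
  let ?W = "W \<inter> W'"
  let ?N = "?W \<inter> fst c"
  have opW: "openin X ?W" using frameD(3)[OF fr] holo_sectionD(1)[OF \<sigma>] by blast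
  have op: "openin X ?N" by (rule openin_chart_Int[OF opW cA(1)])
  have hs: "holo_section ?W \<sigma>" "\<And>i. i < 3 \<Longrightarrow> holo_section ?W (S i)"
    using holo_section_subset[OF \<sigma> opW] holo_section_subset[OF frameD(1)[OF fr] opW] by auto
  have ch: "c \<in> charts_at y" if "y \<in> ?N" for y using that cA by (simp add: charts_at_iff)
  define D where "D = (\<lambda>y. det3 c (S 0 y) (S (Suc 0) y) (S 2 y))"
  have D: "D y \<noteq> 0" if "y \<in> ?N" for y using frameD(2)[OF fr _ ch[OF that]] that by (simp add: D_def)
  define f :: "nat \<Rightarrow> 'a \<Rightarrow> complex" where "f = (\<lambda>i y. (if i = 0 then det3 c (\<sigma> y) (S (Suc 0) y) (S 2 y)
      else if i = 1 then det3 c (S 0 y) (\<sigma> y) (S 2 y) else det3 c (S 0 y) (S (Suc 0) y) (\<sigma> y)) / D y)"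
  have f: "holo_fun ?N (f i)" for i
  proof -
    have hD: "holo_fun ?N D" unfolding D_def by (intro holo_fun_det3 hs cA) simp_all
    show ?thesis
      unfolding f_def
      by (cases "i = 0"; cases "i = 1"; simp; intro holo_fun_divide holo_fun_det3 hs cA hD D) simp_all
  qed
  have eq: "\<sigma> y = (\<lambda>d k. \<Sum>i<3. f i y * S i y d k)" if y: "y \<in> ?N" for y
  proof (rule J_eqI[OF _ _ ch[OF y]])
    show "\<sigma> y \<in> J 2 y" using holo_sectionD(2)[OF hs(1)] y by blast
    show "(\<lambda>d k. \<Sum>i<3. f i y * S i y d k) \<in> J 2 y"
      using holo_sectionD(2)[OF hs(2)] y by (intro J_comb) auto
    \<comment> \<open>Cramer's rule as a polynomial identity in the entries, with the denominator
      cleared.\<close>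
    have "D y * \<sigma> y c m = det3 c (\<sigma> y) (S (Suc 0) y) (S 2 y) * S 0 y c m
        + det3 c (S 0 y) (\<sigma> y) (S 2 y) * S (Suc 0) y c m + det3 c (S 0 y) (S (Suc 0) y) (\<sigma> y) * S 2 y c m"
      if "m = 0 \<or> m = Suc 0 \<or> m = 2" for m
      using that by (elim disjE) (simp_all add: D_def det3_def algebra_simps)
    then show "\<sigma> y c 0 = (\<Sum>i<3. f i y * S i y c 0)" "\<sigma> y c (Suc 0) = (\<Sum>i<3. f i y * S i y c (Suc 0))"
      "\<sigma> y c 2 = (\<Sum>i<3. f i y * S i y c 2)"
      using D[OF y] by (simp_all add: sum_lessThan_3 f_def field_simps)
  qed
  show ?thesis
    using op x cA f eq by (intro exI[of _ ?N] exI[of _ f]) auto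
qed

text \<open>Replacing one member of the frame by the combination multiplies the determinant by the
  corresponding coefficient.\<close>

lemma frame_independent:
  assumes fr: "frame W S" and x: "x \<in> W"
    and eq: "(\<lambda>d k. \<Sum>i<3. a i * S i x d k) = (\<lambda>d k. \<Sum>i<3. b i * S i x d k)" and i: "i < 3"
  shows "a i = b i"
proof -
  obtain c where c: "c \<in> charts_at x"
    using chart_exists[OF frameD(3)[OF fr]] x by blast
  let ?D = "det3 c (S 0 x) (S (Suc 0) x) (S 2 x)"
  have D: "?D \<noteq> 0" by (rule frameD(2)[OF fr x c])
  have expand: "det3 c (\<lambda>d k. \<Sum>i<3. a i * S i x d k) (S (Suc 0) x) (S 2 x) = a 0 * ?D"
    "det3 c (S 0 x) (\<lambda>d k. \<Sum>i<3. a i * S i x d k) (S 2 x) = a (Suc 0) * ?D"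
    "det3 c (S 0 x) (S (Suc 0) x) (\<lambda>d k. \<Sum>i<3. a i * S i x d k) = a 2 * ?D" for a
    unfolding det3_def sum_lessThan_3 by (simp_all add: algebra_simps)
  have "a 0 = b 0" "a (Suc 0) = b (Suc 0)" "a 2 = b 2"
    using expand[of a, unfolded eq] expand[of b] D by simp_all
  then show ?thesis using i all_lessThan_3[of "\<lambda>i. a i = b i"] by blast
qed

section \<open>Connections and flat frames\<close>

lemma differential_const: "differential (\<lambda>_. k) x v = 0"
  by (simp add: differential_def Let_def in_chart_def o_def)

lemma conn_zero:
  "holomorphic_connection D \<Longrightarrow> \<not> (\<exists>W. x \<in> W \<and> holo_section W \<sigma>) \<Longrightarrow> D \<sigma> x = (\<lambda>_ _ _. 0)"
  unfolding holomorphic_connection_def by (drule conjunct1) metis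

lemma conn_local:
  assumes D: "holomorphic_connection D" and \<sigma>: "holo_section N \<sigma>" and eq: "\<And>y. y \<in> N \<Longrightarrow> \<sigma> y = \<tau> y" and x: "x \<in> N"
  shows "D \<sigma> x = D \<tau> x"
  by (rule D[unfolded holomorphic_connection_def, THEN conjunct2, THEN conjunct1, rule_format,
        OF \<sigma> holo_section_cong[OF \<sigma> eq] eq x])

lemma conn_hom:
  assumes "holomorphic_connection D" "holo_section W \<sigma>" "x \<in> W"
  shows "D \<sigma> x \<in> hom_tangent x (J 2 x)"
  using assms(1)[unfolded holomorphic_connection_def, THEN conjunct2, THEN conjunct2, THEN conjunct1, rule_format,
        OF assms(2)] assms(3) by blast

lemma conn_add:
  assumes "holomorphic_connection D" "holo_section W \<sigma>" "holo_section W \<tau>" "x \<in> W" "v \<in> tangent x"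
  shows "D (\<lambda>y c i. \<sigma> y c i + \<tau> y c i) x v = (\<lambda>c i. D \<sigma> x v c i + D \<tau> x v c i)"
  by (rule assms(1)[unfolded holomorphic_connection_def, THEN conjunct2, THEN conjunct2, THEN conjunct2,
        THEN conjunct1, rule_format, OF assms(2-5)])

lemma conn_leibniz:
  assumes "holomorphic_connection D" "holo_fun W f" "holo_section W \<sigma>" "x \<in> W" "v \<in> tangent x"
  shows "D (\<lambda>y c i. f y * \<sigma> y c i) x v = (\<lambda>c i. f x * D \<sigma> x v c i + differential f x v * \<sigma> x c i)"
  by (rule assms(1)[unfolded holomorphic_connection_def, THEN conjunct2, THEN conjunct2, THEN conjunct2,
        THEN conjunct2, rule_format, OF assms(2-5)])

lemma holo_section_scale: "holo_section W \<sigma> \<Longrightarrow> holo_fun W f \<Longrightarrow> holo_section W (\<lambda>y c k. f y * \<sigma> y c k)"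
  using holo_section_lin[of W \<sigma> \<sigma> f "\<lambda>_. 0"] holo_fun_const[of W 0] holo_funD(1)[of W f] by simp

lemma conn_comb:
  fixes S :: "nat \<Rightarrow> 'a \<Rightarrow> 'a jet"
  assumes D: "holomorphic_connection D" and S: "\<And>i. i < 3 \<Longrightarrow> holo_section W (S i)"
    and f: "\<And>i. i < 3 \<Longrightarrow> holo_fun W (f i)" and x: "x \<in> W" and v: "v \<in> tangent x"
  shows "D (\<lambda>y c k. \<Sum>i<3. f i y * S i y c k) x v =
    (\<lambda>c k. \<Sum>i<3. f i x * D (S i) x v c k + differential (f i) x v * S i x c k)"
proof -
  have h: "holo_section W (\<lambda>y c k. f i y * S i y c k)" if "i < 3" for i
    using S f that by (intro holo_section_scale)
  have h01: "holo_section W (\<lambda>y c k. f 0 y * S 0 y c k + f (Suc 0) y * S (Suc 0) y c k)"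
    using S f by (intro holo_section_lin) auto
  have l: "D (\<lambda>y c k. f i y * S i y c k) x v = (\<lambda>c k. f i x * D (S i) x v c k + differential (f i) x v * S i x c k)"
    if "i < 3" for i
    by (rule conn_leibniz[OF D f[OF that] S[OF that] x v])
  show ?thesis
    unfolding sum_lessThan_3
    using conn_add[OF D h01 h[of 2] x v] conn_add[OF D h[of 0] h[of "Suc 0"] x v] l[of 0] l[of "Suc 0"] l[of 2]
    by simp
qed

definition flat_frame :: "'a connection \<Rightarrow> 'a set \<Rightarrow> (nat \<Rightarrow> 'a \<Rightarrow> 'a jet) \<Rightarrow> bool" where
  "flat_frame D W S \<longleftrightarrow> frame W S \<and> (\<forall>i<3. flat D W (S i))"

lemma flatD:
  "flat D W \<sigma> \<Longrightarrow> holo_section W \<sigma>"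
  "flat D W \<sigma> \<Longrightarrow> x \<in> W \<Longrightarrow> v \<in> tangent x \<Longrightarrow> D \<sigma> x v = (\<lambda>_ _. 0)"
  "flat D W \<sigma> \<Longrightarrow> openin X W"
  using holo_sectionD(1) by (auto simp: flat_def)

lemma flat_subset: "flat D W \<sigma> \<Longrightarrow> openin X W' \<Longrightarrow> W' \<subseteq> W \<Longrightarrow> flat D W' \<sigma>"
  unfolding flat_def using holo_section_subset by blast

lemma flat_localI:
  assumes D: "holomorphic_connection D" and W: "openin X W"
    and loc: "\<And>x. x \<in> W \<Longrightarrow> \<exists>N \<tau>. x \<in> N \<and> flat D N \<tau> \<and> (\<forall>y\<in>N. \<sigma> y = \<tau> y)"
  shows "flat D W \<sigma>"
  unfolding flat_def
proof (intro conjI ballI)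
  show "holo_section W \<sigma>"
    by (rule holo_section_localI[OF W]) (metis loc flatD(1))
  fix x v assume x: "x \<in> W" and v: "v \<in> tangent x"
  obtain N \<tau> where N: "x \<in> N" "flat D N \<tau>" "\<forall>y\<in>N. \<sigma> y = \<tau> y" using loc[OF x] by (elim exE conjE)
  have "D \<tau> x = D \<sigma> x"
    by (rule conn_local[OF D flatD(1)[OF N(2)] _ N(1)]) (use N in simp)
  then show "D \<sigma> x v = (\<lambda>_ _. 0)" using flatD(2)[OF N(2,1) v] by simp
qed

lemma flat_cong:
  assumes "holomorphic_connection D" "flat D W \<sigma>" "\<And>y. y \<in> W \<Longrightarrow> \<tau> y = \<sigma> y"
  shows "flat D W \<tau>"
  by (rule flat_localI[OF assms(1) flatD(3)[OF assms(2)]]) (use assms in blast)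

lemma flat_comb:
  fixes S :: "nat \<Rightarrow> 'a \<Rightarrow> 'a jet"
  assumes D: "holomorphic_connection D" and W: "openin X W" and S: "\<And>i. i < 3 \<Longrightarrow> flat D W (S i)"
  shows "flat D W (\<lambda>y c k. \<Sum>i<3. a i * S i y c k)"
  unfolding flat_def
proof (intro conjI ballI)
  show "holo_section W (\<lambda>y c k. \<Sum>i<3. a i * S i y c k)"
    by (rule holo_section_comb[OF W flatD(1)[OF S] holo_fun_const[OF W]])
  fix x v assume x: "x \<in> W" and v: "v \<in> tangent x"
  show "D (\<lambda>y c k. \<Sum>i<3. a i * S i y c k) x v = (\<lambda>_ _. 0)"
    using conn_comb[where S=S and f="\<lambda>i _. a i", OF D flatD(1)[OF S] holo_fun_const[OF W] x v] flatD(2)[OF S x v]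
    by (simp add: differential_const)
qed

text \<open>By locality and the Leibniz rule, the terms with \<open>D (S i)\<close> being zero, the
  connection differentiates the coefficients in a flat frame.\<close>

lemma conn_flat_frame:
  assumes D: "holomorphic_connection D" and fr: "flat_frame D W S" and N: "openin X N" "N \<subseteq> W" "x \<in> N"
    and f: "\<And>i. i < 3 \<Longrightarrow> holo_fun N (f i)" and eq: "\<And>y. y \<in> N \<Longrightarrow> \<sigma> y = (\<lambda>d k. \<Sum>i<3. f i y * S i y d k)"
    and v: "v \<in> tangent x"
  shows "D \<sigma> x v = (\<lambda>c k. \<Sum>i<3. differential (f i) x v * S i x c k)"
proof -
  have S: "flat D N (S i)" if "i < 3" for i
    using fr flat_subset[OF _ N(1,2)] that by (auto simp: flat_frame_def)
  have h: "holo_section N (\<lambda>y d k. \<Sum>i<3. f i y * S i y d k)"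
    by (rule holo_section_comb[OF N(1) flatD(1)[OF S] f])
  have "D (\<lambda>y d k. \<Sum>i<3. f i y * S i y d k) x = D \<sigma> x"
    by (rule conn_local[OF D h _ N(3)]) (use eq in simp)
  then show ?thesis
    using conn_comb[where S=S and f=f, OF D flatD(1)[OF S] f N(3) v] flatD(2)[OF S N(3) v] by simp
qed

text \<open>In a common flat frame both connections differentiate the same coefficients. Outside
  tangent vectors and holomorphic germs both take the default value 0, so they are equal as
  functions.\<close>

lemma conn_unique:
  assumes D: "holomorphic_connection D" and D': "holomorphic_connection D'"
    and fr: "\<And>x. x \<in> topspace X \<Longrightarrow> \<exists>W S. x \<in> W \<and> flat_frame D W S \<and> flat_frame D' W S"
  shows "D = D'"
proof (intro ext)
  fix \<sigma> x v c and k :: nat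
  show "D \<sigma> x v c k = D' \<sigma> x v c k"
  proof (cases "\<exists>W. x \<in> W \<and> holo_section W \<sigma>")
    case False
    show ?thesis by (simp add: conn_zero[OF D False] conn_zero[OF D' False])
  next
    case True
    then obtain W' where W': "x \<in> W'" "holo_section W' \<sigma>" by blast
    show ?thesis
    proof (cases "v \<in> tangent x")
      case False
      then show ?thesis
        using conn_hom[OF D W'(2,1)] conn_hom[OF D' W'(2,1)] by (simp add: hom_tangent_def)
    next
      case v: True
      have "x \<in> topspace X" using W' openin_subset[OF holo_sectionD(1)] by blast
      then obtain W S where S: "x \<in> W" "flat_frame D W S" "flat_frame D' W S" using fr by blast
      obtain N f where N: "openin X N" "x \<in> N" "N \<subseteq> W \<inter> W'" "\<forall>i<3. holo_fun N (f i)"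
          "\<forall>y\<in>N. \<sigma> y = (\<lambda>d k. \<Sum>i<3. f i y * S i y d k)"
        using frame_expand[OF _ W'(2) S(1) W'(1), of S] S(2) by (auto simp: flat_frame_def)
      have "D \<sigma> x v = (\<lambda>c k. \<Sum>i<3. differential (f i) x v * S i x c k)"
        by (rule conn_flat_frame[OF D S(2) N(1) _ N(2) _ _ v]) (use N in auto)
      moreover have "D' \<sigma> x v = (\<lambda>c k. \<Sum>i<3. differential (f i) x v * S i x c k)"
        by (rule conn_flat_frame[OF D' S(3) N(1) _ N(2) _ _ v]) (use N in auto)
      ultimately show ?thesis by simp
    qed
  qed
qed

lemma holo_cd_zero_imp_const3:
  fixes f :: "nat \<Rightarrow> 'a \<Rightarrow> complex"
  assumes "\<And>i. i < 3 \<Longrightarrow> holo_fun W (f i)" "x \<in> W" "c \<in> charts_at x"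
    and "\<And>i y. i < 3 \<Longrightarrow> y \<in> W \<Longrightarrow> y \<in> fst c \<Longrightarrow> cd c (f i) y = 0"
  shows "\<exists>N a. openin X N \<and> x \<in> N \<and> N \<subseteq> W \<and> (\<forall>y\<in>N. \<forall>i<3. f i y = a i)"
proof -
  have "\<exists>N. openin X N \<and> x \<in> N \<and> N \<subseteq> W \<and> (\<exists>k. \<forall>y\<in>N. f i y = k)" if "i < 3" for i
    using cd_zero_imp_const[OF assms(1)[OF that] assms(2,3) assms(4)[OF that]] by blast
  then have "\<forall>i\<in>{..<3}. \<exists>N k. openin X N \<and> x \<in> N \<and> N \<subseteq> W \<and> (\<forall>y\<in>N. f i y = k)"
    by simp
  from bchoice[OF this] obtain N where
    "\<forall>i\<in>{..<3}. \<exists>k. openin X (N i) \<and> x \<in> N i \<and> N i \<subseteq> W \<and> (\<forall>y\<in>N i. f i y = k)" by (elim exE)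
  from bchoice[OF this] obtain a where
    N: "\<forall>i\<in>{..<3}. openin X (N i) \<and> x \<in> N i \<and> N i \<subseteq> W \<and> (\<forall>y\<in>N i. f i y = a i)" by (elim exE)
  let ?N = "\<Inter>(N ` {..<3})"
  have "openin X ?N" using N by (intro openin_Inter) (auto simp: lessThan_empty_iff)
  moreover have "x \<in> ?N" using N by simp
  moreover have "?N \<subseteq> W" using bspec[OF N, of 0] by auto
  moreover have "f i y = a i" if "y \<in> ?N" "i < 3" for i y using bspec[OF N, of i] that by simp
  ultimately show ?thesis by (intro exI[of _ ?N] exI[of _ a]) simp
qed

text \<open>Flatness makes the differentials of the coefficients vanish, by independence of the
  frame; so the coefficients are constant near x.\<close>

lemma flat_const_comb:
  assumes D: "holomorphic_connection D" and fr: "flat_frame D W S" and \<sigma>: "flat D W' \<sigma>"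
    and x: "x \<in> W" "x \<in> W'"
  shows "\<exists>N a. openin X N \<and> x \<in> N \<and> N \<subseteq> W \<inter> W' \<and> (\<forall>y\<in>N. \<sigma> y = (\<lambda>d k. \<Sum>i<3. a i * S i y d k))"
proof -
  have fr': "frame W S" using fr by (simp add: flat_frame_def)
  obtain N f where N: "openin X N" "x \<in> N" "N \<subseteq> W \<inter> W'" "\<And>i. i < 3 \<Longrightarrow> holo_fun N (f i)"
    "\<And>y. y \<in> N \<Longrightarrow> \<sigma> y = (\<lambda>d k. \<Sum>i<3. f i y * S i y d k)"
    using frame_expand[OF fr' flatD(1)[OF \<sigma>] x] by blast
  obtain c where c: "c \<in> charts_at x"
    using chart_exists[OF N(1)] N(2) by blast
  have z: "cd c (f i) y = 0" if i: "i < 3" and y: "y \<in> N" "y \<in> fst c" for i y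
  proof -
    have cy: "c \<in> charts_at y" using y c by (auto simp: charts_at_iff)
    let ?v = "coord_vec c y"
    have v: "?v \<in> tangent y" by (rule coord_vec_tangent[OF cy])
    have "(\<lambda>c k. \<Sum>i<3. differential (f i) y ?v * S i y c k) = D \<sigma> y ?v"
      by (rule conn_flat_frame[OF D fr N(1) _ y(1) N(4,5) v, symmetric]) (use N in auto)
    also have "\<dots> = (\<lambda>c k. \<Sum>i<3. 0 * S i y c k)"
      using flatD(2)[OF \<sigma> _ v] y N(3) by auto
    finally have e: "(\<lambda>c k. \<Sum>i<3. differential (f i) y ?v * S i y c k) = (\<lambda>c k. \<Sum>i<3. 0 * S i y c k)" .
    have "differential (f i) y ?v = 0"
      by (rule frame_independent[where a="\<lambda>i. differential (f i) y ?v" and b="\<lambda>_. 0", OF fr' _ e i])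
         (use y N in auto)
    then show ?thesis
      using differential_eq[OF N(4)[OF i] y(1) v cy] coord_vec_self[OF cy] by simp
  qed
  have "\<exists>N' a. openin X N' \<and> x \<in> N' \<and> N' \<subseteq> N \<and> (\<forall>y\<in>N'. \<forall>i<3. f i y = a i)"
    by (rule holo_cd_zero_imp_const3[OF N(4) N(2) c z])
  then obtain N' a where N': "openin X N'" "x \<in> N'" "N' \<subseteq> N" "\<forall>y\<in>N'. \<forall>i<3. f i y = a i"
    by (elim exE conjE)
  have "\<sigma> y = (\<lambda>d k. \<Sum>i<3. a i * S i y d k)" if "y \<in> N'" for y
    using N(5)[of y] N' that by (auto simp: sum_lessThan_3)
  then show ?thesis
    using N' N(3) by (intro exI[of _ N'] exI[of _ a]) auto
qed

text \<open>Both sections have constant coefficients in the frame, and these agree by independence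
  at x: a flat section is determined near x by its value there.\<close>

lemma flat_eq:
  assumes D: "holomorphic_connection D" and fr: "flat_frame D W S" and \<sigma>: "flat D W1 \<sigma>" and \<tau>: "flat D W2 \<tau>"
    and x: "x \<in> W" "x \<in> W1" "x \<in> W2" and eq: "\<sigma> x = \<tau> x"
  shows "\<exists>N. openin X N \<and> x \<in> N \<and> N \<subseteq> W \<inter> W1 \<inter> W2 \<and> (\<forall>y\<in>N. \<sigma> y = \<tau> y)"
proof -
  obtain N1 a where 1: "openin X N1" "x \<in> N1" "N1 \<subseteq> W \<inter> W1" "\<forall>y\<in>N1. \<sigma> y = (\<lambda>d k. \<Sum>i<3. a i * S i y d k)"
    using flat_const_comb[OF D fr \<sigma> x(1,2)] by (elim exE conjE)
  obtain N2 b where 2: "openin X N2" "x \<in> N2" "N2 \<subseteq> W \<inter> W2" "\<forall>y\<in>N2. \<tau> y = (\<lambda>d k. \<Sum>i<3. b i * S i y d k)"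
    using flat_const_comb[OF D fr \<tau> x(1,3)] by (elim exE conjE)
  have "a i = b i" if "i < 3" for i
    by (rule frame_independent[OF _ x(1) _ that, of S]) (use fr 1(2,4) 2(2,4) eq in \<open>auto simp: flat_frame_def\<close>)
  then have "\<sigma> y = \<tau> y" if "y \<in> N1 \<inter> N2" for y
    using 1(4) 2(4) that by (simp add: sum_lessThan_3)
  then show ?thesis
    using 1(1-3) 2(1-3) by (intro exI[of _ "N1 \<inter> N2"]) auto
qed

text \<open>Let \<open>D\<close> differentiate the coefficients of a section in any frame of the
  family. A constant change of frame commutes with differentiation, which is all that
  well-definedness asks for.\<close>

lemma glued_connection:
  assumes cover: "\<And>x. x \<in> topspace X \<Longrightarrow> \<exists>W S. (W, S) \<in> FR \<and> x \<in> W"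
    and fr: "\<And>W S. (W, S) \<in> FR \<Longrightarrow> frame W S"
    and compat: "\<And>W S W' S' x. (W, S) \<in> FR \<Longrightarrow> (W', S') \<in> FR \<Longrightarrow> x \<in> W \<Longrightarrow> x \<in> W' \<Longrightarrow>
      \<exists>N a. openin X N \<and> x \<in> N \<and> N \<subseteq> W \<inter> W' \<and> (\<forall>y\<in>N. \<forall>i<3. S' i y = (\<lambda>d k. \<Sum>j<3. a i j * S j y d k))"
  shows "\<exists>D. holomorphic_connection D \<and> (\<forall>(W, S)\<in>FR. \<forall>i<3. flat D W (S i))"
proof -
  \<comment> \<open>\<open>R\<close> lists the data of one admissible computation: an expansion near
    x in a frame of the family.\<close>
  define R where "R = (\<lambda>W S N f \<sigma> x. (W, S) \<in> FR \<and> openin X N \<and> x \<in> N \<and> N \<subseteq> W \<and>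
    (\<forall>i<3. holo_fun N (f i)) \<and> (\<forall>y\<in>N. \<sigma> y = (\<lambda>d k. \<Sum>i<3. f i y * S i y d k)))"
  define val where "val = (\<lambda>S f x v d k. \<Sum>i<3. differential (f i) x v * (S :: nat \<Rightarrow> 'a \<Rightarrow> 'a jet) i x d k)"
  \<comment> \<open>The value is picked among all computations; \<open>val_eq\<close> shows that
    they agree.\<close>
  define D :: "'a connection" where "D = (\<lambda>\<sigma> x v. if (\<exists>W S N f. R W S N f \<sigma> x) \<and> v \<in> tangent x
    then (SOME j. \<exists>W S N f. R W S N f \<sigma> x \<and> j = val S f x v) else (\<lambda>_ _. 0))"
  have R_I: "R W S N f \<sigma> x" if "(W, S) \<in> FR" "openin X N" "x \<in> N" "N \<subseteq> W"
    "\<And>i. i < 3 \<Longrightarrow> holo_fun N (f i)" "\<And>y. y \<in> N \<Longrightarrow> \<sigma> y = (\<lambda>d k. \<Sum>i<3. f i y * S i y d k)"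
    for W S N f \<sigma> x using that by (simp add: R_def)
  have R_D: "(W, S) \<in> FR" "openin X N" "x \<in> N" "N \<subseteq> W"
    "i < 3 \<Longrightarrow> holo_fun N (f i)" "y \<in> N \<Longrightarrow> \<sigma> y = (\<lambda>d k. \<Sum>i<3. f i y * S i y d k)"
    if "R W S N f \<sigma> x" for W S N f \<sigma> x i y
    using that by (simp_all add: R_def)
  have R_frame: "frame W S" if "R W S N f \<sigma> x" for W S N f \<sigma> x
    using fr[OF R_D(1)[OF that]] .
  have R_sec: "holo_section N (S i)" if "R W S N f \<sigma> x" "i < 3" for W S N f \<sigma> x i
    by (rule holo_section_subset[OF frameD(1)[OF R_frame[OF that(1)] that(2)] R_D(2,4)[OF that(1)]])
  have R_move: "R W S N f \<sigma> y" if "R W S N f \<sigma> x" "y \<in> N" for W S N f \<sigma> x y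
    using that by (simp add: R_def)
  \<comment> \<open>On the common domain f = g a with a constant matrix a; hence df = dg a, and the
    same a expresses the second frame by the first.\<close>
  have val_eq: "val S f x v = val S' g x v"
    if R: "R W S N f \<sigma> x" and R': "R W' S' N' g \<sigma> x" and v: "v \<in> tangent x" for W S N f \<sigma> x W' S' N' g v
  proof -
    have "x \<in> W" "x \<in> W'" using R_D(3,4)[OF R] R_D(3,4)[OF R'] by auto
    then obtain M a where M: "openin X M" "x \<in> M" "M \<subseteq> W \<inter> W'"
      "\<And>y i. y \<in> M \<Longrightarrow> i < 3 \<Longrightarrow> S' i y = (\<lambda>d k. \<Sum>j<3. a i j * S j y d k)"
      using compat[OF R_D(1)[OF R] R_D(1)[OF R'] \<open>x \<in> W\<close> \<open>x \<in> W'\<close>] by (elim exE conjE) simp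
    let ?N = "N \<inter> N' \<inter> M"
    have op: "openin X ?N" by (intro openin_Int R_D(2)[OF R] R_D(2)[OF R'] M(1))
    have xN: "x \<in> ?N" using R_D(3)[OF R] R_D(3)[OF R'] M(2) by blast
    obtain c where c: "c \<in> charts_at x"
      using chart_exists[OF op] xN by blast
    have g: "holo_fun ?N (\<lambda>y. g i y * b)" if "i < 3" for i b
      using holo_fun_subset[OF R_D(5)[OF R' that] op] holo_fun_const[OF op] by (intro holo_fun_mult) auto
    have sumeq: "(\<lambda>d k. \<Sum>i<3. g i y * S' i y d k) = (\<lambda>d k. \<Sum>j<3. (\<Sum>i<3. g i y * a i j) * S j y d k)"
      if y: "y \<in> ?N" for y
      using M(4)[of y 0] M(4)[of y "Suc 0"] M(4)[of y 2] y by (auto simp: sum_lessThan_3 algebra_simps)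
    have f_eq: "f j y = (\<Sum>i<3. g i y * a i j)" if j: "j < 3" and y: "y \<in> ?N" for j y
    proof (rule frame_independent[OF R_frame[OF R] _ _ j])
      show "y \<in> W" using M(3) y by blast
      show "(\<lambda>d k. \<Sum>i<3. f i y * S i y d k) = (\<lambda>d k. \<Sum>j<3. (\<Sum>i<3. g i y * a i j) * S j y d k)"
        using R_D(6)[OF R, of y] R_D(6)[OF R', of y] sumeq[OF y] y by simp
    qed
    have df: "differential (f j) x v = (\<Sum>i<3. differential (g i) x v * a i j)" if j: "j < 3" for j
    proof -
      have "cd c (f j) x = cd c (\<lambda>y. \<Sum>i<3. g i y * a i j) x"
        by (rule cd_cong[OF op xN c f_eq[OF j]])
      also have "\<dots> = (\<Sum>i<3. cd c (\<lambda>y. g i y * a i j) x)"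
        by (rule cd_sum[OF op _ xN c]) (simp add: g)
      also have "\<dots> = (\<Sum>i<3. cd c (g i) x * a i j)"
        using cd_mult[OF R_D(5)[OF R'] holo_fun_const[OF R_D(2)[OF R']] R_D(3)[OF R'] c]
        by (simp add: cd_const)
      finally show ?thesis
        using differential_eq[OF R_D(5)[OF R j] R_D(3)[OF R] v c] differential_eq[OF R_D(5)[OF R'] R_D(3)[OF R'] v c]
        by (simp add: sum_distrib_left mult_ac)
    qed
    have Sx: "S' i x = (\<lambda>d k. \<Sum>j<3. a i j * S j x d k)" if "i < 3" for i
      using M(4)[OF M(2) that] .
    show ?thesis
      unfolding val_def by (intro ext) (simp add: df Sx sum_lessThan_3 algebra_simps)
  qed
  have D_eq: "D \<sigma> x v = val S f x v" if R: "R W S N f \<sigma> x" and v: "v \<in> tangent x" for W S N f \<sigma> x v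
  proof -
    have "(SOME j. \<exists>W S N f. R W S N f \<sigma> x \<and> j = val S f x v) = val S f x v"
    proof (rule some_equality)
      show "\<exists>W S' N g. R W S' N g \<sigma> x \<and> val S f x v = val S' g x v" using R by blast
      fix j assume "\<exists>W S N f. R W S N f \<sigma> x \<and> j = val S f x v"
      then show "j = val S f x v" using val_eq[OF R _ v] by metis
    qed
    then show ?thesis using R v unfolding D_def by auto
  qed
  have expand: "\<exists>N f. R W S N f \<sigma> x \<and> N \<subseteq> W'"
    if h: "(W, S) \<in> FR" "x \<in> W" "holo_section W' \<sigma>" "x \<in> W'" for W S W' \<sigma> x
  proof -
    obtain N f where N: "openin X N" "x \<in> N" "N \<subseteq> W \<inter> W'" "\<forall>i<3. holo_fun N (f i)"
        "\<forall>y\<in>N. \<sigma> y = (\<lambda>d k. \<Sum>i<3. f i y * S i y d k)"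
      using frame_expand[OF fr[OF h(1)] h(3,2,4)] by (elim exE conjE)
    then have "R W S N f \<sigma> x" using h(1) by (intro R_I) auto
    then show ?thesis using N(3) by blast
  qed
  have ex: "\<exists>W S N f. R W S N f \<sigma> x \<and> N \<subseteq> W'" if "holo_section W' \<sigma>" "x \<in> W'" for W' \<sigma> x
  proof -
    have "x \<in> topspace X" using openin_subset[OF holo_sectionD(1)[OF that(1)]] that(2) by blast
    then obtain W S where "(W, S) \<in> FR" "x \<in> W" using cover by blast
    from expand[OF this that] show ?thesis by blast
  qed
  have R_section: "holo_section N \<sigma>" if R: "R W S N f \<sigma> x" for W S N f \<sigma> x
    by (rule holo_section_cong[OF holo_section_comb[OF R_D(2)[OF R] R_sec[OF R] R_D(5)[OF R]]])
       (use R_D(6)[OF R] in auto)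
  have conn: "holomorphic_connection D"
    unfolding holomorphic_connection_def
  proof (intro conjI allI impI ballI)
    fix \<sigma> x assume n: "\<not> (\<exists>W. x \<in> W \<and> holo_section W \<sigma>)"
    have "\<not> (\<exists>W S N f. R W S N f \<sigma> x)"
    proof
      assume "\<exists>W S N f. R W S N f \<sigma> x"
      then obtain W S N f where R: "R W S N f \<sigma> x" by (elim exE)
      show False using n R_section[OF R] R_D(3)[OF R] by blast
    qed
    then show "D \<sigma> x = (\<lambda>_ _ _. 0)" by (simp add: D_def)
  next
    fix W' \<sigma> \<tau> x assume h: "holo_section W' \<sigma>" "holo_section W' \<tau>" "\<forall>x\<in>W'. \<sigma> x = \<tau> x" "x \<in> W'"
    obtain W S N f where R: "R W S N f \<sigma> x" "N \<subseteq> W'" using ex[OF h(1,4)] by (elim exE conjE)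
    have R': "R W S N f \<tau> x"
    proof (rule R_I[OF R_D(1-5)[OF R(1)]])
      fix y assume "y \<in> N"
      then show "\<tau> y = (\<lambda>d k. \<Sum>i<3. f i y * S i y d k)"
        using R_D(6)[OF R(1), of y] R(2) h(3) by (metis subsetD)
    qed
    show "D \<sigma> x = D \<tau> x"
    proof
      fix v show "D \<sigma> x v = D \<tau> x v"
        by (cases "v \<in> tangent x") (simp_all add: D_eq[OF R(1)] D_eq[OF R'], simp add: D_def)
    qed
  next
    fix W' \<sigma> x assume h: "holo_section W' \<sigma>" "x \<in> W'"
    obtain W S N f where R: "R W S N f \<sigma> x" "N \<subseteq> W'" using ex[OF h] by (elim exE conjE)
    obtain c where c: "c \<in> charts_at x"
      using chart_exists[OF R_D(2)[OF R(1)]] R_D(3)[OF R(1)] by blast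
    show "D \<sigma> x \<in> hom_tangent x (J 2 x)"
      unfolding hom_tangent_def
    proof (intro CollectI conjI allI impI ballI)
      fix v assume "v \<notin> tangent x"
      then show "D \<sigma> x v = (\<lambda>_ _. 0)" by (simp add: D_def)
    next
      fix v assume v: "v \<in> tangent x"
      show "D \<sigma> x v \<in> J 2 x"
        unfolding D_eq[OF R(1) v] val_def
        by (rule J_comb) (use holo_sectionD(2)[OF R_sec[OF R(1)] R_D(3)[OF R(1)]] in blast)
    next
      fix u v a b assume uv: "u \<in> tangent x" "v \<in> tangent x"
      have d: "differential (f i) x (\<lambda>c. a * u c + b * v c) = a * differential (f i) x u + b * differential (f i) x v"
        if "i < 3" for i
        using differential_eq[OF R_D(5)[OF R(1) that] R_D(3)[OF R(1)] _ c] uv tangent_lin[OF uv, of a b]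
        by (simp add: algebra_simps)
      show "D \<sigma> x (\<lambda>c. a * u c + b * v c) = (\<lambda>c i. a * D \<sigma> x u c i + b * D \<sigma> x v c i)"
        unfolding D_eq[OF R(1) uv(1)] D_eq[OF R(1) uv(2)] D_eq[OF R(1) tangent_lin[OF uv]] val_def
        by (intro ext) (simp add: d sum_lessThan_3 algebra_simps)
    qed
  next
    fix W' \<sigma> W'' s assume h: "holo_section W' \<sigma>" "W'' \<subseteq> W'" "holo_vf W'' s"
    show "holo_section W'' (\<lambda>x. D \<sigma> x (s x))"
    proof (rule holo_section_localI[OF holo_vfD(1)[OF h(3)]])
      fix x assume x: "x \<in> W''"
      then have xW': "x \<in> W'" using h(2) by blast
      obtain W S N f where R: "R W S N f \<sigma> x" "N \<subseteq> W'" using ex[OF h(1) xW'] by (elim exE conjE)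
      obtain c where c: "c \<in> charts_at x"
        using chart_exists[OF R_D(2)[OF R(1)]] R_D(3)[OF R(1)] by blast
      have cA: "c \<in> A" "x \<in> fst c" using c by auto
      let ?N = "N \<inter> W'' \<inter> fst c"
      have op: "openin X ?N" using openin_Int[OF R_D(2)[OF R(1)] holo_vfD(1)[OF h(3)]] cA(1) by (rule openin_chart_Int)
      let ?g = "\<lambda>i y. cd c (f i) y * s y c"
      have g: "holo_fun ?N (?g i)" if "i < 3" for i
        using holo_fun_cd[OF R_D(5)[OF R(1) that] cA(1)] holo_vfD(3)[OF h(3) cA(1)]
        by (intro holo_fun_mult holo_fun_subset[OF _ op]) auto
      have S: "holo_section ?N (S i)" if "i < 3" for i
        by (rule holo_section_subset[OF R_sec[OF R(1) that] op]) auto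
      have "D \<sigma> y (s y) = (\<lambda>d k. \<Sum>i<3. ?g i y * S i y d k)" if y: "y \<in> ?N" for y
      proof -
        have R': "R W S N f \<sigma> y" using R_move[OF R(1)] y by blast
        have v: "s y \<in> tangent y" using holo_vfD(2)[OF h(3)] y by blast
        have "c \<in> charts_at y" using cA y by (simp add: charts_at_iff)
        then show ?thesis
          unfolding D_eq[OF R' v] val_def
          using differential_eq[OF R_D(5)[OF R'] R_D(3)[OF R'] v] by (simp add: sum_lessThan_3)
      qed
      then show "\<exists>N t. x \<in> N \<and> holo_section N t \<and> (\<forall>y\<in>N. D \<sigma> y (s y) = t y)"
        using holo_section_comb[OF op S g] x R_D(3)[OF R(1)] cA(2)
        by (intro exI[of _ ?N] exI[of _ "\<lambda>y d k. \<Sum>i<3. ?g i y * S i y d k"]) simp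
    qed
  next
    fix W' \<sigma> \<tau> x v assume h: "holo_section W' \<sigma>" "holo_section W' \<tau>" "x \<in> W'" and v: "v \<in> tangent x"
    obtain W S N f where R: "R W S N f \<sigma> x" "N \<subseteq> W'" using ex[OF h(1,3)] by (elim exE conjE)
    \<comment> \<open>\<open>expand\<close> instead of \<open>ex\<close>: both sections must be
      expanded in the same frame for the coefficients to be added.\<close>
    obtain N' g where R': "R W S N' g \<tau> x" "N' \<subseteq> W'"
      using expand[OF R_D(1)[OF R(1)] subsetD[OF R_D(4,3)[OF R(1)]] h(2,3)] by (elim exE conjE)
    have op: "openin X (N \<inter> N')" using R_D(2)[OF R(1)] R_D(2)[OF R'(1)] by blast
    have xN: "x \<in> N \<inter> N'" using R_D(3)[OF R(1)] R_D(3)[OF R'(1)] by blast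
    have f: "holo_fun (N \<inter> N') (f i)" "holo_fun (N \<inter> N') (g i)" if "i < 3" for i
      using R_D(5)[OF R(1) that] R_D(5)[OF R'(1) that] by (auto intro: holo_fun_subset[OF _ op])
    have R2: "R W S (N \<inter> N') (\<lambda>i y. f i y + g i y) (\<lambda>y c i. \<sigma> y c i + \<tau> y c i) x"
    proof (rule R_I[OF R_D(1)[OF R(1)] op xN])
      show "N \<inter> N' \<subseteq> W" using R_D(4)[OF R(1)] by blast
      show "holo_fun (N \<inter> N') (\<lambda>y. f i y + g i y)" if "i < 3" for i using f[OF that] by (rule holo_fun_add)
      show "(\<lambda>c i. \<sigma> y c i + \<tau> y c i) = (\<lambda>d k. \<Sum>i<3. (f i y + g i y) * S i y d k)" if "y \<in> N \<inter> N'" for y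
        using R_D(6)[OF R(1), of y] R_D(6)[OF R'(1), of y] that by (simp add: sum_lessThan_3 algebra_simps)
    qed
    obtain c where c: "c \<in> charts_at x" using chart_exists[OF op] xN by blast
    have d: "differential (\<lambda>y. f i y + g i y) x v = differential (f i) x v + differential (g i) x v" if "i < 3" for i
      using differential_eq[OF holo_fun_add[OF f[OF that]] xN v c] differential_eq[OF f(1)[OF that] xN v c]
        differential_eq[OF f(2)[OF that] xN v c] cd_add[OF f[OF that] xN c] by (simp add: algebra_simps)
    show "D (\<lambda>y c i. \<sigma> y c i + \<tau> y c i) x v = (\<lambda>c i. D \<sigma> x v c i + D \<tau> x v c i)"
      unfolding D_eq[OF R(1) v] D_eq[OF R'(1) v] D_eq[OF R2 v] val_def
      by (intro ext) (simp add: d sum_lessThan_3 algebra_simps)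
  next
    fix W' f \<sigma> x v assume h: "holo_fun W' f" "holo_section W' \<sigma>" "x \<in> W'" and v: "v \<in> tangent x"
    obtain W S N g where R: "R W S N g \<sigma> x" "N \<subseteq> W'" using ex[OF h(2,3)] by (elim exE conjE)
    note op = R_D(2)[OF R(1)] and xN = R_D(3)[OF R(1)]
    have f: "holo_fun N f" by (rule holo_fun_subset[OF h(1) op R(2)])
    note g = R_D(5)[OF R(1)]
    have R2: "R W S N (\<lambda>i y. f y * g i y) (\<lambda>y c i. f y * \<sigma> y c i) x"
    proof (rule R_I[OF R_D(1)[OF R(1)] op xN R_D(4)[OF R(1)]])
      show "holo_fun N (\<lambda>y. f y * g i y)" if "i < 3" for i using f g[OF that] by (rule holo_fun_mult)
      show "(\<lambda>c i. f y * \<sigma> y c i) = (\<lambda>d k. \<Sum>i<3. (f y * g i y) * S i y d k)" if "y \<in> N" for y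
        using R_D(6)[OF R(1) that] by (simp add: sum_lessThan_3 algebra_simps)
    qed
    obtain c where c: "c \<in> charts_at x" using chart_exists[OF op] xN by blast
    have d: "differential (\<lambda>y. f y * g i y) x v = f x * differential (g i) x v + differential f x v * g i x" if "i < 3" for i
      using differential_eq[OF holo_fun_mult[OF f g[OF that]] xN v c] differential_eq[OF f xN v c]
        differential_eq[OF g[OF that] xN v c] cd_mult[OF f g[OF that] xN c] by (simp add: algebra_simps)
    show "D (\<lambda>y c i. f y * \<sigma> y c i) x v = (\<lambda>c i. f x * D \<sigma> x v c i + differential f x v * \<sigma> x c i)"
      unfolding D_eq[OF R(1) v] D_eq[OF R2 v] val_def
      using R_D(6)[OF R(1) xN]
      by (intro ext) (simp add: d sum_lessThan_3 algebra_simps)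
  qed
  have "flat D W (S i)" if WS: "(W, S) \<in> FR" and i: "i < 3" for W S i
    unfolding flat_def
  proof (intro conjI ballI frameD(1)[OF fr[OF WS] i])
    fix x v assume x: "x \<in> W" and v: "v \<in> tangent x"
    have op: "openin X W" by (rule frameD(3)[OF fr[OF WS]])
    \<comment> \<open>A frame section has coefficients 0 and 1 in its own frame, and these are
      constant.\<close>
    have "R W S W (\<lambda>j _. if j = i then 1 else 0) (S i) x"
    proof (rule R_I[OF WS op x order_refl])
      show "holo_fun W (\<lambda>_. if j = i then 1 else 0)" for j by (rule holo_fun_const[OF op])
      consider "i = 0" | "i = Suc 0" | "i = 2" using i by linarith
      then show "S i y = (\<lambda>d k. \<Sum>j<3. (if j = i then 1 else 0) * S j y d k)" for y
        by cases (simp_all add: sum_lessThan_3)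
    qed
    from D_eq[OF this v] show "D (S i) x v = (\<lambda>_ _. 0)"
      by (simp add: val_def differential_const)
  qed
  then show ?thesis using conn by blast
qed

section \<open>Connections with flat jets of vector fields\<close>

text \<open>\<open>det3\<close> reads only the entries at \<open>c\<close>, so the derivative of a
  section may be passed to it as a family that differentiates each chart entry in its own
  coordinate.\<close>

lemma cd_det3:
  assumes \<rho>: "holo_section W \<rho>" and \<sigma>: "holo_section W \<sigma>" and \<tau>: "holo_section W \<tau>"
    and x: "x \<in> W" and c: "c \<in> charts_at x"
  shows "cd c (\<lambda>y. det3 c (\<rho> y) (\<sigma> y) (\<tau> y)) x =
    det3 c (\<lambda>d k. cd d (\<lambda>y. \<rho> y d k) x) (\<sigma> x) (\<tau> x) + det3 c (\<rho> x) (\<lambda>d k. cd d (\<lambda>y. \<sigma> y d k) x) (\<tau> x)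
      + det3 c (\<rho> x) (\<sigma> x) (\<lambda>d k. cd d (\<lambda>y. \<tau> y d k) x)"
proof -
  have cA: "c \<in> A" and xW: "x \<in> W \<inter> fst c" using c x by auto
  note h = holo_sectionD(3)[OF \<rho> cA] holo_sectionD(3)[OF \<sigma> cA] holo_sectionD(3)[OF \<tau> cA]
  show ?thesis
    unfolding det3_def
    by (simp add: cd_add[OF _ _ xW c] cd_diff[OF _ _ xW c] cd_mult[OF _ _ xW c] h
        holo_fun_add holo_fun_diff holo_fun_mult)
       (simp add: algebra_simps)
qed

text \<open>The coordinate form of a connection with companion matrix: flat sections are the jets of
  solutions of a''' = q0 a + q1 a' + q2 a''. The first two rows force a flat section to be a
  jet.\<close>

definition third_order :: "'a connection \<Rightarrow> 'a chart \<Rightarrow> 'a \<Rightarrow> complex \<Rightarrow> complex \<Rightarrow> complex \<Rightarrow> bool" where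
  "third_order D c x q0 q1 q2 \<longleftrightarrow> (\<forall>W \<sigma> v. holo_section W \<sigma> \<longrightarrow> x \<in> W \<longrightarrow> v \<in> tangent x \<longrightarrow>
     D \<sigma> x v c 0 = v c * (cd c (\<lambda>y. \<sigma> y c 0) x - \<sigma> x c (Suc 0)) \<and>
     D \<sigma> x v c (Suc 0) = v c * (cd c (\<lambda>y. \<sigma> y c (Suc 0)) x - \<sigma> x c 2) \<and>
     D \<sigma> x v c 2 = v c * (cd c (\<lambda>y. \<sigma> y c 2) x - (q0 * \<sigma> x c 0 + q1 * \<sigma> x c (Suc 0) + q2 * \<sigma> x c 2)))"

lemma third_orderD:
  assumes "third_order D c x q0 q1 q2" "holo_section W \<sigma>" "x \<in> W" "v \<in> tangent x"
  shows "D \<sigma> x v c 0 = v c * (cd c (\<lambda>y. \<sigma> y c 0) x - \<sigma> x c (Suc 0))"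
    "D \<sigma> x v c (Suc 0) = v c * (cd c (\<lambda>y. \<sigma> y c (Suc 0)) x - \<sigma> x c 2)"
    "D \<sigma> x v c 2 = v c * (cd c (\<lambda>y. \<sigma> y c 2) x - (q0 * \<sigma> x c 0 + q1 * \<sigma> x c (Suc 0) + q2 * \<sigma> x c 2))"
  using assms(1)[unfolded third_order_def, rule_format, OF assms(2-4)] by simp_all

text \<open>In the flat frame, D \<sigma> is the derivative of \<sigma> minus the frame derivatives
  weighted by the coefficients of \<sigma>. Differentiating a jet shifts its entries by one order,
  which gives the first two rows; the equation satisfied by the three fields gives the third. The
  second claim is Abel's identity for their Wronskian.\<close>

lemma jet_frame_formula:
  assumes D: "holomorphic_connection D" and s: "\<And>i. i < 3 \<Longrightarrow> holo_vf W (s i)"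
    and fr: "flat_frame D W (\<lambda>i. jet 2 (s i))" and x: "x \<in> W" and c: "c \<in> charts_at x"
  shows "\<exists>q0 q1 q2. third_order D c x q0 q1 q2 \<and>
    q2 * det3 c (jet 2 (s 0) x) (jet 2 (s (Suc 0)) x) (jet 2 (s 2) x) =
      cd c (\<lambda>y. det3 c (jet 2 (s 0) y) (jet 2 (s (Suc 0)) y) (jet 2 (s 2) y)) x"
proof -
  have cA: "c \<in> A" "x \<in> fst c" using c by auto
  have fr': "frame W (\<lambda>i. jet 2 (s i))" using fr by (simp add: flat_frame_def)
  have opW: "openin X W" by (rule frameD(3)[OF fr'])
  have opc: "openin X (W \<inter> fst c)" by (rule openin_chart_Int[OF opW cA(1)])
  have xc: "x \<in> W \<inter> fst c" using x cA by simp
  have S: "holo_section W (jet 2 (s i))" if "i < 3" for i using holo_section_jet[OF s[OF that]] .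
  note d0 = cd_jet(1)[OF c] and d1 = cd_jet(2)[OF c]
  define T where "T = (\<lambda>i. cd c (\<lambda>y. jet 2 (s i) y c 2) x)"
  \<comment> \<open>Coefficients in a frame are unique, so any coefficients g of \<sigma> at x are
    the values at x of those of an expansion near x.\<close>
  have key: "D \<sigma> x v c k = v c * (cd c (\<lambda>y. \<sigma> y c k) x - (\<Sum>i<3. g i * cd c (\<lambda>y. jet 2 (s i) y c k) x)) \<and>
      \<sigma> x = (\<lambda>d k. \<Sum>i<3. g i * jet 2 (s i) x d k)"
    if \<sigma>: "holo_section W' \<sigma>" "x \<in> W'" and v: "v \<in> tangent x" and k: "k \<le> 2"
      and g: "\<sigma> x = (\<lambda>d k. \<Sum>i<3. g i * jet 2 (s i) x d k)" for W' \<sigma> v k g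
  proof -
    obtain N f where N: "openin X N" "x \<in> N" "N \<subseteq> W \<inter> W'" "\<forall>i<3. holo_fun N (f i)"
      "\<forall>y\<in>N. \<sigma> y = (\<lambda>d k. \<Sum>i<3. f i y * jet 2 (s i) y d k)"
      using frame_expand[OF fr' \<sigma>(1) x \<sigma>(2)] by (elim exE conjE)
    have fg: "f i x = g i" if "i < 3" for i
      by (rule frame_independent[where a="\<lambda>i. f i x" and b=g, OF fr' x _ that]) (use g N(2,5) in simp)
    have opN: "openin X (N \<inter> fst c)" by (rule openin_chart_Int[OF N(1) cA(1)])
    have xN: "x \<in> N \<inter> fst c" using N cA by simp
    have hf: "holo_fun (N \<inter> fst c) (f i)" and hS: "holo_fun (N \<inter> fst c) (\<lambda>y. jet 2 (s i) y c k)" if "i < 3" for i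
      using N(3,4) that by (auto intro!: holo_fun_subset[OF _ opN] holo_fun_subset[OF holo_sectionD(3)[OF S[OF that] cA(1) k] opN])
    have "cd c (\<lambda>y. \<sigma> y c k) x = cd c (\<lambda>y. \<Sum>i<3. f i y * jet 2 (s i) y c k) x"
      by (rule cd_cong[OF N(1,2) c]) (use N(5) in simp)
    also have "\<dots> = (\<Sum>i<3. cd c (\<lambda>y. f i y * jet 2 (s i) y c k) x)"
      by (rule cd_sum[OF opN _ xN c]) (simp add: holo_fun_mult hf hS)
    also have "\<dots> = (\<Sum>i<3. cd c (f i) x * jet 2 (s i) x c k + f i x * cd c (\<lambda>y. jet 2 (s i) y c k) x)"
      using cd_mult[OF hf hS xN c] by simp
    finally have 1: "cd c (\<lambda>y. \<sigma> y c k) x = \<dots>" .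
    have "D \<sigma> x v = (\<lambda>c k. \<Sum>i<3. differential (f i) x v * jet 2 (s i) x c k)"
      by (rule conn_flat_frame[OF D fr N(1) _ N(2) _ _ v]) (use N in auto)
    moreover have "differential (f i) x v = cd c (f i) x * v c" if "i < 3" for i
      by (rule differential_eq[OF hf[OF that] xN v c])
    ultimately show ?thesis
      unfolding 1 using g by (simp add: sum_lessThan_3 fg algebra_simps)
  qed
  have ex: "\<exists>g. \<sigma> x = (\<lambda>d k. \<Sum>i<3. g i * jet 2 (s i) x d k)" if \<sigma>: "holo_section W' \<sigma>" "x \<in> W'" for W' \<sigma>
  proof -
    obtain N f where N: "openin X N" "x \<in> N" "N \<subseteq> W \<inter> W'" "\<forall>i<3. holo_fun N (f i)"
      "\<forall>y\<in>N. \<sigma> y = (\<lambda>d k. \<Sum>i<3. f i y * jet 2 (s i) y d k)"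
      using frame_expand[OF fr' \<sigma>(1) x \<sigma>(2)] by (elim exE conjE)
    then show ?thesis by (intro exI[of _ "\<lambda>i. f i x"]) simp
  qed
  define u where "u = (\<lambda>i k. jet 2 (s i) x c k)"
  define \<Delta> where "\<Delta> = det3 c (jet 2 (s 0) x) (jet 2 (s (Suc 0)) x) (jet 2 (s 2) x)"
  have \<Delta>0: "\<Delta> \<noteq> 0" using frameD(2)[OF fr' x c] by (simp add: \<Delta>_def)
  \<comment> \<open>\<open>jj f0 f1 f2\<close> is the determinant with rows
    \<open>(f0 i, f1 i, f2 i)\<close>. Below, q0, q1, q2 solve by Cramer's rule the linear system
    saying that each \<open>s i\<close> satisfies the third-order equation at x; \<open>T i\<close>
    is its third derivative there.\<close>
  define jj :: "(nat \<Rightarrow> complex) \<Rightarrow> (nat \<Rightarrow> complex) \<Rightarrow> (nat \<Rightarrow> complex) \<Rightarrow> complex" where "jj = (\<lambda>f0 f1 f2. det3 c (\<lambda>_ k. if k = 0 then f0 0 else if k = 1 then f1 0 else f2 0)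
     (\<lambda>_ k. if k = 0 then f0 1 else if k = 1 then f1 1 else f2 1)
     (\<lambda>_ k. if k = 0 then f0 2 else if k = 1 then f1 2 else f2 2))"
  define q0 where "q0 = jj T (\<lambda>i. u i 1) (\<lambda>i. u i 2) / \<Delta>"
  define q1 where "q1 = jj (\<lambda>i. u i 0) T (\<lambda>i. u i 2) / \<Delta>"
  define q2 where "q2 = jj (\<lambda>i. u i 0) (\<lambda>i. u i 1) T / \<Delta>"
  have q: "q0 * u i 0 + q1 * u i (Suc 0) + q2 * u i 2 = T i" if "i < 3" for i
  proof -
    consider "i = 0" | "i = Suc 0" | "i = 2" using \<open>i < 3\<close> by linarith
    then have "\<Delta> * (q0 * u i 0 + q1 * u i (Suc 0) + q2 * u i 2) = \<Delta> * T i"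
    proof cases
    qed (simp_all add: q0_def q1_def q2_def \<Delta>0 distrib_left,
        simp_all add: jj_def \<Delta>_def det3_def u_def algebra_simps)
    then show ?thesis using \<Delta>0 by simp
  qed
  have "third_order D c x q0 q1 q2"
    unfolding third_order_def
  proof (intro allI impI conjI)
    fix W' \<sigma> v assume \<sigma>: "holo_section W' \<sigma>" "x \<in> W'" and v: "v \<in> tangent x"
    obtain g where g: "\<sigma> x = (\<lambda>d k. \<Sum>i<3. g i * jet 2 (s i) x d k)" using ex[OF \<sigma>] by (elim exE)
    note k = key[OF \<sigma> v _ g, THEN conjunct1]
    show "D \<sigma> x v c 0 = v c * (cd c (\<lambda>y. \<sigma> y c 0) x - \<sigma> x c (Suc 0))"
      using k[of 0] g by (simp add: sum_lessThan_3 d0)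
    show "D \<sigma> x v c (Suc 0) = v c * (cd c (\<lambda>y. \<sigma> y c (Suc 0)) x - \<sigma> x c 2)"
      using k[of "Suc 0"] g by (simp add: sum_lessThan_3 d1)
    have "(\<Sum>i<3. g i * T i) = q0 * \<sigma> x c 0 + q1 * \<sigma> x c (Suc 0) + q2 * \<sigma> x c 2"
      unfolding g using q[of 0] q[of "Suc 0"] q[of 2]
      by (simp add: sum_lessThan_3 u_def[symmetric]) (simp add: u_def algebra_simps flip: q)
    then show "D \<sigma> x v c 2 = v c * (cd c (\<lambda>y. \<sigma> y c 2) x - (q0 * \<sigma> x c 0 + q1 * \<sigma> x c (Suc 0) + q2 * \<sigma> x c 2))"
      using k[of 2] by (simp add: T_def)
  qed
  moreover have "q2 * \<Delta> = cd c (\<lambda>y. det3 c (jet 2 (s 0) y) (jet 2 (s (Suc 0)) y) (jet 2 (s 2) y)) x"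
  proof -
    have "q2 * \<Delta> = jj (\<lambda>i. u i 0) (\<lambda>i. u i 1) T" using \<Delta>0 by (simp add: q2_def)
    \<comment> \<open>Abel's identity: in the derivative of the Wronskian everything cancels except
      the determinant with second derivatives replaced by third ones.\<close>
    also have "\<dots> = cd c (\<lambda>y. det3 c (jet 2 (s 0) y) (jet 2 (s (Suc 0)) y) (jet 2 (s 2) y)) x"
      unfolding cd_det3[OF S[of 0] S[of "Suc 0"] S[of 2] x c, simplified]
      by (simp add: det3_def jj_def u_def d0 d1 T_def[symmetric]) (simp add: T_def algebra_simps)
    finally show ?thesis .
  qed
  ultimately show ?thesis unfolding \<Delta>_def by blast
qed

lemma lie_bracket_jet:
  "c \<in> charts_at x \<Longrightarrow> lie_bracket s t x c = jet 2 s x c 0 * jet 2 t x c (Suc 0) - jet 2 t x c 0 * jet 2 s x c (Suc 0)"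
  by (simp add: lie_bracket_def jet_0 jet_1 cd_def)

lemma cd_zero_on:
  "openin X W \<Longrightarrow> x \<in> W \<Longrightarrow> c \<in> charts_at x \<Longrightarrow> (\<And>y. y \<in> W \<Longrightarrow> y \<in> fst c \<Longrightarrow> F y = 0) \<Longrightarrow> cd c F x = 0"
  using cd_cong[of W x c F "\<lambda>_. 0"] by (simp add: cd_const)

text \<open>2 is the Wronskian of 1, z, z^2, and the constants \<open>B\<close> say that the span of
  the fields is a Lie algebra. The four conditions are derived from the local existence of such
  frames.\<close>

definition sl2_frame :: "'a connection \<Rightarrow> 'a set \<Rightarrow> (nat \<Rightarrow> 'a \<Rightarrow> 'a tvec) \<Rightarrow> bool" where
  "sl2_frame D W s \<longleftrightarrow> (\<forall>i<3. holo_vf W (s i)) \<and> flat_frame D W (\<lambda>i. jet 2 (s i)) \<and>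
     (\<forall>y\<in>W. \<forall>c\<in>charts_at y. det3 c (jet 2 (s 0) y) (jet 2 (s (Suc 0)) y) (jet 2 (s 2) y) = 2) \<and>
     (\<exists>B. \<forall>i<3. \<forall>j<3. \<forall>y\<in>W. lie_bracket (s i) (s j) y = (\<lambda>c. \<Sum>k<3. B i j k * s k y c))"

section \<open>From local frames of fields to the four conditions\<close>

context
  fixes D :: "'a connection"
  assumes D: "holomorphic_connection D"
    and local_frame: "\<And>x. x \<in> topspace X \<Longrightarrow> \<exists>W s. x \<in> W \<and> sl2_frame D W s"
begin

text \<open>Abel's identity with the constant Wronskian 2 forces q2 = 0.\<close>

lemma connection_formula:
  assumes c: "c \<in> charts_at x"
  shows "\<exists>q0 q1. third_order D c x q0 q1 0"
proof -
  obtain W s where W: "x \<in> W" "sl2_frame D W s" using local_frame charts_at_topspace[OF c] by blast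
  have s: "\<And>i. i < 3 \<Longrightarrow> holo_vf W (s i)" and fr: "flat_frame D W (\<lambda>i. jet 2 (s i))"
    and det: "\<And>y c. y \<in> W \<Longrightarrow> c \<in> charts_at y \<Longrightarrow>
      det3 c (jet 2 (s 0) y) (jet 2 (s (Suc 0)) y) (jet 2 (s 2) y) = 2"
    using W(2) by (auto simp: sl2_frame_def)
  have op: "openin X W" using holo_vfD(1)[OF s[of 0]] by simp
  have z: "cd c (\<lambda>y. det3 c (jet 2 (s 0) y) (jet 2 (s (Suc 0)) y) (jet 2 (s 2) y)) x = cd c (\<lambda>_. 2) x"
    by (rule cd_cong[OF op W(1) c]) (use c in \<open>auto intro!: det simp: charts_at_iff\<close>)
  have "\<exists>q0 q1 q2. third_order D c x q0 q1 q2 \<and>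
    q2 * det3 c (jet 2 (s 0) x) (jet 2 (s (Suc 0)) x) (jet 2 (s 2) x) =
      cd c (\<lambda>y. det3 c (jet 2 (s 0) y) (jet 2 (s (Suc 0)) y) (jet 2 (s 2) y)) x"
    by (rule jet_frame_formula[OF D _ fr W(1) c]) (rule s)
  then obtain q0 q1 q2 where q: "third_order D c x q0 q1 q2" "q2 * det3 c (jet 2 (s 0) x) (jet 2 (s (Suc 0)) x) (jet 2 (s 2) x) =
      cd c (\<lambda>y. det3 c (jet 2 (s 0) y) (jet 2 (s (Suc 0)) y) (jet 2 (s 2) y)) x"
    by (elim exE conjE)
  have "q2 = 0" using q(2) det[OF W(1) c] by (simp add: z cd_const)
  then show ?thesis using q(1) by blast
qed

lemma connection_formula_0:
  assumes "c \<in> charts_at x" "holo_section W \<sigma>" "x \<in> W" "v \<in> tangent x"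
  shows "D \<sigma> x v c 0 = v c * (cd c (\<lambda>y. \<sigma> y c 0) x - \<sigma> x c (Suc 0))"
  using connection_formula[OF assms(1)] third_orderD(1)[OF _ assms(2-4)] by blast

lemma connection_formula_1:
  assumes "c \<in> charts_at x" "holo_section W \<sigma>" "x \<in> W" "v \<in> tangent x"
  shows "D \<sigma> x v c (Suc 0) = v c * (cd c (\<lambda>y. \<sigma> y c (Suc 0)) x - \<sigma> x c 2)"
  using connection_formula[OF assms(1)] third_orderD(2)[OF _ assms(2-4)] by blast

lemma conn_outside:
  assumes "holo_section W \<sigma>" "x \<in> W" "v \<in> tangent x" "c \<notin> charts_at x \<or> \<not> i \<le> 2"
  shows "D \<sigma> x v c i = 0"
  using conn_hom[OF D assms(1,2)] assms(3,4) J_outside[of "D \<sigma> x v" x c i] unfolding hom_tangent_def by blast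

lemma holo_section_K_incl:
  assumes "holo_form W \<theta>"
  shows "holo_section W (\<lambda>y. K_incl y (\<theta> y))"
proof (rule holo_section_localI)
  show W: "openin X W" using assms by (simp add: holo_form_def)
  fix x assume x: "x \<in> W"
  obtain c where c: "c \<in> charts_at x" using chart_exists[OF W] x by blast
  have cA: "c \<in> A" "x \<in> fst c" using c by auto
  let ?N = "W \<inter> fst c"
  have op: "openin X ?N" by (rule openin_chart_Int[OF W cA(1)])
  have "holo_vf ?N (\<lambda>y d. 1 * coord_vec c y d)"
    by (rule holo_vf_coord[OF cA(1) holo_fun_const[OF op]]) simp
  then have "holo_fun ?N (\<lambda>y. \<theta> y (\<lambda>d. 1 * coord_vec c y d))"
    using assms by (simp add: holo_form_def)
  then have "holo_section ?N (\<lambda>y. jet_of c 0 0 (\<theta> y (coord_vec c y)) y)"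
    by (intro holo_section_jet_of[OF cA(1)] holo_fun_const[OF op]) simp_all
  moreover have "K_incl y (\<theta> y) = jet_of c 0 0 (\<theta> y (coord_vec c y)) y" if "y \<in> ?N" for y
    by (rule K_incl_eq) (use that assms cA in \<open>auto simp: holo_form_def charts_at_iff\<close>)
  ultimately show "\<exists>N t. x \<in> N \<and> holo_section N t \<and> (\<forall>y\<in>N. K_incl y (\<theta> y) = t y)"
    using x cA by (intro exI[of _ ?N] exI[of _ "\<lambda>y. jet_of c 0 0 (\<theta> y (coord_vec c y)) y"]) simp
qed

text \<open>The section has derivatives (0, 0, b), so the first-order entry of its image is -b on
  the coordinate vector; \<open>O_incl\<close> has -1 in this entry, and the signs cancel.\<close>

lemma sff_K2_one: "sff_K2 D (\<lambda>_. 1)"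
  unfolding sff_K2_def
proof (intro allI impI ballI)
  fix W \<theta> x v assume \<theta>: "holo_form W \<theta>" and x: "x \<in> W" and v: "v \<in> tangent x"
  have W: "openin X W" and \<theta>x: "\<And>y. y \<in> W \<Longrightarrow> \<theta> y \<in> cotangent y" using \<theta> by (auto simp: holo_form_def)
  have xX: "x \<in> topspace X" using openin_subset[OF W] x by blast
  let ?\<sigma> = "\<lambda>y. K_incl y (\<theta> y)"
  have \<sigma>: "holo_section W ?\<sigma>" by (rule holo_section_K_incl[OF \<theta>])
  have K: "K_incl y (\<theta> y) = jet_of d 0 0 (\<theta> y (coord_vec d y)) y" if "y \<in> W" "d \<in> charts_at y" for d y
    by (rule K_incl_eq[OF \<theta>x[OF that(1)] that(2)])
  show "trunc 1 (D ?\<sigma> x v) = O_incl x (1 * \<theta> x v)"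
  proof (intro ext)
    fix d and i :: nat
    show "trunc 1 (D ?\<sigma> x v) d i = O_incl x (1 * \<theta> x v) d i"
    proof (cases "d \<in> charts_at x \<and> i \<le> 1")
      case True
      then have d: "d \<in> charts_at x" by simp
      note q = connection_formula_0[OF d \<sigma> x v] connection_formula_1[OF d \<sigma> x v]
      have z: "cd d (\<lambda>y. ?\<sigma> y d 0) x = 0" "cd d (\<lambda>y. ?\<sigma> y d (Suc 0)) x = 0"
        using d by (auto intro!: cd_zero_on[OF W x d] simp: K charts_at_iff jet_of_self)
      have i: "i = 0 \<or> i = Suc 0" using True by linarith
      have "\<theta> x v = v d * \<theta> x (coord_vec d x)" by (rule cotangent_eq[OF \<theta>x[OF x] v d])
      then show ?thesis
        using i d q z K[OF x d] by (auto simp: trunc_def O_incl_eq[OF xX] jet_of_self[OF d])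
    next
      case False
      then show ?thesis
        using conn_outside[OF \<sigma> x v, of d i] by (auto simp: trunc_def O_incl_eq[OF xX])
    qed
  qed
qed

text \<open>By the sign of \<open>O_incl\<close> the section has value 0 and first derivative -g, so
  the zeroth row of the formula gives 0 - (-g) = g.\<close>

lemma sff_F2_one: "sff_F2 D (\<lambda>_. 1)"
  unfolding sff_F2_def
proof (intro allI impI ballI)
  fix W \<sigma> g x v assume \<sigma>: "holo_section W \<sigma>" and g: "holo_fun W g"
    and F2: "\<forall>y\<in>W. \<sigma> y \<in> F2 y \<and> trunc 1 (\<sigma> y) = O_incl y (g y)" and x: "x \<in> W" and v: "v \<in> tangent x"
  have W: "openin X W" using \<sigma> by (rule holo_sectionD)
  have xX: "x \<in> topspace X" using openin_subset[OF W] x by blast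
  have z: "\<sigma> y d 0 = 0" if "y \<in> W" for y d
    using F2 that by (auto simp: F2_def p0_def dest: fun_cong)
  show "p0 (D \<sigma> x v) = (\<lambda>c. 1 * g x * v c)"
  proof
    fix d
    show "p0 (D \<sigma> x v) d = 1 * g x * v d"
    proof (cases "d \<in> charts_at x")
      case d: True
      have q: "D \<sigma> x v d 0 = v d * (cd d (\<lambda>y. \<sigma> y d 0) x - \<sigma> x d (Suc 0))"
        by (rule connection_formula_0[OF d \<sigma> x v])
      have "trunc 1 (\<sigma> x) d (Suc 0) = - g x" using F2 x d by (simp add: O_incl_eq[OF xX])
      then show ?thesis
        using q cd_zero_on[OF W x d z] by (simp add: p0_def trunc_def)
    next
      case False
      then show ?thesis using conn_outside[OF \<sigma> x v, of d 0] tangent_zero[OF v] by (simp add: p0_def)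
    qed
  qed
qed

lemma conn_in_hom_tangent:
  assumes \<sigma>: "holo_section W \<sigma>" "x \<in> W" and E: "\<And>v. v \<in> tangent x \<Longrightarrow> D \<sigma> x v \<in> E"
  shows "D \<sigma> x \<in> hom_tangent x E"
  using conn_hom[OF D \<sigma>] E unfolding hom_tangent_def by blast

text \<open>The zeroth row vanishes on (0, 0, a), so the image lies in F2. For the converse, both
  entries of the wanted value can be prescribed at x, through the value and the derivative of
  a.\<close>

lemma conn_K2_image:
  assumes x: "x \<in> topspace X"
  shows "{D \<sigma> x | W \<sigma>. x \<in> W \<and> holo_section W \<sigma> \<and> (\<forall>y\<in>W. \<sigma> y \<in> K2 y)} = hom_tangent x (F2 x)"
proof (intro equalityI subsetI)
  fix \<omega> assume "\<omega> \<in> {D \<sigma> x | W \<sigma>. x \<in> W \<and> holo_section W \<sigma> \<and> (\<forall>y\<in>W. \<sigma> y \<in> K2 y)}"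
  then obtain W \<sigma> where \<omega>: "\<omega> = D \<sigma> x" and xW: "x \<in> W" and \<sigma>: "holo_section W \<sigma>" and K: "\<And>y. y \<in> W \<Longrightarrow> \<sigma> y \<in> K2 y"
    by blast
  have W: "openin X W" using \<sigma> by (rule holo_sectionD)
  have z: "\<sigma> y d 0 = 0" "\<sigma> y d (Suc 0) = 0" if "y \<in> W" for y d
  proof -
    have "trunc 1 (\<sigma> y) d i = 0" for i using K[OF that] by (simp add: K2_def)
    from this[of 0] this[of 1] show "\<sigma> y d 0 = 0" "\<sigma> y d (Suc 0) = 0" by (simp_all add: trunc_def)
  qed
  have "D \<sigma> x v \<in> F2 x" if v: "v \<in> tangent x" for v
  proof -
    have "D \<sigma> x v d 0 = 0" for d
    proof (cases "d \<in> charts_at x")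
      case d: True
      have "D \<sigma> x v d 0 = v d * (cd d (\<lambda>y. \<sigma> y d 0) x - \<sigma> x d (Suc 0))"
        by (rule connection_formula_0[OF d \<sigma> xW v])
      then show ?thesis using cd_zero_on[OF W xW d z(1)] z(2)[OF xW] by simp
    next
      case False
      then show ?thesis using conn_outside[OF \<sigma> xW v, of d 0] by simp
    qed
    then show ?thesis using conn_hom[OF D \<sigma> xW] v by (auto simp: F2_def p0_def hom_tangent_def)
  qed
  then show "\<omega> \<in> hom_tangent x (F2 x)"
    unfolding \<omega> by (rule conn_in_hom_tangent[OF \<sigma> xW])
next
  fix \<omega> assume \<omega>: "\<omega> \<in> hom_tangent x (F2 x)"
  obtain c where c: "c \<in> charts_at x" using charts_at_nonempty[OF x] by blast
  have cA: "c \<in> A" "x \<in> fst c" using c by auto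
  have op: "openin X (fst c)" by (rule open_chart_domain[OF cA(1)])
  obtain q0 q1 where q: "third_order D c x q0 q1 0" using connection_formula[OF c] by blast
  define e where "e = coord_vec c x"
  have e: "e \<in> tangent x" "e c = 1" unfolding e_def by (rule coord_vec_tangent[OF c], rule coord_vec_self[OF c])
  have \<omega>e: "\<omega> e \<in> J 2 x" "\<omega> e c 0 = 0"
    using \<omega> e(1) by (auto simp: hom_tangent_def F2_def p0_def dest: fun_cong)
  define b1 b2 where "b1 = \<omega> e c (Suc 0)" and "b2 = \<omega> e c 2"
  \<comment> \<open>At x the entries of order 1 and 2 of the image are -a and a' (here q2 = 0), so a
    has to take the value -b1 and the derivative b2.\<close>
  define a where "a = (\<lambda>y. b2 * (snd c y - snd c x) - b1)"
  have h: "holo_fun (fst c) (\<lambda>y. snd c y - snd c x)"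
    by (intro holo_fun_diff holo_fun_const[OF op] holo_fun_chart[OF cA(1)])
  have a: "holo_fun (fst c) a"
    unfolding a_def by (intro holo_fun_diff holo_fun_mult h holo_fun_const[OF op])
  have da: "cd c a x = b2"
    unfolding a_def
    using cd_diff[OF holo_fun_chart[OF cA(1)] holo_fun_const[OF op] cA(2) c, of "snd c x"] cd_self[OF c]
    by (simp add: cd_diff[OF holo_fun_mult[OF holo_fun_const[OF op] h] holo_fun_const[OF op] cA(2) c]
        cd_cmult[OF h cA(2) c] cd_const)
  define \<sigma> where "\<sigma> = (\<lambda>y. jet_of c 0 0 (a y) y)"
  have ch: "c \<in> charts_at y" if "y \<in> fst c" for y using that cA by (simp add: charts_at_iff)
  have \<sigma>: "holo_section (fst c) \<sigma>"
    unfolding \<sigma>_def by (rule holo_section_jet_of[OF cA(1) order_refl holo_fun_const[OF op] holo_fun_const[OF op] a])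
  have K: "\<sigma> y \<in> K2 y" if "y \<in> fst c" for y
  proof -
    have "trunc 1 (\<sigma> y) = (\<lambda>_ _. 0)"
      by (intro ext) (simp add: \<sigma>_def trunc_def jet_of_def)
    then show ?thesis using jet_of_in_J[OF ch[OF that]] by (simp add: \<sigma>_def K2_def)
  qed
  have d0: "cd c (\<lambda>y. \<sigma> y c 0) x = 0" "cd c (\<lambda>y. \<sigma> y c (Suc 0)) x = 0"
    by (auto intro!: cd_zero_on[OF op cA(2) c] simp: \<sigma>_def jet_of_self[OF ch])
  have d2: "cd c (\<lambda>y. \<sigma> y c 2) x = b2"
    using cd_cong[OF op cA(2) c, of "\<lambda>y. \<sigma> y c 2" a] da by (simp add: \<sigma>_def jet_of_self[OF ch])
  have "D \<sigma> x e = \<omega> e"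
  proof (rule J_eqI[OF _ \<omega>e(1) c])
    show "D \<sigma> x e \<in> J 2 x" using conn_hom[OF D \<sigma> cA(2)] e(1) by (simp add: hom_tangent_def)
    show "D \<sigma> x e c 0 = \<omega> e c 0" "D \<sigma> x e c (Suc 0) = \<omega> e c (Suc 0)" "D \<sigma> x e c 2 = \<omega> e c 2"
      using third_orderD[OF q \<sigma> cA(2) e(1)] d0 d2 \<omega>e(2) e(2)
      by (simp_all add: \<sigma>_def jet_of_self[OF c] b1_def b2_def a_def)
  qed
  moreover have lin: "\<eta> v = (\<lambda>d i. v c * \<eta> e d i)" if \<eta>: "\<eta> \<in> hom_tangent x E" and v: "v \<in> tangent x" for \<eta> E v
  proof -
    have "\<eta> (\<lambda>d. v c * e d + 0 * e d) = (\<lambda>d i. v c * \<eta> e d i + 0 * \<eta> e d i)"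
      using \<eta> e(1) unfolding hom_tangent_def by blast
    then show ?thesis using tangent_eq_coord_vec[OF v c] by (simp add: e_def)
  qed
  ultimately have "D \<sigma> x v = \<omega> v" for v
  proof (cases "v \<in> tangent x")
    case True
    then show ?thesis using \<open>D \<sigma> x e = \<omega> e\<close> lin[OF conn_hom[OF D \<sigma> cA(2)]] lin[OF \<omega>] by metis
  next
    case False
    then show ?thesis using conn_hom[OF D \<sigma> cA(2)] \<omega> by (simp add: hom_tangent_def)
  qed
  then have "D \<sigma> x = \<omega>" by blast
  then show "\<omega> \<in> {D \<sigma> x | W \<sigma>. x \<in> W \<and> holo_section W \<sigma> \<and> (\<forall>y\<in>W. \<sigma> y \<in> K2 y)}"
    using \<sigma> K cA(2) by blast
qed

lemma oper: "oper_connection D"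
  unfolding oper_connection_def using conn_K2_image sff_K2_one sff_F2_one by blast

text \<open>The first two rows of the formula say a0' = a1 and a1' = a2 for a flat section.\<close>

lemma flat_imp_jet:
  assumes \<sigma>: "flat D W \<sigma>" and x: "x \<in> W"
  shows "jet 2 (\<lambda>y. p0 (\<sigma> y)) x = \<sigma> x"
proof -
  note h = flatD(1)[OF \<sigma>]
  have W: "openin X W" using h by (rule holo_sectionD)
  obtain c where c: "c \<in> charts_at x" using chart_exists[OF W] x by blast
  have cA: "c \<in> A" "x \<in> fst c" using c by auto
  have e: "cd c (\<lambda>y. \<sigma> y c 0) y = \<sigma> y c (Suc 0)" "cd c (\<lambda>y. \<sigma> y c (Suc 0)) y = \<sigma> y c 2"
    if y: "y \<in> W" "y \<in> fst c" for y
  proof -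
    have cy: "c \<in> charts_at y" using y cA by (simp add: charts_at_iff)
    have v: "coord_vec c y \<in> tangent y" by (rule coord_vec_tangent[OF cy])
    have "D \<sigma> y (coord_vec c y) c 0 = coord_vec c y c * (cd c (\<lambda>y. \<sigma> y c 0) y - \<sigma> y c (Suc 0))"
      "D \<sigma> y (coord_vec c y) c (Suc 0) = coord_vec c y c * (cd c (\<lambda>y. \<sigma> y c (Suc 0)) y - \<sigma> y c 2)"
      using connection_formula_0[OF cy h y(1) v] connection_formula_1[OF cy h y(1) v] by simp_all
    then show "cd c (\<lambda>y. \<sigma> y c 0) y = \<sigma> y c (Suc 0)" "cd c (\<lambda>y. \<sigma> y c (Suc 0)) y = \<sigma> y c 2"
      using flatD(2)[OF \<sigma> y(1) v] coord_vec_self[OF cy] by simp_all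
  qed
  have "cd c (cd c (\<lambda>y. \<sigma> y c 0)) x = cd c (\<lambda>y. \<sigma> y c (Suc 0)) x"
    by (rule cd_cong[OF W x c e(1)])
  then have e2: "cd c (cd c (\<lambda>y. \<sigma> y c 0)) x = \<sigma> x c 2" using e(2)[OF x cA(2)] by simp
  show ?thesis
  proof (rule J_eqI[OF _ _ c])
    show "jet 2 (\<lambda>y. p0 (\<sigma> y)) x \<in> J 2 x"
      using holo_sectionD(2)[OF holo_section_jet[OF holo_vf_p0[OF h]] x] .
    show "\<sigma> x \<in> J 2 x" by (rule holo_sectionD(2)[OF h x])
  qed (use e(1)[OF x cA(2)] e2 in \<open>simp_all add: jet_0[OF c] jet_1[OF c] jet_2[OF c] p0_def\<close>)
qed

text \<open>The witness is the combination of the flat frame with the coefficients of j at x; any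
  other candidate also gives j, by \<open>flat_imp_jet\<close>.\<close>

lemma F_endo_id:
  assumes j: "j \<in> J 2 x"
  shows "F_endo D x j = j"
  unfolding F_endo_def
proof (rule the_equality)
  obtain W s where W: "x \<in> W" "sl2_frame D W s" using local_frame J_topspace[OF j] by blast
  have fr: "flat_frame D W (\<lambda>i. jet 2 (s i))" using W(2) by (simp add: sl2_frame_def)
  have fr': "frame W (\<lambda>i. jet 2 (s i))" using fr by (simp add: flat_frame_def)
  have op: "openin X W" by (rule frameD(3)[OF fr'])
  obtain c where c: "c \<in> charts_at x" using chart_exists[OF op] W(1) by blast
  have cA: "c \<in> A" "x \<in> fst c" using c by auto
  have opc: "openin X (fst c)" by (rule open_chart_domain[OF cA(1)])
  \<comment> \<open>An auxiliary extension of j, not flat in general: it serves to read off the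
    coefficients of j at x from \<open>frame_expand\<close>.\<close>
  have h: "holo_section (fst c) (\<lambda>y. jet_of c (j c 0) (j c (Suc 0)) (j c 2) y)"
    by (rule holo_section_jet_of[OF cA(1) order_refl]) (rule holo_fun_const[OF opc])+
  obtain N f where N: "openin X N" "x \<in> N" "N \<subseteq> W \<inter> fst c" "\<forall>i<3. holo_fun N (f i)"
      "\<forall>y\<in>N. jet_of c (j c 0) (j c (Suc 0)) (j c 2) y = (\<lambda>d k. \<Sum>i<3. f i y * jet 2 (s i) y d k)"
    using frame_expand[OF fr' h W(1) cA(2)] by (elim exE conjE)
  have jx: "j = (\<lambda>d k. \<Sum>i<3. f i x * jet 2 (s i) x d k)"
    using J_eq_jet_of[OF j c] N(2,5) by simp
  let ?\<sigma> = "\<lambda>y d k. \<Sum>i<3. f i x * jet 2 (s i) y d k"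
  have fl: "flat D W ?\<sigma>"
    by (rule flat_comb[OF D op]) (use fr in \<open>simp add: flat_frame_def\<close>)
  show "\<exists>W \<sigma>. x \<in> W \<and> flat D W \<sigma> \<and> \<sigma> x = j \<and> j = jet 2 (\<lambda>y. p0 (\<sigma> y)) x"
    by (rule exI[of _ W], rule exI[of _ ?\<sigma>])
       (simp only: W(1) fl flat_imp_jet[OF fl W(1)] jx[symmetric] simp_thms)
next
  fix k assume "\<exists>W \<sigma>. x \<in> W \<and> flat D W \<sigma> \<and> \<sigma> x = j \<and> k = jet 2 (\<lambda>y. p0 (\<sigma> y)) x"
  then obtain W \<sigma> where "x \<in> W" "flat D W \<sigma>" "\<sigma> x = j" "k = jet 2 (\<lambda>y. p0 (\<sigma> y)) x"
    by (elim exE conjE)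
  then show "k = j" by (simp add: flat_imp_jet)
qed

text \<open>The connection matrix in a chart has trace q2 = 0, and the sign in
  \<open>det_triv_eq\<close> affects both sides alike.\<close>

lemma trivial_det: "induces_trivial_det D"
  unfolding induces_trivial_det_def
proof (intro allI impI ballI)
  fix W \<rho> \<sigma> \<tau> x v
  assume h: "holo_section W \<rho>" "holo_section W \<sigma>" "holo_section W \<tau>" and x: "x \<in> W" and v: "v \<in> tangent x"
  have W: "openin X W" using h(1) by (rule holo_sectionD)
  obtain c where c: "c \<in> charts_at x" using chart_exists[OF W] x by blast
  have cA: "c \<in> A" "x \<in> fst c" using c by auto
  have op: "openin X (W \<inter> fst c)" by (rule openin_chart_Int[OF W cA(1)])
  have xc: "x \<in> W \<inter> fst c" using x cA by simp
  have ch: "c \<in> charts_at y" if "y \<in> W \<inter> fst c" for y using that cA by (simp add: charts_at_iff)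
  have DJ: "D \<phi> x v \<in> J 2 x" if "holo_section W \<phi>" for \<phi>
    using conn_hom[OF D that x] v by (simp add: hom_tangent_def)
  note J = holo_sectionD(2)[OF h(1)] holo_sectionD(2)[OF h(2)] holo_sectionD(2)[OF h(3)]
  obtain q0 q1 where q: "third_order D c x q0 q1 0" using connection_formula[OF c] by blast
  let ?F = "\<lambda>y. det_triv y (\<rho> y) (\<sigma> y) (\<tau> y)" and ?G = "\<lambda>y. det3 c (\<rho> y) (\<sigma> y) (\<tau> y)"
  have G: "holo_fun (W \<inter> fst c) ?G" by (rule holo_fun_det3[OF cA(1) h])
  have F_eq: "?F y = - ?G y" if "y \<in> W \<inter> fst c" for y
    using det_triv_eq[OF ch[OF that]] J that by simp
  have F: "holo_fun (W \<inter> fst c) ?F"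
    by (rule holo_fun_cong[OF holo_fun_uminus[OF G]]) (simp add: F_eq)
  have "cd c ?F x = cd c (\<lambda>y. - ?G y) x"
    by (rule cd_cong[OF op xc c F_eq])
  then have "differential ?F x v = - cd c ?G x * v c"
    using differential_eq[OF F xc v c] cd_uminus[OF G xc c] by simp
  also have "\<dots> = - det3 c (D \<rho> x v) (\<sigma> x) (\<tau> x) - det3 c (\<rho> x) (D \<sigma> x v) (\<tau> x) - det3 c (\<rho> x) (\<sigma> x) (D \<tau> x v)"
    unfolding cd_det3[OF h x c]
    by (simp add: det3_def third_orderD[OF q h(1) x v] third_orderD[OF q h(2) x v] third_orderD[OF q h(3) x v])
       (simp add: algebra_simps)
  finally show "det_triv x (D \<rho> x v) (\<sigma> x) (\<tau> x) + det_triv x (\<rho> x) (D \<sigma> x v) (\<tau> x)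
        + det_triv x (\<rho> x) (\<sigma> x) (D \<tau> x v) = differential ?F x v"
    using det_triv_eq[OF c] J[OF x] DJ[OF h(1)] DJ[OF h(2)] DJ[OF h(3)] by simp
qed

text \<open>Fields with flat jets are locally constant combinations of the frame, so their bracket
  is one as well, by the constants \<open>B\<close>.\<close>

lemma bracket_closed: "flat_fields_bracket_closed D"
  unfolding flat_fields_bracket_closed_def
proof (intro allI impI)
  fix W' s' t' assume vf: "holo_vf W' s'" "holo_vf W' t'" and fl: "flat D W' (jet 2 s')" "flat D W' (jet 2 t')"
  show "flat D W' (jet 2 (lie_bracket s' t'))"
  proof (rule flat_localI[OF D holo_vfD(1)[OF vf(1)]])
    fix x assume x: "x \<in> W'"
    have xX: "x \<in> topspace X" using openin_subset[OF holo_vfD(1)[OF vf(1)]] x by blast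
    obtain W s where W: "x \<in> W" "sl2_frame D W s" using local_frame[OF xX] by blast
    have fr: "flat_frame D W (\<lambda>i. jet 2 (s i))" and s: "\<And>i. i < 3 \<Longrightarrow> holo_vf W (s i)"
      and "\<exists>B. \<forall>i<3. \<forall>j<3. \<forall>y\<in>W. lie_bracket (s i) (s j) y = (\<lambda>c. \<Sum>k<3. B i j k * s k y c)"
      using W(2) by (simp_all add: sl2_frame_def)
    then obtain B where "\<forall>i<3. \<forall>j<3. \<forall>y\<in>W. lie_bracket (s i) (s j) y = (\<lambda>c. \<Sum>k<3. B i j k * s k y c)"
      by (elim exE)
    then have B: "lie_bracket (s i) (s j) y = (\<lambda>c. \<Sum>k<3. B i j k * s k y c)"
      if "i < 3" "j < 3" "y \<in> W" for i j y using that by simp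
    obtain N1 a where N1: "openin X N1" "x \<in> N1" "N1 \<subseteq> W \<inter> W'"
      "\<forall>y\<in>N1. jet 2 s' y = (\<lambda>d k. \<Sum>i<3. a i * jet 2 (s i) y d k)"
      using flat_const_comb[OF D fr fl(1) W(1) x] by (elim exE conjE)
    obtain N2 b where N2: "openin X N2" "x \<in> N2" "N2 \<subseteq> W \<inter> W'"
      "\<forall>y\<in>N2. jet 2 t' y = (\<lambda>d k. \<Sum>i<3. b i * jet 2 (s i) y d k)"
      using flat_const_comb[OF D fr fl(2) W(1) x] by (elim exE conjE)
    let ?N = "N1 \<inter> N2"
    have op: "openin X ?N" using N1(1) N2(1) by blast
    define e where "e = (\<lambda>k. \<Sum>i<3. \<Sum>j<3. a i * b j * B i j k)"
    let ?t = "\<lambda>y c. \<Sum>k<3. e k * s k y c"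
    have eq: "lie_bracket s' t' y = ?t y" if y: "y \<in> ?N" for y
    proof
      fix c
      have yW: "y \<in> W" using y N1(3) by blast
      show "lie_bracket s' t' y c = ?t y c"
      proof (cases "c \<in> charts_at y")
        case c: True
        have "lie_bracket s' t' y c = (\<Sum>i<3. \<Sum>j<3. a i * b j * lie_bracket (s i) (s j) y c)"
          unfolding lie_bracket_jet[OF c] using N1(4) N2(4) y by (simp add: sum_lessThan_3 algebra_simps)
        also have "\<dots> = ?t y c"
          using B[OF _ _ yW] by (simp add: sum_lessThan_3 e_def algebra_simps)
        finally show ?thesis .
      next
        case False
        then show ?thesis
          using tangent_zero[OF holo_vfD(2)[OF s yW]] by (simp add: lie_bracket_def)
      qed
    qed
    have sN: "holo_vf ?N (s i)" if "i < 3" for i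
      by (rule holo_vf_subset[OF s[OF that] op]) (use N1(3) in blast)
    have flN: "flat D ?N (\<lambda>y c k. \<Sum>i<3. e i * jet 2 (s i) y c k)"
    proof (rule flat_comb[OF D op])
      show "flat D ?N (jet 2 (s i))" if "i < 3" for i
        by (rule flat_subset[OF _ op]) (use fr N1(3) that in \<open>auto simp: flat_frame_def\<close>)
    qed
    have "jet 2 (lie_bracket s' t') y = (\<lambda>c k. \<Sum>i<3. e i * jet 2 (s i) y c k)" if y: "y \<in> ?N" for y
      using jet_cong[OF op y eq] jet_comb[OF op sN y] by simp
    then show "\<exists>N \<tau>. x \<in> N \<and> flat D N \<tau> \<and> (\<forall>y\<in>N. jet 2 (lie_bracket s' t') y = \<tau> y)"
      using flN N1(2) N2(2)
      by (intro exI[of _ ?N] exI[of _ "\<lambda>y c k. \<Sum>i<3. e i * jet 2 (s i) y c k"]) simp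
  qed
qed

end

section \<open>The vector fields generated by the projective group\<close>

definition local_coord :: "'a set \<Rightarrow> ('a \<Rightarrow> complex) \<Rightarrow> bool" where
  "local_coord W h \<longleftrightarrow> holo_fun W h \<and> (\<forall>y\<in>W. \<forall>c\<in>charts_at y. cd c h y \<noteq> 0)"

text \<open>The field h^i d/dh, the pullback of z^i d/dz by h.\<close>

definition hfield :: "('a \<Rightarrow> complex) \<Rightarrow> nat \<Rightarrow> 'a \<Rightarrow> 'a tvec" where
  "hfield h i y = (\<lambda>c. if c \<in> charts_at y then h y ^ i / cd c h y else 0)"

lemma local_coordD:
  "local_coord W h \<Longrightarrow> holo_fun W h" "local_coord W h \<Longrightarrow> y \<in> W \<Longrightarrow> c \<in> charts_at y \<Longrightarrow> cd c h y \<noteq> 0"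
  "local_coord W h \<Longrightarrow> openin X W"
  using holo_funD(1) by (auto simp: local_coord_def)

lemma local_coord_subset: "local_coord W h \<Longrightarrow> openin X W' \<Longrightarrow> W' \<subseteq> W \<Longrightarrow> local_coord W' h"
  unfolding local_coord_def using holo_fun_subset by blast

lemma holo_vf_hfield:
  assumes h: "local_coord W h"
  shows "holo_vf W (hfield h i)"
  unfolding holo_vf_iff
proof (intro conjI ballI)
  note hh = local_coordD(1)[OF h]
  show W: "openin X W" by (rule holo_funD(1)[OF hh])
  fix x assume x: "x \<in> W"
  show "hfield h i x \<in> tangent x"
  proof (rule tangentI)
    fix c d assume cd: "c \<in> charts_at x" "d \<in> charts_at x"
    show "hfield h i x d = cd c (snd d) x * hfield h i x c"
      using cd cd_chain[OF hh x cd] local_coordD(2)[OF h x] transition_nonzero[OF cd] by (simp add: hfield_def)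
  qed (simp add: hfield_def)
next
  note hh = local_coordD(1)[OF h]
  fix c assume c: "c \<in> A"
  have op: "openin X (W \<inter> fst c)" by (rule openin_chart_Int[OF holo_funD(1)[OF hh] c])
  have "holo_fun (W \<inter> fst c) (\<lambda>y. h y ^ i / cd c h y)"
    using local_coordD(2)[OF h, of _ c] c
    by (intro holo_fun_divide holo_fun_power holo_fun_cd[OF hh c] holo_fun_subset[OF hh op]) (auto simp: charts_at_iff)
  then show "holo_fun (W \<inter> fst c) (\<lambda>y. hfield h i y c)"
    by (rule holo_fun_cong) (use c in \<open>auto simp: hfield_def charts_at_iff\<close>)
qed

text \<open>Stated with u = 1/h', where h' u = 1 keeps all derivatives polynomial: (h u)' = 1 + h u'
  and (h^2 u)' = 2 h + h^2 u'.\<close>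

lemma hfield_jet:
  assumes h: "local_coord W h" and x: "x \<in> W" and c: "c \<in> charts_at x"
  defines "u \<equiv> \<lambda>y. 1 / cd c h y"
  shows "jet 2 (hfield h 0) x c 0 = u x" "jet 2 (hfield h 0) x c (Suc 0) = cd c u x"
    "jet 2 (hfield h 0) x c 2 = cd c (cd c u) x"
    "jet 2 (hfield h (Suc 0)) x c 0 = h x * u x"
    "jet 2 (hfield h (Suc 0)) x c (Suc 0) = 1 + h x * cd c u x"
    "jet 2 (hfield h (Suc 0)) x c 2 = cd c h x * cd c u x + h x * cd c (cd c u) x"
    "jet 2 (hfield h 2) x c 0 = h x * h x * u x"
    "jet 2 (hfield h 2) x c (Suc 0) = 2 * h x + h x * h x * cd c u x"
    "jet 2 (hfield h 2) x c 2 = 2 * cd c h x + 2 * h x * cd c h x * cd c u x + h x * h x * cd c (cd c u) x"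
proof -
  note hh = local_coordD(1)[OF h]
  have cA: "c \<in> A" "x \<in> fst c" using c by auto
  let ?N = "W \<inter> fst c"
  have op: "openin X ?N" by (rule openin_chart_Int[OF holo_funD(1)[OF hh] cA(1)])
  have xN: "x \<in> ?N" using x cA by simp
  have ch: "c \<in> charts_at y" if "y \<in> ?N" for y using that cA by (simp add: charts_at_iff)
  have p: "cd c h y \<noteq> 0" if "y \<in> ?N" for y using local_coordD(2)[OF h _ ch[OF that]] that by blast
  have hN: "holo_fun ?N h" by (rule holo_fun_subset[OF hh op]) blast
  have hu: "holo_fun ?N u"
    unfolding u_def by (intro holo_fun_divide holo_fun_const[OF op] holo_fun_cd[OF hh cA(1)] p)
  have hu1: "holo_fun ?N (cd c u)"
    using holo_fun_cd[OF hu cA(1)] by (simp add: Int_assoc)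
  have e0: "hfield h 0 y c = u y" "hfield h (Suc 0) y c = h y * u y" "hfield h 2 y c = h y * h y * u y"
    if "y \<in> ?N" for y
    using ch[OF that] by (simp_all add: hfield_def u_def power2_eq_square)
  have d0: "cd c (\<lambda>y. hfield h 0 y c) y = cd c u y" if y: "y \<in> ?N" for y
    by (rule cd_cong[OF op y ch[OF y]]) (simp add: e0)
  have d1: "cd c (\<lambda>y. hfield h (Suc 0) y c) y = 1 + h y * cd c u y" if y: "y \<in> ?N" for y
  proof -
    have "cd c (\<lambda>y. hfield h (Suc 0) y c) y = cd c (\<lambda>y. h y * u y) y"
      by (rule cd_cong[OF op y ch[OF y]]) (simp add: e0)
    then show ?thesis using cd_mult[OF hN hu y ch[OF y]] p[OF y] by (simp add: u_def)
  qed
  have d2: "cd c (\<lambda>y. hfield h 2 y c) y = 2 * h y + h y * h y * cd c u y" if y: "y \<in> ?N" for y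
  proof -
    have "cd c (\<lambda>y. hfield h 2 y c) y = cd c (\<lambda>y. h y * h y * u y) y"
      by (rule cd_cong[OF op y ch[OF y]]) (simp add: e0)
    also have "\<dots> = (cd c h y * h y + h y * cd c h y) * u y + h y * h y * cd c u y"
      using cd_mult[OF holo_fun_mult[OF hN hN] hu y ch[OF y]] cd_mult[OF hN hN y ch[OF y]] by simp
    finally show ?thesis using p[OF y] by (simp add: u_def)
  qed
  show "jet 2 (hfield h 0) x c 0 = u x" "jet 2 (hfield h (Suc 0)) x c 0 = h x * u x"
    "jet 2 (hfield h 2) x c 0 = h x * h x * u x"
    using e0[OF xN] by (simp_all add: jet_0[OF c])
  show "jet 2 (hfield h 0) x c (Suc 0) = cd c u x" "jet 2 (hfield h (Suc 0)) x c (Suc 0) = 1 + h x * cd c u x"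
    "jet 2 (hfield h 2) x c (Suc 0) = 2 * h x + h x * h x * cd c u x"
    using d0[OF xN] d1[OF xN] d2[OF xN] by (simp_all add: jet_1[OF c])
  have "cd c (cd c (\<lambda>y. hfield h 0 y c)) x = cd c (cd c u) x"
    by (rule cd_cong[OF op xN c d0])
  then show "jet 2 (hfield h 0) x c 2 = cd c (cd c u) x" by (simp add: jet_2[OF c])
  have "cd c (cd c (\<lambda>y. hfield h (Suc 0) y c)) x = cd c (\<lambda>y. 1 + h y * cd c u y) x"
    by (rule cd_cong[OF op xN c d1])
  also have "\<dots> = cd c h x * cd c u x + h x * cd c (cd c u) x"
    using cd_add[OF holo_fun_const[OF op] holo_fun_mult[OF hN hu1] xN c, of 1] cd_mult[OF hN hu1 xN c]
    by (simp add: cd_const)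
  finally show "jet 2 (hfield h (Suc 0)) x c 2 = cd c h x * cd c u x + h x * cd c (cd c u) x"
    by (simp add: jet_2[OF c])
  have "cd c (cd c (\<lambda>y. hfield h 2 y c)) x = cd c (\<lambda>y. 2 * h y + h y * h y * cd c u y) x"
    by (rule cd_cong[OF op xN c d2])
  also have "\<dots> = 2 * cd c h x + ((cd c h x * h x + h x * cd c h x) * cd c u x + h x * h x * cd c (cd c u) x)"
    using cd_add[OF holo_fun_mult[OF holo_fun_const[OF op] hN] holo_fun_mult[OF holo_fun_mult[OF hN hN] hu1] xN c, of 2]
      cd_mult[OF holo_fun_mult[OF hN hN] hu1 xN c] cd_mult[OF hN hN xN c] cd_cmult[OF hN xN c, of 2] by simp
  finally show "jet 2 (hfield h 2) x c 2 = 2 * cd c h x + 2 * h x * cd c h x * cd c u x + h x * h x * cd c (cd c u) x"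
    by (simp add: jet_2[OF c] algebra_simps)
qed

text \<open>Row operations remove the powers of h and leave a triangular matrix with diagonal u, 1,
  2 h', where u = 1/h'.\<close>

lemma hfield_det:
  assumes h: "local_coord W h" and x: "x \<in> W" and c: "c \<in> charts_at x"
  shows "det3 c (jet 2 (hfield h 0) x) (jet 2 (hfield h (Suc 0)) x) (jet 2 (hfield h 2) x) = 2"
proof -
  have p: "cd c h x \<noteq> 0" by (rule local_coordD(2)[OF h x c])
  show ?thesis
    unfolding det3_def hfield_jet[OF h x c] using p by (simp add: field_simps)
qed

text \<open>[h^i d/dh, h^j d/dh] = (j - i) h^(i+j-1) d/dh. The exponent is encoded by
  \<open>i + j = Suc k\<close>; in the cases i = j = 0 and i = j = 2, where it leaves the range, the
  coefficient j - i is 0.\<close>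

lemma hfield_bracket:
  assumes h: "local_coord W h" and x: "x \<in> W" and ij: "i < 3" "j < 3"
  shows "lie_bracket (hfield h i) (hfield h j) x =
    (\<lambda>c. \<Sum>k<3. (if i + j = Suc k then of_nat j - of_nat i else 0) * hfield h k x c)"
proof
  fix c
  show "lie_bracket (hfield h i) (hfield h j) x c =
    (\<Sum>k<3. (if i + j = Suc k then of_nat j - of_nat i else 0) * hfield h k x c)"
  proof (cases "c \<in> charts_at x")
    case c: True
    have i: "i = 0 \<or> i = Suc 0 \<or> i = 2" and j: "j = 0 \<or> j = Suc 0 \<or> j = 2" using ij by linarith+
    have hf: "hfield h 0 x c = 1 / cd c h x" "hfield h (Suc 0) x c = h x * (1 / cd c h x)"
      "hfield h 2 x c = h x * h x * (1 / cd c h x)"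
      using c by (simp_all add: hfield_def power2_eq_square)
    show ?thesis
      unfolding lie_bracket_jet[OF c] sum_lessThan_3 hf
      using i j by (elim disjE; hypsubst; unfold hfield_jet[OF h x c]; simp add: algebra_simps)
  next
    case False
    then show ?thesis by (simp add: lie_bracket_def hfield_def)
  qed
qed

lemma frame_hfield:
  assumes h: "local_coord W h"
  shows "frame W (\<lambda>i. jet 2 (hfield h i))"
  unfolding frame_def using hfield_det[OF h] by (auto intro!: holo_section_jet holo_vf_hfield[OF h])

lemma sl2_frame_hfield:
  assumes h: "local_coord W h" and fl: "\<And>i. i < 3 \<Longrightarrow> flat D W (jet 2 (hfield h i))"
  shows "sl2_frame D W (hfield h)"
  unfolding sl2_frame_def
proof (intro conjI)
  show "flat_frame D W (\<lambda>i. jet 2 (hfield h i))"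
    unfolding flat_frame_def using frame_hfield[OF h] fl by blast
  show "\<exists>B. \<forall>i<3. \<forall>j<3. \<forall>y\<in>W. lie_bracket (hfield h i) (hfield h j) y = (\<lambda>c. \<Sum>k<3. B i j k * hfield h k y c)"
    by (rule exI[of _ "\<lambda>i j k. if i + j = Suc k then of_nat j - of_nat i else 0"])
       (intro allI impI ballI, rule hfield_bracket[OF h])
qed (use holo_vf_hfield[OF h] hfield_det[OF h] in auto)

end

section \<open>The projective line\<close>

locale plane = vector_space sc for sc :: "complex \<Rightarrow> 'v::ab_group_add \<Rightarrow> 'v" +
  assumes dim2: "dim UNIV = 2"
begin

definition line :: "'v \<Rightarrow> 'v set" where
  "line v = range (\<lambda>t. sc t v)"

lemma functional_iff:
  "functional sc \<alpha> \<longleftrightarrow> (\<forall>x y. \<alpha> (x + y) = \<alpha> x + \<alpha> y) \<and> (\<forall>r x. \<alpha> (sc r x) = r * \<alpha> x)"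
proof -
  have "vector_space ((*) :: complex \<Rightarrow> complex \<Rightarrow> complex)"
    by unfold_locales (simp_all add: algebra_simps)
  then show ?thesis using vector_space_axioms by (simp add: Vector_Spaces.linear_iff)
qed

lemma linear_sc_iff:
  "Vector_Spaces.linear sc sc B \<longleftrightarrow> (\<forall>x y. B (x + y) = B x + B y) \<and> (\<forall>r x. B (sc r x) = sc r (B x))"
  using vector_space_axioms by (simp add: Vector_Spaces.linear_iff)

lemma functional_simps:
  assumes "functional sc \<alpha>"
  shows "\<alpha> (x + y) = \<alpha> x + \<alpha> y" "\<alpha> (sc r x) = r * \<alpha> x" "\<alpha> 0 = 0"
proof -
  show 1: "\<alpha> (x + y) = \<alpha> x + \<alpha> y" "\<alpha> (sc r x) = r * \<alpha> x" for x y r using assms by (simp_all add: functional_iff)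
  show "\<alpha> 0 = 0" using 1(1)[of 0 0] by simp
qed

lemma linear_simps:
  assumes "Vector_Spaces.linear sc sc B"
  shows "B (x + y) = B x + B y" "B (sc r x) = sc r (B x)"
  using assms by (simp_all add: linear_sc_iff)

text \<open>A basis with its dual basis. The quotient \<beta>/\<alpha> is the affine coordinate that
  is 0 at the line of u and infinite at that of w.\<close>

definition frame2 :: "'v \<Rightarrow> 'v \<Rightarrow> ('v \<Rightarrow> complex) \<Rightarrow> ('v \<Rightarrow> complex) \<Rightarrow> bool" where
  "frame2 u w \<alpha> \<beta> \<longleftrightarrow> functional sc \<alpha> \<and> functional sc \<beta> \<and> (\<forall>v. v = sc (\<alpha> v) u + sc (\<beta> v) w) \<and>
     \<alpha> u = 1 \<and> \<alpha> w = 0 \<and> \<beta> u = 0 \<and> \<beta> w = 1"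

lemma frame2D:
  assumes "frame2 u w \<alpha> \<beta>"
  shows "functional sc \<alpha>" "functional sc \<beta>" "v = sc (\<alpha> v) u + sc (\<beta> v) w" "\<alpha> u = 1" "\<alpha> w = 0" "\<beta> u = 0" "\<beta> w = 1"
  using assms unfolding frame2_def by blast+

lemma frame2_exists:
  assumes "u \<noteq> 0"
  shows "\<exists>w \<alpha> \<beta>. frame2 u w \<alpha> \<beta>"
proof -
  define Bs where "Bs = extend_basis {u}"
  have i: "independent {u}" using assms by (simp add: dependent_single)
  have B: "u \<in> Bs" "independent Bs" "span Bs = UNIV"
    using extend_basis_superset[OF i] independent_extend_basis[OF i] span_extend_basis[OF i] by (auto simp: Bs_def)
  have card: "card Bs = 2" using dim_eq_card[of Bs UNIV] B dim2 by simp
  then obtain a b where ab: "Bs = {a, b}" "a \<noteq> b" by (meson card_2_iff)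
  obtain w where w: "Bs = {u, w}" "u \<noteq> w"
    using ab B(1) by (cases "u = a") auto
  let ?\<alpha> = "\<lambda>v. representation Bs v u" and ?\<beta> = "\<lambda>v. representation Bs v w"
  have "frame2 u w ?\<alpha> ?\<beta>"
    unfolding frame2_def functional_iff
  proof (intro conjI allI)
    fix v
    have "(\<Sum>b\<in>Bs. sc (representation Bs v b) b) = v"
      by (rule sum_representation_eq) (use B w in auto)
    then show "v = sc (?\<alpha> v) u + sc (?\<beta> v) w" using w by simp
  qed (use B w in \<open>simp_all add: representation_add representation_scale representation_basis\<close>)
  then show ?thesis by blast
qed

lemma nonzero_exists: "\<exists>u::'v. u \<noteq> 0"
proof (rule ccontr)
  assume "\<not> (\<exists>u::'v. u \<noteq> 0)"
  then have "(UNIV :: 'v set) = span {}" by auto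
  then have "dim (UNIV :: 'v set) = card {}" using dim_eq_card[of "{}" UNIV] by (simp add: independent_empty)
  then show False using dim2 by simp
qed

lemma line_in_projective_line: "v \<noteq> 0 \<Longrightarrow> line v \<in> projective_line sc"
proof -
  assume v: "v \<noteq> 0"
  have s: "line v = span {v}" by (simp add: line_def span_singleton)
  have "dim (span {v}) = 1" using dim_eq_card_independent[of "{v}"] v by (simp add: dependent_single)
  then show ?thesis unfolding projective_line_def s by simp
qed

lemma projective_line_iff: "L \<in> projective_line sc \<longleftrightarrow> (\<exists>v. v \<noteq> 0 \<and> L = line v)"
proof
  assume "L \<in> projective_line sc"
  then have L: "subspace L" "dim L = 1" by (auto simp: projective_line_def)
  obtain B where B: "B \<subseteq> L" "independent B" "L \<subseteq> span B" "card B = dim L" by (rule basis_exists)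
  obtain v where v: "B = {v}" using B(4) L(2) by (metis card_1_singletonE)
  have "L = span B" using B(1,3) L(1) span_minimal by blast
  moreover have "v \<noteq> 0" using B(2) v by (simp add: dependent_single)
  ultimately show "\<exists>v. v \<noteq> 0 \<and> L = line v" by (auto simp: line_def span_singleton v)
qed (use line_in_projective_line in blast)

lemma line_nonvanishing: "functional sc \<gamma> \<Longrightarrow> (\<exists>z\<in>line v. \<gamma> z \<noteq> 0) \<longleftrightarrow> \<gamma> v \<noteq> 0"
  by (auto simp: line_def functional_simps intro: exI[of _ 1])

lemma affine_coord_line:
  assumes "functional sc \<gamma>" "functional sc \<delta>" "\<gamma> v \<noteq> 0"
  shows "affine_coord \<gamma> \<delta> (line v) = \<delta> v / \<gamma> v"
  unfolding affine_coord_def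
proof (rule the_equality)
  have "v \<in> line v" by (auto simp: line_def intro: image_eqI[of _ _ 1])
  then show "\<exists>w\<in>line v. \<gamma> w \<noteq> 0 \<and> \<delta> v / \<gamma> v = \<delta> w / \<gamma> w" using assms(3) by blast
  fix q assume "\<exists>w\<in>line v. \<gamma> w \<noteq> 0 \<and> q = \<delta> w / \<gamma> w"
  then show "q = \<delta> v / \<gamma> v" using assms by (auto simp: line_def functional_simps)
qed

lemma line_scale: "r \<noteq> 0 \<Longrightarrow> line (sc r v) = line v"
proof -
  assume r: "r \<noteq> 0"
  show ?thesis
  proof (intro equalityI subsetI)
    fix z assume "z \<in> line v"
    then obtain t where t: "z = sc t v" by (auto simp: line_def)
    have "z = sc (t / r) (sc r v)" using r t by simp
    then show "z \<in> line (sc r v)" unfolding line_def by (rule image_eqI) simp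
  qed (auto simp: line_def)
qed

lemma line_image: "Vector_Spaces.linear sc sc g \<Longrightarrow> g ` line v = line (g v)"
  by (auto simp: line_def image_image linear_simps)

lemma line_affine_coord:
  assumes fr: "frame2 u w \<alpha> \<beta>" and L: "L \<in> projective_line sc" and nz: "\<exists>z\<in>L. \<alpha> z \<noteq> 0"
  shows "L = line (u + sc (affine_coord \<alpha> \<beta> L) w)"
proof -
  obtain v where v: "L = line v" using L projective_line_iff by blast
  note fs = frame2D(1,2)[OF fr]
  have av: "\<alpha> v \<noteq> 0" using nz line_nonvanishing[OF fs(1)] v by simp
  have q: "affine_coord \<alpha> \<beta> L = \<beta> v / \<alpha> v" unfolding v by (rule affine_coord_line[OF fs av])
  have "sc (\<alpha> v) (u + sc (affine_coord \<alpha> \<beta> L) w) = sc (\<alpha> v) u + sc (\<beta> v) w"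
    using av by (simp add: q scale_right_distrib)
  also have "\<dots> = v" using frame2D(3)[OF fr, of v] by simp
  finally show ?thesis using line_scale[OF av, of "u + sc (affine_coord \<alpha> \<beta> L) w"] v by simp
qed

lemma line_vector_nonzero:
  assumes "frame2 u w \<alpha> \<beta>"
  shows "u + sc q w \<noteq> 0"
proof
  assume "u + sc q w = 0"
  then have "\<alpha> (u + sc q w) = \<alpha> 0" by simp
  then show False using frame2D[OF assms] by (simp add: functional_simps)
qed

lemma affine_coord_frame:
  assumes fr: "frame2 u w \<alpha> \<beta>"
  shows "affine_coord \<alpha> \<beta> (line (u + sc q w)) = q" "\<alpha> (u + sc q w) = 1"
proof -
  note f = frame2D[OF fr]
  show 1: "\<alpha> (u + sc q w) = 1" by (simp add: functional_simps[OF f(1)] f)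
  show "affine_coord \<alpha> \<beta> (line (u + sc q w)) = q"
    using affine_coord_line[OF f(1,2), of "u + sc q w"] 1 by (simp add: functional_simps[OF f(2)] f)
qed

text \<open>The moved line is spanned by z + t B z, so its coordinate is a quotient of two affine
  functions of t, with nonzero denominator near t = 0.\<close>

lemma deriv_affine_coord:
  assumes \<gamma>: "functional sc \<gamma>" and \<delta>: "functional sc \<delta>" and B: "Vector_Spaces.linear sc sc B" and z: "\<gamma> z \<noteq> 0"
  shows "deriv (\<lambda>t. affine_coord \<gamma> \<delta> ((\<lambda>w. w + sc t (B w)) ` line z)) 0
    = (\<delta> (B z) * \<gamma> z - \<delta> z * \<gamma> (B z)) / (\<gamma> z * \<gamma> z)"
proof -
  have lin: "Vector_Spaces.linear sc sc (\<lambda>w. w + sc t (B w))" for t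
    unfolding linear_sc_iff by (simp add: linear_simps[OF B] scale_right_distrib add_ac scale_left_commute)
  have im: "(\<lambda>w. w + sc t (B w)) ` line z = line (z + sc t (B z))" for t
    by (rule line_image[OF lin])
  have g: "\<gamma> (z + sc t (B z)) = \<gamma> z + t * \<gamma> (B z)" "\<delta> (z + sc t (B z)) = \<delta> z + t * \<delta> (B z)" for t
    by (simp_all add: functional_simps[OF \<gamma>] functional_simps[OF \<delta>])
  have "((\<lambda>t. \<gamma> z + t * \<gamma> (B z)) \<longlongrightarrow> \<gamma> z + 0 * \<gamma> (B z)) (nhds 0)"
    by (intro tendsto_intros filterlim_ident)
  then have ev: "eventually (\<lambda>t. \<gamma> z + t * \<gamma> (B z) \<noteq> 0) (nhds 0)"
    using z by (intro tendsto_imp_eventually_ne[of _ "\<gamma> z"]) auto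
  have ev': "eventually (\<lambda>t. affine_coord \<gamma> \<delta> ((\<lambda>w. w + sc t (B w)) ` line z)
      = (\<delta> z + t * \<delta> (B z)) / (\<gamma> z + t * \<gamma> (B z))) (nhds 0)"
    by (rule eventually_mono[OF ev]) (simp add: im affine_coord_line[OF \<gamma> \<delta>] g)
  have "((\<lambda>t. (\<delta> z + t * \<delta> (B z)) / (\<gamma> z + t * \<gamma> (B z))) has_field_derivative
      (\<delta> (B z) * \<gamma> z - \<delta> z * \<gamma> (B z)) / (\<gamma> z * \<gamma> z)) (at 0)"
    by (rule derivative_eq_intros refl | use z in simp)+
  from DERIV_imp_deriv[OF this] show ?thesis
    using deriv_cong_ev[OF ev' refl] by simp
qed

end

locale projective_surface = riemann_surface X A + plane sc
  for X :: "'a topology" and A :: "'a chart set" and sc :: "complex \<Rightarrow> 'v::ab_group_add \<Rightarrow> 'v"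
begin

section \<open>Affine coordinates of an embedding\<close>

definition affine_dom :: "'a set \<Rightarrow> ('a \<Rightarrow> 'v set) \<Rightarrow> ('v \<Rightarrow> complex) \<Rightarrow> 'a set" where
  "affine_dom U f \<alpha> = {x \<in> U. \<exists>z\<in>f x. \<alpha> z \<noteq> 0}"

lemma embeddingD:
  assumes "holo_embedding sc U f"
  shows "openin X U" "x \<in> U \<Longrightarrow> f x \<in> projective_line sc" "inj_on f U"
    "functional sc \<alpha> \<Longrightarrow> functional sc \<beta> \<Longrightarrow> holo_fun (affine_dom U f \<alpha>) (affine_coord \<alpha> \<beta> \<circ> f)"
  using assms unfolding holo_embedding_def affine_dom_def by blast+

lemma embedding_line:
  assumes "holo_embedding sc U f" "frame2 u w \<alpha> \<beta>" "x \<in> affine_dom U f \<alpha>"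
  shows "f x = line (u + sc ((affine_coord \<alpha> \<beta> \<circ> f) x) w)"
  using line_affine_coord[OF assms(2) embeddingD(2)[OF assms(1)]] assms(3) by (simp add: affine_dom_def)

lemma cd_moebius:
  assumes h: "holo_fun N h" and x: "x \<in> N" and c: "c \<in> charts_at x" and nz: "p + h x * q \<noteq> 0"
  shows "cd c (\<lambda>y. (a + h y * b) / (p + h y * q)) x = (b * p - a * q) * cd c h x / ((p + h x * q) * (p + h x * q))"
proof -
  have op: "openin X N" using h by (rule holo_funD)
  have lin: "holo_fun N (\<lambda>y. r + h y * s)" for r s
    by (intro holo_fun_add holo_fun_mult holo_fun_const[OF op] h)
  have d: "cd c (\<lambda>y. r + h y * s) x = cd c h x * s" for r s
    using cd_add[OF holo_fun_const[OF op] holo_fun_mult[OF h holo_fun_const[OF op]] x c]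
      cd_mult[OF h holo_fun_const[OF op] x c] by (simp add: cd_const)
  show ?thesis
    unfolding cd_divide[OF lin lin x c nz] d by (simp add: algebra_simps)
qed

lemma change_affine_coord:
  assumes fr: "frame2 u w \<alpha> \<beta>" and \<gamma>: "functional sc \<gamma>" and \<delta>: "functional sc \<delta>"
    and L: "L = line (u + sc q w)"
  shows "(\<exists>z\<in>L. \<gamma> z \<noteq> 0) \<longleftrightarrow> \<gamma> u + q * \<gamma> w \<noteq> 0"
    and "\<gamma> u + q * \<gamma> w \<noteq> 0 \<Longrightarrow> affine_coord \<gamma> \<delta> L = (\<delta> u + q * \<delta> w) / (\<gamma> u + q * \<gamma> w)"
  unfolding L using line_nonvanishing[OF \<gamma>] affine_coord_line[OF \<gamma> \<delta>, of "u + sc q w"]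
  by (simp_all add: functional_simps[OF \<gamma>] functional_simps[OF \<delta>])

text \<open>The coordinate \<delta>/\<gamma> is a Moebius function of h on the common domain; the
  constant in the numerator is its determinant.\<close>

lemma cd_change_affine_coord:
  assumes emb: "holo_embedding sc U f" and fr: "frame2 u w \<alpha> \<beta>" and x: "x \<in> affine_dom U f \<alpha>"
    and \<gamma>: "functional sc \<gamma>" and \<delta>: "functional sc \<delta>" and nz: "\<exists>z\<in>f x. \<gamma> z \<noteq> 0" and c: "c \<in> charts_at x"
  defines "h \<equiv> affine_coord \<alpha> \<beta> \<circ> f"
  shows "cd c (affine_coord \<gamma> \<delta> \<circ> f) x =
    (\<delta> w * \<gamma> u - \<delta> u * \<gamma> w) * cd c h x / ((\<gamma> u + h x * \<gamma> w) * (\<gamma> u + h x * \<gamma> w))"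
proof -
  note fs = frame2D(1,2)[OF fr]
  have h: "holo_fun (affine_dom U f \<alpha>) h" unfolding h_def by (rule embeddingD(4)[OF emb fs])
  let ?N = "affine_dom U f \<alpha> \<inter> affine_dom U f \<gamma>"
  have op: "openin X ?N"
    using holo_funD(1)[OF h] holo_funD(1)[OF embeddingD(4)[OF emb \<gamma> \<delta>]] by blast
  have xN: "x \<in> ?N" using x nz by (auto simp: affine_dom_def)
  have line: "f y = line (u + sc (h y) w)" if "y \<in> ?N" for y
    unfolding h_def by (rule embedding_line[OF emb fr]) (use that in blast)
  have nz': "\<gamma> u + h y * \<gamma> w \<noteq> 0" if "y \<in> ?N" for y
    using change_affine_coord(1)[OF fr \<gamma> \<delta> line[OF that]] that by (auto simp: affine_dom_def)
  have "cd c (affine_coord \<gamma> \<delta> \<circ> f) x = cd c (\<lambda>y. (\<delta> u + h y * \<delta> w) / (\<gamma> u + h y * \<gamma> w)) x"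
    by (rule cd_cong[OF op xN c]) (simp add: change_affine_coord(2)[OF fr \<gamma> \<delta> line] nz')
  also have "\<dots> = (\<delta> w * \<gamma> u - \<delta> u * \<gamma> w) * cd c h x / ((\<gamma> u + h x * \<gamma> w) * (\<gamma> u + h x * \<gamma> w))"
    by (rule cd_moebius[where N="affine_dom U f \<alpha>"]) (use h x c nz'[OF xN] in auto)
  finally show ?thesis .
qed

text \<open>The definition of an embedding provides a nonzero derivative in some affine coordinate;
  the Moebius relation between coordinates transfers it to \<beta>/\<alpha>.\<close>

lemma embedding_local_coord:
  assumes emb: "holo_embedding sc U f" and fr: "frame2 u w \<alpha> \<beta>"
  shows "local_coord (affine_dom U f \<alpha>) (affine_coord \<alpha> \<beta> \<circ> f)"
  unfolding local_coord_def
proof (intro conjI ballI)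
  note fs = frame2D(1,2)[OF fr]
  show h: "holo_fun (affine_dom U f \<alpha>) (affine_coord \<alpha> \<beta> \<circ> f)" by (rule embeddingD(4)[OF emb fs])
  fix x c assume x: "x \<in> affine_dom U f \<alpha>" and c: "c \<in> charts_at x"
  have "x \<in> U" using x by (simp add: affine_dom_def)
  then obtain \<gamma> \<delta> v where gd: "functional sc \<gamma>" "functional sc \<delta>" "\<exists>w\<in>f x. \<gamma> w \<noteq> 0"
    "v \<in> tangent x" "differential (affine_coord \<gamma> \<delta> \<circ> f) x v \<noteq> 0"
    using emb unfolding holo_embedding_def by blast
  have "x \<in> affine_dom U f \<gamma>" using gd(3) \<open>x \<in> U\<close> by (simp add: affine_dom_def)
  then have "differential (affine_coord \<gamma> \<delta> \<circ> f) x v = cd c (affine_coord \<gamma> \<delta> \<circ> f) x * v c"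
    by (rule differential_eq[OF embeddingD(4)[OF emb gd(1,2)] _ gd(4) c])
  then show "cd c (affine_coord \<alpha> \<beta> \<circ> f) x \<noteq> 0"
    using gd(5) cd_change_affine_coord[OF emb fr x gd(1,2,3) c] by auto
qed

lemma embedding_coord_inj:
  assumes emb: "holo_embedding sc U f" and fr: "frame2 u w \<alpha> \<beta>"
  shows "inj_on (affine_coord \<alpha> \<beta> \<circ> f) (affine_dom U f \<alpha>)"
proof (rule inj_onI)
  fix x y assume xy: "x \<in> affine_dom U f \<alpha>" "y \<in> affine_dom U f \<alpha>"
    "(affine_coord \<alpha> \<beta> \<circ> f) x = (affine_coord \<alpha> \<beta> \<circ> f) y"
  have "f x = f y"
    using embedding_line[OF emb fr xy(1)] embedding_line[OF emb fr xy(2)] xy(3) by simp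
  then show "x = y" using inj_onD[OF embeddingD(3)[OF emb]] xy by (simp add: affine_dom_def)
qed

text \<open>With u chosen in the line f x the coordinate vanishes at x; this normalization makes the
  jets at x triangular in \<open>adapted_moebius\<close>.\<close>

lemma centered_frame:
  assumes emb: "holo_embedding sc U f" and x: "x \<in> U"
  shows "\<exists>u w \<alpha> \<beta>. frame2 u w \<alpha> \<beta> \<and> x \<in> affine_dom U f \<alpha> \<and> (affine_coord \<alpha> \<beta> \<circ> f) x = 0"
proof -
  obtain u where u: "u \<noteq> 0" "f x = line u"
    using embeddingD(2)[OF emb x] projective_line_iff by blast
  obtain w \<alpha> \<beta> where fr: "frame2 u w \<alpha> \<beta>" using frame2_exists[OF u(1)] by blast
  have "x \<in> affine_dom U f \<alpha>"
    using x line_nonvanishing[OF frame2D(1)[OF fr], of u] frame2D(4)[OF fr] u by (simp add: affine_dom_def)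
  moreover have "(affine_coord \<alpha> \<beta> \<circ> f) x = 0"
    using affine_coord_frame(1)[OF fr, of 0] u by simp
  ultimately show ?thesis using fr by blast
qed

section \<open>Pullbacks of projective vector fields\<close>

text \<open>The pullback condition at a single point, separated from holomorphy so that the field
  can be constructed point by point.\<close>

definition pulls_back_at :: "('a \<Rightarrow> 'v set) \<Rightarrow> ('v \<Rightarrow> 'v) \<Rightarrow> 'a \<Rightarrow> 'a tvec \<Rightarrow> bool" where
  "pulls_back_at f B x v \<longleftrightarrow> (\<forall>\<gamma> \<delta>. functional sc \<gamma> \<longrightarrow> functional sc \<delta> \<longrightarrow> (\<exists>w\<in>f x. \<gamma> w \<noteq> 0) \<longrightarrow>
     differential (affine_coord \<gamma> \<delta> \<circ> f) x v = deriv (\<lambda>t. affine_coord \<gamma> \<delta> ((\<lambda>w. w + sc t (B w)) ` f x)) 0)"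

lemma pulls_back_iff: "pulls_back sc U f B s \<longleftrightarrow> holo_vf U s \<and> (\<forall>x\<in>U. pulls_back_at f B x (s x))"
  unfolding pulls_back_def pulls_back_at_def by blast

text \<open>The coordinate q of the line of z = u + q w moves with velocity \<beta> (B z) - q
  \<alpha> (B z). These are the coefficients of this quadratic polynomial in q, the right-hand side
  of a Riccati equation.\<close>

definition field_coeff :: "'v \<Rightarrow> 'v \<Rightarrow> ('v \<Rightarrow> complex) \<Rightarrow> ('v \<Rightarrow> complex) \<Rightarrow> ('v \<Rightarrow> 'v) \<Rightarrow> nat \<Rightarrow> complex" where
  "field_coeff u w \<alpha> \<beta> B i = (if i = 0 then \<beta> (B u) else if i = 1 then \<beta> (B w) - \<alpha> (B u) else - \<alpha> (B w))"

lemma hfield_comb_tangent: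
  assumes "local_coord W h" "x \<in> W"
  shows "(\<lambda>c. \<Sum>i<3. k i * hfield h i x c) \<in> tangent x"
proof -
  have W: "openin X W" using assms(1) by (rule local_coordD)
  show ?thesis
    by (rule holo_vfD(2)[OF holo_vf_comb[OF W holo_vf_hfield[OF assms(1)] holo_fun_const[OF W]] assms(2)])
qed

text \<open>In coordinates \<gamma>, \<delta> both sides of the pullback condition carry the same
  factor, that of the change of coordinate. So the condition for all \<gamma>, \<delta> comes down
  to the equation h' v = b - q a, which is the case of \<alpha>, \<beta>, where the factor is
  1.\<close>

lemma pulls_back_at_iff:
  assumes emb: "holo_embedding sc U f" and fr: "frame2 u w \<alpha> \<beta>" and x: "x \<in> affine_dom U f \<alpha>"
    and B: "Vector_Spaces.linear sc sc B" and v: "v \<in> tangent x"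
  shows "pulls_back_at f B x v \<longleftrightarrow>
    v = (\<lambda>c. \<Sum>i<3. field_coeff u w \<alpha> \<beta> B i * hfield (affine_coord \<alpha> \<beta> \<circ> f) i x c)"
proof -
  define h where "h = affine_coord \<alpha> \<beta> \<circ> f"
  note fd = frame2D[OF fr]
  have lc: "local_coord (affine_dom U f \<alpha>) h" unfolding h_def by (rule embedding_local_coord[OF emb fr])
  obtain c where c: "c \<in> charts_at x"
    using chart_exists[OF local_coordD(3)[OF lc]] x by blast
  have xU: "x \<in> U" using x by (simp add: affine_dom_def)
  define q where "q = h x"
  define z where "z = u + sc q w"
  have fx: "f x = line z" unfolding z_def q_def h_def by (rule embedding_line[OF emb fr x])
  define a b where "a = \<alpha> (B z)" and "b = \<beta> (B z)"
  have Bz: "B z = sc a u + sc b w" unfolding a_def b_def by (rule fd(3))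
  have p: "cd c h x \<noteq> 0" by (rule local_coordD(2)[OF lc x c])
  have L: "differential (affine_coord \<gamma> \<delta> \<circ> f) x v =
      (\<delta> w * \<gamma> u - \<delta> u * \<gamma> w) * (cd c h x * v c) / ((\<gamma> u + q * \<gamma> w) * (\<gamma> u + q * \<gamma> w))"
    and R: "deriv (\<lambda>t. affine_coord \<gamma> \<delta> ((\<lambda>w. w + sc t (B w)) ` f x)) 0 =
      (\<delta> w * \<gamma> u - \<delta> u * \<gamma> w) * (b - q * a) / ((\<gamma> u + q * \<gamma> w) * (\<gamma> u + q * \<gamma> w))"
    if \<gamma>: "functional sc \<gamma>" and \<delta>: "functional sc \<delta>" and nz: "\<exists>w\<in>f x. \<gamma> w \<noteq> 0" for \<gamma> \<delta>
  proof -
    have gz: "\<gamma> z = \<gamma> u + q * \<gamma> w" "\<delta> z = \<delta> u + q * \<delta> w"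
      by (simp_all add: z_def functional_simps[OF \<gamma>] functional_simps[OF \<delta>])
    have gB: "\<gamma> (B z) = a * \<gamma> u + b * \<gamma> w" "\<delta> (B z) = a * \<delta> u + b * \<delta> w"
      unfolding Bz by (simp_all add: functional_simps[OF \<gamma>] functional_simps[OF \<delta>])
    have gz0: "\<gamma> z \<noteq> 0" using nz line_nonvanishing[OF \<gamma>] fx by simp
    have "x \<in> affine_dom U f \<gamma>" using nz xU by (simp add: affine_dom_def)
    then show "differential (affine_coord \<gamma> \<delta> \<circ> f) x v =
      (\<delta> w * \<gamma> u - \<delta> u * \<gamma> w) * (cd c h x * v c) / ((\<gamma> u + q * \<gamma> w) * (\<gamma> u + q * \<gamma> w))"
      using differential_eq[OF embeddingD(4)[OF emb \<gamma> \<delta>] _ v c]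
        cd_change_affine_coord[OF emb fr x \<gamma> \<delta> nz c] by (simp add: h_def q_def)
    have "\<delta> (B z) * \<gamma> z - \<delta> z * \<gamma> (B z) = (\<delta> w * \<gamma> u - \<delta> u * \<gamma> w) * (b - q * a)"
      unfolding gz gB by (simp add: algebra_simps)
    then show "deriv (\<lambda>t. affine_coord \<gamma> \<delta> ((\<lambda>w. w + sc t (B w)) ` f x)) 0 =
      (\<delta> w * \<gamma> u - \<delta> u * \<gamma> w) * (b - q * a) / ((\<gamma> u + q * \<gamma> w) * (\<gamma> u + q * \<gamma> w))"
      unfolding fx deriv_affine_coord[OF \<gamma> \<delta> B gz0] by (simp add: gz)
  qed
  have "pulls_back_at f B x v \<longleftrightarrow> cd c h x * v c = b - q * a"
  proof
    assume pb: "pulls_back_at f B x v"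
    have nz: "\<exists>w\<in>f x. \<alpha> w \<noteq> 0" using x by (simp add: affine_dom_def)
    have "differential (affine_coord \<alpha> \<beta> \<circ> f) x v = deriv (\<lambda>t. affine_coord \<alpha> \<beta> ((\<lambda>w. w + sc t (B w)) ` f x)) 0"
      using pb fd(1,2) nz unfolding pulls_back_at_def by blast
    then show "cd c h x * v c = b - q * a"
      unfolding L[OF fd(1,2) nz] R[OF fd(1,2) nz] by (simp add: fd)
  next
    assume "cd c h x * v c = b - q * a"
    then show "pulls_back_at f B x v"
      unfolding pulls_back_at_def by (intro allI impI) (simp add: L R)
  qed
  also have "b - q * a = (\<Sum>i<3. field_coeff u w \<alpha> \<beta> B i * q ^ i)"
    by (simp add: a_def b_def z_def linear_simps[OF B] functional_simps[OF fd(1)] functional_simps[OF fd(2)]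
        sum_lessThan_3 field_coeff_def power2_eq_square algebra_simps)
  also have "cd c h x * v c = (\<Sum>i<3. field_coeff u w \<alpha> \<beta> B i * q ^ i) \<longleftrightarrow>
      v c = (\<Sum>i<3. field_coeff u w \<alpha> \<beta> B i * hfield h i x c)"
    using p c by (simp add: hfield_def q_def sum_lessThan_3 field_simps)
  also have "\<dots> \<longleftrightarrow> v = (\<lambda>c. \<Sum>i<3. field_coeff u w \<alpha> \<beta> B i * hfield h i x c)"
    using tangent_eqI[OF v hfield_comb_tangent[OF lc x] c] by auto
  finally show ?thesis by (simp add: h_def)
qed

text \<open>The vector at each point is singled out by a condition free of coordinates, so the local
  formulas agree on overlaps and give holomorphy.\<close>

lemma pulls_back_exists:
  assumes emb: "holo_embedding sc U f" and B: "Vector_Spaces.linear sc sc B"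
  shows "\<exists>s. pulls_back sc U f B s"
proof -
  define s where "s = (\<lambda>x. THE v. v \<in> tangent x \<and> pulls_back_at f B x v)"
  have s_eq: "s y = (\<lambda>c. \<Sum>i<3. field_coeff u w \<alpha> \<beta> B i * hfield (affine_coord \<alpha> \<beta> \<circ> f) i y c)"
    if fr: "frame2 u w \<alpha> \<beta>" and y: "y \<in> affine_dom U f \<alpha>" for u w \<alpha> \<beta> y
    unfolding s_def
  proof (rule the_equality)
    fix v assume v: "v \<in> tangent y \<and> pulls_back_at f B y v"
    show "v = (\<lambda>c. \<Sum>i<3. field_coeff u w \<alpha> \<beta> B i * hfield (affine_coord \<alpha> \<beta> \<circ> f) i y c)"
      using pulls_back_at_iff[OF emb fr y B conjunct1[OF v]] conjunct2[OF v] by (rule iffD1)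
  qed (use pulls_back_at_iff[OF emb fr y B] hfield_comb_tangent[OF embedding_local_coord[OF emb fr] y] in simp)
  have "holo_vf U s"
  proof (rule holo_vf_localI[OF embeddingD(1)[OF emb]])
    fix x assume "x \<in> U"
    then obtain u w \<alpha> \<beta> where fr: "frame2 u w \<alpha> \<beta>" and x: "x \<in> affine_dom U f \<alpha>"
      using centered_frame[OF emb] by blast
    note lc = embedding_local_coord[OF emb fr]
    have "holo_vf (affine_dom U f \<alpha>)
        (\<lambda>y c. \<Sum>i<3. field_coeff u w \<alpha> \<beta> B i * hfield (affine_coord \<alpha> \<beta> \<circ> f) i y c)"
      by (rule holo_vf_comb[OF local_coordD(3)[OF lc] holo_vf_hfield[OF lc] holo_fun_const[OF local_coordD(3)[OF lc]]])
    then show "\<exists>N t. x \<in> N \<and> holo_vf N t \<and> (\<forall>y\<in>N. s y = t y)"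
      using x s_eq[OF fr] by (intro exI conjI) (assumption, assumption, simp)
  qed
  moreover have "pulls_back_at f B x (s x)" if x: "x \<in> U" for x
  proof -
    obtain u w \<alpha> \<beta> where fr: "frame2 u w \<alpha> \<beta>" and x: "x \<in> affine_dom U f \<alpha>"
      using centered_frame[OF emb x] by blast
    show ?thesis
      unfolding s_eq[OF fr x]
      using pulls_back_at_iff[OF emb fr x B hfield_comb_tangent[OF embedding_local_coord[OF emb fr] x]] by simp
  qed
  ultimately show ?thesis unfolding pulls_back_iff by blast
qed

text \<open>Elementary endomorphisms, one for each of 1, q, q^2 in the velocity polynomial of
  \<open>field_coeff\<close>; the sign of the last one offsets the sign in - \<alpha> (B w).\<close>

definition unit_endo :: "'v \<Rightarrow> 'v \<Rightarrow> ('v \<Rightarrow> complex) \<Rightarrow> ('v \<Rightarrow> complex) \<Rightarrow> nat \<Rightarrow> 'v \<Rightarrow> 'v" where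
  "unit_endo u w \<alpha> \<beta> i z = (if i = 0 then sc (\<alpha> z) w else if i = 1 then sc (\<beta> z) w else sc (- \<beta> z) u)"

lemma unit_endo_linear:
  assumes "frame2 u w \<alpha> \<beta>"
  shows "Vector_Spaces.linear sc sc (unit_endo u w \<alpha> \<beta> i)"
  using frame2D(1,2)[OF assms]
  by (simp add: linear_sc_iff unit_endo_def functional_simps scale_left_distrib scale_left_diff_distrib)

lemma functional_minus:
  assumes "functional sc \<alpha>"
  shows "\<alpha> (- x) = - \<alpha> x"
  using functional_simps(1)[OF assms, of x "- x"] functional_simps(3)[OF assms] by (simp add: add_eq_0_iff)

lemma field_coeff_unit_endo:
  assumes "frame2 u w \<alpha> \<beta>" "i < 3" "j < 3"
  shows "field_coeff u w \<alpha> \<beta> (unit_endo u w \<alpha> \<beta> i) j = (if i = j then 1 else 0)"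
proof -
  note fd = frame2D[OF assms(1)]
  have "i = 0 \<or> i = 1 \<or> i = 2" "j = 0 \<or> j = 1 \<or> j = 2" using assms(2,3) by linarith+
  then show ?thesis
    by (elim disjE) (simp_all add: field_coeff_def unit_endo_def functional_simps[OF fd(1)] functional_simps[OF fd(2)]
        functional_minus[OF fd(1)] functional_minus[OF fd(2)] fd(4-7))
qed

lemma hfield_unit_endo:
  assumes fr: "frame2 u w \<alpha> \<beta>" and i: "i < 3"
  shows "(\<lambda>c. \<Sum>j<3. field_coeff u w \<alpha> \<beta> (unit_endo u w \<alpha> \<beta> i) j * hfield h j x c) = hfield h i x"
proof -
  have "i = 0 \<or> i = 1 \<or> i = 2" using i by linarith
  then show ?thesis
    using field_coeff_unit_endo[OF fr i, of 0] field_coeff_unit_endo[OF fr i, of 1] field_coeff_unit_endo[OF fr i, of 2]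
    by (elim disjE) (simp_all add: sum_lessThan_3)
qed

definition adapted :: "'a connection \<Rightarrow> 'a set \<Rightarrow> ('a \<Rightarrow> 'v set) \<Rightarrow> bool" where
  "adapted D U f \<longleftrightarrow> (\<forall>B s. Vector_Spaces.linear sc sc B \<longrightarrow> pulls_back sc U f B s \<longrightarrow> flat D U (jet 2 s))"

text \<open>The field pulled back from \<open>unit_endo\<close> exists on all of U and restricts to
  h^i d/dh on the affine domain.\<close>

lemma adapted_imp_flat:
  assumes D: "holomorphic_connection D" and emb: "holo_embedding sc U f" and ad: "adapted D U f"
    and fr: "frame2 u w \<alpha> \<beta>" and i: "i < 3"
  shows "flat D (affine_dom U f \<alpha>) (jet 2 (hfield (affine_coord \<alpha> \<beta> \<circ> f) i))"
proof -
  let ?W = "affine_dom U f \<alpha>" and ?h = "affine_coord \<alpha> \<beta> \<circ> f" and ?B = "unit_endo u w \<alpha> \<beta> i"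
  have B: "Vector_Spaces.linear sc sc ?B" by (rule unit_endo_linear[OF fr])
  have W: "openin X ?W" by (rule local_coordD(3)[OF embedding_local_coord[OF emb fr]])
  have WU: "?W \<subseteq> U" by (auto simp: affine_dom_def)
  obtain s where s: "pulls_back sc U f ?B s" using pulls_back_exists[OF emb B] by blast
  have s_eq: "s y = hfield ?h i y" if y: "y \<in> ?W" for y
  proof -
    have sy: "s y \<in> tangent y" and pb: "pulls_back_at f ?B y (s y)"
      using s holo_vfD(2) y WU unfolding pulls_back_iff by blast+
    show ?thesis
      using pulls_back_at_iff[OF emb fr y B sy] pb hfield_unit_endo[OF fr i] by simp
  qed
  have "flat D U (jet 2 s)" using ad s B unfolding adapted_def by blast
  then have "flat D ?W (jet 2 s)" by (rule flat_subset[OF _ W WU])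
  then show ?thesis
    by (rule flat_cong[OF D]) (rule jet_cong[OF W], use s_eq in auto)
qed

text \<open>Every pulled back field is a combination of the three h^i d/dh with the constants
  \<open>field_coeff\<close>; flatness is local, so it may be checked on small W.\<close>

lemma flat_imp_adapted:
  assumes D: "holomorphic_connection D" and emb: "holo_embedding sc U f"
    and loc: "\<And>x. x \<in> U \<Longrightarrow> \<exists>W u w \<alpha> \<beta>. frame2 u w \<alpha> \<beta> \<and> openin X W \<and> x \<in> W \<and> W \<subseteq> affine_dom U f \<alpha> \<and>
      (\<forall>i<3. flat D W (jet 2 (hfield (affine_coord \<alpha> \<beta> \<circ> f) i)))"
  shows "adapted D U f"
  unfolding adapted_def
proof (intro allI impI)
  fix B s assume B: "Vector_Spaces.linear sc sc B" and s: "pulls_back sc U f B s"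
  show "flat D U (jet 2 s)"
  proof (rule flat_localI[OF D embeddingD(1)[OF emb]])
    fix x assume "x \<in> U"
    then obtain W u w \<alpha> \<beta> where fr: "frame2 u w \<alpha> \<beta>" and W: "openin X W" "x \<in> W" "W \<subseteq> affine_dom U f \<alpha>"
      and fl: "\<forall>i<3. flat D W (jet 2 (hfield (affine_coord \<alpha> \<beta> \<circ> f) i))"
      using loc by blast
    define h where "h = affine_coord \<alpha> \<beta> \<circ> f"
    define k where "k = field_coeff u w \<alpha> \<beta> B"
    have lc: "local_coord W h"
      unfolding h_def by (rule local_coord_subset[OF embedding_local_coord[OF emb fr] W(1,3)])
    have s_eq: "s y = (\<lambda>c. \<Sum>i<3. k i * hfield h i y c)" if y: "y \<in> W" for y
    proof -
      have yW: "y \<in> affine_dom U f \<alpha>" using y W(3) by blast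
      then have "y \<in> U" by (simp add: affine_dom_def)
      then have sy: "s y \<in> tangent y" and pb: "pulls_back_at f B y (s y)"
        using s holo_vfD(2) unfolding pulls_back_iff by blast+
      show ?thesis
        using pulls_back_at_iff[OF emb fr yW B sy] pb by (simp add: h_def k_def)
    qed
    have "jet 2 s y = (\<lambda>c j. \<Sum>i<3. k i * jet 2 (hfield h i) y c j)" if y: "y \<in> W" for y
      using jet_cong[OF W(1) y s_eq] jet_comb[OF W(1) holo_vf_hfield[OF lc] y] by simp
    moreover have "flat D W (\<lambda>y c j. \<Sum>i<3. k i * jet 2 (hfield h i) y c j)"
      by (rule flat_comb[OF D W(1)]) (use fl in \<open>simp add: h_def\<close>)
    ultimately show "\<exists>N \<tau>. x \<in> N \<and> flat D N \<tau> \<and> (\<forall>y\<in>N. jet 2 s y = \<tau> y)"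
      using W(2) by (intro exI[of _ W] exI[of _ "\<lambda>y c j. \<Sum>i<3. k i * jet 2 (hfield h i) y c j"]) simp
  qed
qed

end

section \<open>Polynomials with many roots, components of open sets, projectivities\<close>

lemma quadratic_zero:
  fixes a b c :: complex
  assumes "infinite S" "\<And>q. q \<in> S \<Longrightarrow> a + b * q + c * (q * q) = 0"
  shows "a = 0" "b = 0" "c = 0"
proof -
  have "S \<subseteq> {q. poly [:a, b, c:] q = 0}"
    using assms(2) by (auto simp: algebra_simps)
  then have "infinite {q. poly [:a, b, c:] q = 0}" using assms(1) finite_subset by blast
  then have "[:a, b, c:] = 0" using poly_roots_finite by blast
  then show "a = 0" "b = 0" "c = 0" by simp_all
qed

context riemann_surface
begin

lemma open_infinite:
  assumes "openin X M" "x \<in> M"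
  shows "infinite M"
proof
  assume fin: "finite M"
  obtain c where c: "c \<in> charts_at x" using chart_exists[OF assms(1)] assms(2) by blast
  have "open (snd c ` (M \<inter> fst c))" "snd c x \<in> snd c ` (M \<inter> fst c)"
    using open_chart_image[OF _ assms(1)] c assms(2) by auto
  then obtain e where e: "e > 0" "ball (snd c x) e \<subseteq> snd c ` (M \<inter> fst c)"
    using open_contains_ball by blast
  then have "finite (ball (snd c x) e)" using fin finite_subset by blast
  then show False using uncountable_ball[OF e(1)] uncountable_infinite by blast
qed

text \<open>A surface is locally connected: the part of a chart over a small disc in the image of S
  is connected, hence stays in the component.\<close>

lemma open_component:
  assumes O: "openin X S" and C: "C \<in> connected_components_of (subtopology X S)"
  shows "openin X C"
proof (subst openin_subopen, intro ballI)
  fix x assume x: "x \<in> C"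
  have CS: "C \<subseteq> S" using connectedin_connected_components_of[OF C] by (simp add: connectedin_subtopology)
  obtain c where c: "c \<in> charts_at x" using chart_exists[OF O] x CS by blast
  have cA: "c \<in> A" "x \<in> fst c" using c by auto
  have "open (snd c ` (S \<inter> fst c))" "snd c x \<in> snd c ` (S \<inter> fst c)"
    using open_chart_image[OF cA(1) O] cA x CS by auto
  then obtain e where e: "e > 0" "ball (snd c x) e \<subseteq> snd c ` (S \<inter> fst c)"
    using open_contains_ball by blast
  let ?N = "{y \<in> fst c. snd c y \<in> ball (snd c x) e}"
  have op: "openin X ?N" by (rule open_chart_preimage[OF cA(1)]) simp
  have NS: "?N \<subseteq> S"
  proof
    fix y assume y: "y \<in> ?N"
    then obtain y' where y': "y' \<in> S" "y' \<in> fst c" "snd c y = snd c y'" using e(2) by blast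
    then have "y = y'" using y inj_onD[OF inj_on_chart[OF cA(1)]] by blast
    then show "y \<in> S" using y' by simp
  qed
  have im: "snd c ` ?N = ball (snd c x) e" using e(2) by auto
  have sub: "?N \<subseteq> topspace (subtopology X (fst c))" using openin_subset[OF op] by auto
  have "connectedin (top_of_set (snd c ` fst c)) (snd c ` ?N)"
    unfolding im using e(2) by (auto simp: connectedin_subtopology)
  then have "connectedin (subtopology X (fst c)) ?N"
    using homeomorphic_map_connectedness[OF homeomorphic_chart[OF cA(1)] sub] by blast
  then have "connectedin (subtopology X S) ?N" using NS by (simp add: connectedin_subtopology)
  moreover have xN: "x \<in> ?N" using cA e by simp
  ultimately have "?N \<subseteq> C"
    using connected_components_of_maximal[OF C] x by (meson disjnt_iff)
  then show "\<exists>T. openin X T \<and> x \<in> T \<and> T \<subseteq> C" using op xN by blast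
qed

lemma differential_cong:
  assumes "openin X N" "x \<in> N" "\<And>y. y \<in> N \<Longrightarrow> F y = G y"
  shows "differential F x v = differential G x v"
proof -
  define c where "c = (SOME c. c \<in> charts_at x)"
  have "\<exists>c. c \<in> charts_at x" using chart_exists[OF assms(1)] assms(2) by blast
  then have c: "c \<in> charts_at x" unfolding c_def by (rule someI_ex)
  have "cd c F x = cd c G x" by (rule cd_cong[OF assms(1,2) c assms(3)])
  then show ?thesis by (simp add: differential_def Let_def cd_def c_def)
qed

end

context plane
begin

definition projectivity :: "('v \<Rightarrow> 'v) \<Rightarrow> bool" where
  "projectivity G \<longleftrightarrow> Vector_Spaces.linear sc sc G \<and> bij G"

lemma projectivityD:
  assumes "projectivity G"
  shows "Vector_Spaces.linear sc sc G" "inv G (G z) = z" "G (inv G z) = z" "G z = 0 \<longleftrightarrow> z = 0"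
proof -
  show lin: "Vector_Spaces.linear sc sc G" using assms by (simp add: projectivity_def)
  have b: "bij G" using assms by (simp add: projectivity_def)
  show inv: "inv G (G z) = z" for z using b by (simp add: bij_is_inj)
  show "G (inv G z) = z" using b by (simp add: bij_is_surj surj_f_inv_f)
  have "G 0 = 0" using linear_simps(1)[OF lin, of 0 0] by simp
  then show "G z = 0 \<longleftrightarrow> z = 0" using inv by metis
qed

lemma projectivity_inv:
  assumes "projectivity G"
  shows "projectivity (inv G)"
proof -
  note G = projectivityD[OF assms]
  have "inv G (x + y) = inv G x + inv G y" for x y
    using G(2)[of "inv G x + inv G y"] by (simp add: linear_simps[OF G(1)] G(3))
  moreover have "inv G (sc r x) = sc r (inv G x)" for r x
    using G(2)[of "sc r (inv G x)"] by (simp add: linear_simps[OF G(1)] G(3))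
  ultimately show ?thesis using assms bij_imp_bij_inv by (auto simp: projectivity_def linear_sc_iff)
qed

lemma linear_comp: "Vector_Spaces.linear sc sc F \<Longrightarrow> Vector_Spaces.linear sc sc G \<Longrightarrow> Vector_Spaces.linear sc sc (\<lambda>z. F (G z))"
  by (simp add: linear_sc_iff)

lemma functional_comp: "functional sc \<gamma> \<Longrightarrow> Vector_Spaces.linear sc sc G \<Longrightarrow> functional sc (\<lambda>z. \<gamma> (G z))"
  by (simp add: functional_iff linear_sc_iff)

lemma affine_coord_image: "affine_coord \<gamma> \<delta> (G ` L) = affine_coord (\<lambda>z. \<gamma> (G z)) (\<lambda>z. \<delta> (G z)) L"
  by (simp add: affine_coord_def)

lemma PGL_iff: "T \<in> PGL sc \<longleftrightarrow> (\<exists>G. projectivity G \<and> T = image G)"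
  by (auto simp: PGL_def projectivity_def)

lemma self_in_line: "v \<in> line v"
  unfolding line_def by (rule image_eqI[of _ _ 1]) simp_all

end

context projective_surface
begin

section \<open>Projectively related embeddings\<close>

text \<open>Let K be G followed by the inverse of H. That K preserves the line of u + q w is a
  quadratic equation in q. It holds for infinitely many q, as the coordinate is injective on an
  infinite set, so K is a scalar.\<close>

lemma projectivity_rigid:
  assumes emb: "holo_embedding sc U f" and M: "openin X M" "x \<in> M" "M \<subseteq> U"
    and G: "projectivity G" and H: "projectivity H" and eq: "\<And>z. z \<in> M \<Longrightarrow> G ` f z = H ` f z"
    and L: "L \<in> projective_line sc"
  shows "G ` L = H ` L"
proof -
  obtain u w \<alpha> \<beta> where fr: "frame2 u w \<alpha> \<beta>" and x: "x \<in> affine_dom U f \<alpha>"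
    using centered_frame[OF emb] M by blast
  note fd = frame2D[OF fr]
  define h where "h = affine_coord \<alpha> \<beta> \<circ> f"
  let ?M = "M \<inter> affine_dom U f \<alpha>"
  have "openin X ?M" using M(1) local_coordD(3)[OF embedding_local_coord[OF emb fr]] by blast
  then have "infinite ?M" by (rule open_infinite[of _ x]) (use M x in simp)
  moreover have "inj_on h ?M" unfolding h_def using embedding_coord_inj[OF emb fr] inj_on_subset by blast
  ultimately have inf: "infinite (h ` ?M)" by (simp add: finite_image_iff)
  note Gl = projectivityD(1)[OF G] and Hl = projectivityD(1)[OF H]
  note Hi = projectivityD(1)[OF projectivity_inv[OF H]]
  define K where "K = (\<lambda>z. inv H (G z))"
  have K: "Vector_Spaces.linear sc sc K" unfolding K_def by (rule linear_comp[OF Hi Gl])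
  have z: "\<beta> (K u) + (\<beta> (K w) - \<alpha> (K u)) * q + (- \<alpha> (K w)) * (q * q) = 0" if q: "q \<in> h ` ?M" for q
  proof -
    obtain y where y: "y \<in> M" "y \<in> affine_dom U f \<alpha>" "q = h y" using q by blast
    let ?z = "u + sc q w"
    have fy: "f y = line ?z" unfolding y(3) h_def by (rule embedding_line[OF emb fr y(2)])
    have "G ?z \<in> line (H ?z)"
      using eq[OF y(1)] self_in_line[of "G ?z"] unfolding fy by (simp add: line_image[OF Gl] line_image[OF Hl])
    then obtain r where "G ?z = sc r (H ?z)" by (auto simp: line_def)
    then have Kz: "K ?z = sc r ?z"
      by (simp add: K_def linear_simps(2)[OF Hi] projectivityD(2)[OF H])
    have "\<alpha> (K ?z) = r" "\<beta> (K ?z) = r * q"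
      unfolding Kz by (simp_all add: functional_simps[OF fd(1)] functional_simps[OF fd(2)] fd(4-7))
    then have "\<beta> (K ?z) = \<alpha> (K ?z) * q" by simp
    then show ?thesis
      by (simp add: linear_simps[OF K] functional_simps[OF fd(1)] functional_simps[OF fd(2)] algebra_simps)
  qed
  note k = quadratic_zero[OF inf z]
  define r where "r = \<alpha> (K u)"
  have Ku: "K u = sc r u" and Kw: "K w = sc r w"
    using fd(3)[of "K u"] fd(3)[of "K w"] k by (simp_all add: r_def)
  have Kv: "K v = sc r v" for v
  proof -
    have "K (sc (\<alpha> v) u + sc (\<beta> v) w) = sc r (sc (\<alpha> v) u + sc (\<beta> v) w)"
      by (simp add: linear_simps[OF K] Ku Kw scale_right_distrib mult.commute)
    then show ?thesis using fd(3)[of v] by simp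
  qed
  have Gv: "G v = sc r (H v)" for v
  proof -
    have "H (K v) = G v" by (simp add: K_def projectivityD(3)[OF H])
    then show ?thesis by (simp add: Kv linear_simps(2)[OF Hl])
  qed
  obtain v where v: "v \<noteq> 0" "L = line v" using L projective_line_iff by blast
  have "r \<noteq> 0" using Gv[of v] projectivityD(4)[OF G, of v] v(1) by auto
  then show ?thesis
    unfolding v(2) line_image[OF Gl] line_image[OF Hl] Gv by (rule line_scale)
qed

text \<open>The compatibility of charts read at a point, free of components and inverse
  maps.\<close>

definition moebius_near :: "'a set \<Rightarrow> ('a \<Rightarrow> 'v set) \<Rightarrow> 'a set \<Rightarrow> ('a \<Rightarrow> 'v set) \<Rightarrow> 'a \<Rightarrow> bool" where
  "moebius_near U f U' g x \<longleftrightarrow>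
     (\<exists>N G. openin X N \<and> x \<in> N \<and> N \<subseteq> U \<inter> U' \<and> projectivity G \<and> (\<forall>y\<in>N. g y = G ` f y))"

text \<open>Components are open, which gives one direction. For the other, the points near which a
  fixed projectivity describes the transition form an open set, and by rigidity so do the remaining
  points of the component.\<close>

lemma transition_iff:
  assumes f: "holo_embedding sc U f" and g: "holo_embedding sc U' g"
  shows "(\<forall>C\<in>connected_components_of (subtopology X (U \<inter> U')).
      \<exists>T\<in>PGL sc. \<forall>L\<in>f ` C. (g \<circ> inv_into U f) L = T L) \<longleftrightarrow> (\<forall>x\<in>U \<inter> U'. moebius_near U f U' g x)"
    (is "?lhs \<longleftrightarrow> ?rhs")
proof -
  have op: "openin X (U \<inter> U')" using embeddingD(1)[OF f] embeddingD(1)[OF g] by blast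
  have top: "topspace (subtopology X (U \<inter> U')) = U \<inter> U'" using openin_subset[OF op] by auto
  have CS: "C \<subseteq> U \<inter> U'" if "C \<in> connected_components_of (subtopology X (U \<inter> U'))" for C
    using connectedin_connected_components_of[OF that] by (simp add: connectedin_subtopology)
  have inv: "inv_into U f (f y) = y" if "y \<in> U" for y
    using embeddingD(3)[OF f] that by (rule inv_into_f_f)
  show ?thesis
  proof
    assume lhs: ?lhs
    show ?rhs
    proof
      fix x assume x: "x \<in> U \<inter> U'"
      then obtain C where C: "C \<in> connected_components_of (subtopology X (U \<inter> U'))" "x \<in> C"
        using Union_connected_components_of[of "subtopology X (U \<inter> U')"] top by blast
      obtain T where T: "T \<in> PGL sc" "\<forall>L\<in>f ` C. (g \<circ> inv_into U f) L = T L" using lhs C(1) by blast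
      obtain G where G: "projectivity G" "T = image G" using T(1) PGL_iff by blast
      have "g y = G ` f y" if "y \<in> C" for y
      proof -
        have "y \<in> U" using that CS[OF C(1)] by blast
        moreover have "(g \<circ> inv_into U f) (f y) = G ` f y" using T(2) that G(2) by simp
        ultimately show ?thesis using inv[of y] by simp
      qed
      then show "moebius_near U f U' g x"
        unfolding moebius_near_def
        using open_component[OF op C(1)] C(2) CS[OF C(1)] G(1) by (intro exI[of _ C] exI[of _ G]) simp
    qed
  next
    assume rhs: ?rhs
    show ?lhs
    proof
      fix C assume C: "C \<in> connected_components_of (subtopology X (U \<inter> U'))"
      have opC: "openin X C" by (rule open_component[OF op C])
      have conC: "connectedin X C"
        using connectedin_connected_components_of[OF C] by (simp add: connectedin_subtopology)
      obtain x0 where x0: "x0 \<in> C" using nonempty_connected_components_of[OF C] by blast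
      have rel: "\<exists>N G. openin X N \<and> x \<in> N \<and> N \<subseteq> C \<and> projectivity G \<and> (\<forall>y\<in>N. g y = G ` f y)" if "x \<in> C" for x
      proof -
        have "moebius_near U f U' g x" using rhs CS[OF C] that by blast
        then obtain N G where N: "openin X N" "x \<in> N" "projectivity G" "\<forall>y\<in>N. g y = G ` f y"
          unfolding moebius_near_def by (elim exE conjE)
        then show ?thesis using opC that by (intro exI[of _ "N \<inter> C"] exI[of _ G]) auto
      qed
      obtain N0 G0 where N0: "openin X N0" "x0 \<in> N0" "N0 \<subseteq> C" "projectivity G0" "\<forall>y\<in>N0. g y = G0 ` f y"
        using rel[OF x0] by (elim exE conjE)
      define S where "S = {x \<in> C. \<exists>N. openin X N \<and> x \<in> N \<and> N \<subseteq> C \<and> (\<forall>y\<in>N. g y = G0 ` f y)}"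
      have opS: "openin X S"
      proof (subst openin_subopen, intro ballI)
        fix x assume "x \<in> S"
        then obtain N where N: "openin X N" "x \<in> N" "N \<subseteq> C" "\<forall>y\<in>N. g y = G0 ` f y"
          unfolding S_def mem_Collect_eq by (elim exE conjE)
        then have "N \<subseteq> S" unfolding S_def by blast
        then show "\<exists>T. openin X T \<and> x \<in> T \<and> T \<subseteq> S" using N by blast
      qed
      have opCS: "openin X (C - S)"
      proof (subst openin_subopen, intro ballI)
        fix x assume x: "x \<in> C - S"
        then have xC: "x \<in> C" by blast
        obtain N G where N: "openin X N" "x \<in> N" "N \<subseteq> C" "projectivity G" "\<forall>y\<in>N. g y = G ` f y"
          using rel[OF xC] by (elim exE conjE)
        have "N \<inter> S = {}"
        proof (rule ccontr)
          assume "N \<inter> S \<noteq> {}"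
          then obtain y where y: "y \<in> N" "y \<in> S" by blast
          from y(2) obtain M where M': "openin X M" "y \<in> M" "M \<subseteq> C" "\<forall>z\<in>M. g z = G0 ` f z"
            unfolding S_def mem_Collect_eq by (elim exE conjE)
          note M = y(1) M'
          have opNM: "openin X (N \<inter> M)" using N(1) M(2) by blast
          \<comment> \<open>G and G0 agree on the values of f over an open set, hence on all lines,
            so G0 serves on the whole of N.\<close>
          have "G ` L = G0 ` L" if "L \<in> projective_line sc" for L
            by (rule projectivity_rigid[OF f opNM _ _ N(4) N0(4) _ that, of y])
               (use M N CS[OF C] in auto)
          then have "g z = G0 ` f z" if "z \<in> N" for z
            using N(3,5) that CS[OF C] embeddingD(2)[OF f, of z] by (metis IntD1 subsetD)
          then have "x \<in> S" unfolding S_def using N by blast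
          then show False using x by blast
        qed
        then show "\<exists>T. openin X T \<and> x \<in> T \<and> T \<subseteq> C - S" using N by blast
      qed
      have "x0 \<in> S" unfolding S_def using x0 N0 by blast
      have "C - S = {}"
      proof (rule ccontr)
        assume "C - S \<noteq> {}"
        then show False
          using connectedinD[OF conC opS opCS] \<open>x0 \<in> S\<close> x0 by blast
      qed
      then have "g y = G0 ` f y" if "y \<in> C" for y
        using that unfolding S_def by blast
      then have "(g \<circ> inv_into U f) L = G0 ` L" if "L \<in> f ` C" for L
        using that CS[OF C] inv by auto
      then show "\<exists>T\<in>PGL sc. \<forall>L\<in>f ` C. (g \<circ> inv_into U f) L = T L"
        using N0(4) PGL_iff by blast
    qed
  qed
qed

text \<open>Changing the chart by G conjugates the endomorphism by G; the functionals are composed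
  with the inverse of G to compare coordinates.\<close>

lemma pulls_back_at_projectivity:
  assumes G: "projectivity G" and N: "openin X N" "y \<in> N" and eq: "\<And>z. z \<in> N \<Longrightarrow> g z = G ` f z"
    and pb: "pulls_back_at g B y v"
  shows "pulls_back_at f (\<lambda>z. inv G (B (G z))) y v"
  unfolding pulls_back_at_def
proof (intro allI impI)
  fix \<gamma> \<delta> assume \<gamma>: "functional sc \<gamma>" and \<delta>: "functional sc \<delta>" and nz: "\<exists>w\<in>f y. \<gamma> w \<noteq> 0"
  note Gd = projectivityD[OF G] and Gi = projectivityD(1)[OF projectivity_inv[OF G]]
  let ?\<gamma> = "\<lambda>z. \<gamma> (inv G z)" and ?\<delta> = "\<lambda>z. \<delta> (inv G z)"
  have aff: "affine_coord ?\<gamma> ?\<delta> (G ` L) = affine_coord \<gamma> \<delta> L" for L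
    unfolding affine_coord_image by (simp add: Gd(2))
  have "\<exists>w\<in>g y. ?\<gamma> w \<noteq> 0" using nz unfolding eq[OF N(2)] by (simp add: Gd(2))
  then have "differential (affine_coord ?\<gamma> ?\<delta> \<circ> g) y v =
      deriv (\<lambda>t. affine_coord ?\<gamma> ?\<delta> ((\<lambda>w. w + sc t (B w)) ` g y)) 0"
    using pb functional_comp[OF \<gamma> Gi] functional_comp[OF \<delta> Gi] unfolding pulls_back_at_def by blast
  moreover have "differential (affine_coord ?\<gamma> ?\<delta> \<circ> g) y v = differential (affine_coord \<gamma> \<delta> \<circ> f) y v"
    by (rule differential_cong[OF N]) (simp add: eq aff)
  moreover have "(\<lambda>w. w + sc t (B w)) ` g y = G ` ((\<lambda>w. w + sc t (inv G (B (G w)))) ` f y)" for t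
    unfolding eq[OF N(2)] image_image by (simp add: linear_simps[OF Gd(1)] Gd(3))
  ultimately show "differential (affine_coord \<gamma> \<delta> \<circ> f) y v =
      deriv (\<lambda>t. affine_coord \<gamma> \<delta> ((\<lambda>w. w + sc t (inv G (B (G w)))) ` f y)) 0"
    by (simp only: aff)
qed

text \<open>With h and k the coordinates of f and g: conjugating the endomorphism that generates k^i
  d/dk by the projectivity gives an endomorphism of V again, and its field is a constant combination
  of the h^j d/dh. These constants are what \<open>glued_connection\<close> asks for.\<close>

lemma hfield_compatible:
  assumes f: "holo_embedding sc U f" and g: "holo_embedding sc U' g"
    and fr: "frame2 u w \<alpha> \<beta>" and fr': "frame2 u' w' \<alpha>' \<beta>'"
    and x: "x \<in> affine_dom U f \<alpha>" "x \<in> affine_dom U' g \<alpha>'" and rel: "moebius_near U f U' g x"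
  shows "\<exists>N a. openin X N \<and> x \<in> N \<and> N \<subseteq> affine_dom U f \<alpha> \<inter> affine_dom U' g \<alpha>' \<and>
    (\<forall>y\<in>N. \<forall>i<3. jet 2 (hfield (affine_coord \<alpha>' \<beta>' \<circ> g) i) y =
      (\<lambda>d k. \<Sum>j<3. a i j * jet 2 (hfield (affine_coord \<alpha> \<beta> \<circ> f) j) y d k))"
proof -
  obtain M G where M: "openin X M" "x \<in> M" "projectivity G" "\<forall>y\<in>M. g y = G ` f y"
    using rel unfolding moebius_near_def by (elim exE conjE)
  define h k where "h = affine_coord \<alpha> \<beta> \<circ> f" and "k = affine_coord \<alpha>' \<beta>' \<circ> g"
  have lf: "local_coord (affine_dom U f \<alpha>) h" and lg: "local_coord (affine_dom U' g \<alpha>') k"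
    unfolding h_def k_def by (rule embedding_local_coord[OF f fr], rule embedding_local_coord[OF g fr'])
  let ?N = "M \<inter> affine_dom U f \<alpha> \<inter> affine_dom U' g \<alpha>'"
  have op: "openin X ?N" using M(1) local_coordD(3)[OF lf] local_coordD(3)[OF lg] by blast
  have lN: "local_coord ?N h" by (rule local_coord_subset[OF lf op]) blast
  define B where "B = (\<lambda>i z. inv G (unit_endo u' w' \<alpha>' \<beta>' i (G z)))"
  define a where "a = (\<lambda>i. field_coeff u w \<alpha> \<beta> (B i))"
  note Gl = projectivityD(1)[OF M(3)] and Gi = projectivityD(1)[OF projectivity_inv[OF M(3)]]
  have B: "Vector_Spaces.linear sc sc (B i)" for i
    unfolding B_def by (rule linear_comp[OF Gi linear_comp[OF unit_endo_linear[OF fr'] Gl]])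
  have eq: "hfield k i y = (\<lambda>c. \<Sum>j<3. a i j * hfield h j y c)" if y: "y \<in> ?N" and i: "i < 3" for y i
  proof -
    have v: "hfield k i y \<in> tangent y" by (rule holo_vfD(2)[OF holo_vf_hfield[OF lg]]) (use y in blast)
    have "pulls_back_at g (unit_endo u' w' \<alpha>' \<beta>' i) y (hfield k i y)"
      using pulls_back_at_iff[OF g fr' _ unit_endo_linear[OF fr'] v] hfield_unit_endo[OF fr' i] y
      by (simp add: k_def)
    then have "pulls_back_at f (B i) y (hfield k i y)"
      unfolding B_def by (rule pulls_back_at_projectivity[OF M(3) M(1), rotated 2]) (use M(4) y in auto)
    then show ?thesis
      using pulls_back_at_iff[OF f fr _ B v] y by (simp add: a_def h_def)
  qed
  have "jet 2 (hfield k i) y = (\<lambda>d m. \<Sum>j<3. a i j * jet 2 (hfield h j) y d m)" if "y \<in> ?N" "i < 3" for y i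
    using jet_cong[OF op that(1) eq[OF _ that(2)]] jet_comb[OF op holo_vf_hfield[OF lN] that(1)] by simp
  then show ?thesis
    using op M(2) x unfolding h_def k_def by (intro exI[of _ ?N] exI[of _ a]) auto
qed

text \<open>In affine coordinates this map is q -> b q / (1 + a q).\<close>

lemma projectivity_of_frames:
  assumes fr: "frame2 u w \<alpha> \<beta>" and fr': "frame2 u' w' \<alpha>' \<beta>'" and b: "b \<noteq> 0"
  shows "projectivity (\<lambda>z. sc (\<alpha> z + a * \<beta> z) u' + sc (b * \<beta> z) w')"
proof -
  note fd = frame2D[OF fr] and fd' = frame2D[OF fr']
  define G where "G = (\<lambda>z. sc (\<alpha> z + a * \<beta> z) u' + sc (b * \<beta> z) w')"
  define H where "H = (\<lambda>z. sc (\<alpha>' z - a / b * \<beta>' z) u + sc (\<beta>' z / b) w)"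
  have lin: "Vector_Spaces.linear sc sc G"
    unfolding G_def linear_sc_iff
    by (simp add: functional_simps[OF fd(1)] functional_simps[OF fd(2)] scale_left_distrib scale_right_distrib
        distrib_left mult_ac add_ac)
  have HG: "H (G z) = z" for z
  proof -
    have "\<alpha>' (G z) = \<alpha> z + a * \<beta> z" "\<beta>' (G z) = b * \<beta> z"
      by (simp_all add: G_def functional_simps[OF fd'(1)] functional_simps[OF fd'(2)] fd'(4-7))
    then show ?thesis using b fd(3)[of z] by (simp add: H_def)
  qed
  have GH: "G (H z) = z" for z
  proof -
    have "\<alpha> (H z) = \<alpha>' z - a / b * \<beta>' z" "\<beta> (H z) = \<beta>' z / b"
      by (simp_all add: H_def functional_simps[OF fd(1)] functional_simps[OF fd(2)] fd(4-7))
    then show ?thesis using b fd'(3)[of z] by (simp add: G_def)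
  qed
  have "bij G" by (rule o_bij[of H]) (auto simp: HG GH)
  then show ?thesis using lin by (simp add: projectivity_def G_def)
qed

lemma adapted_moebius:
  assumes D: "holomorphic_connection D" and f: "holo_embedding sc U f" and g: "holo_embedding sc U' g"
    and af: "adapted D U f" and ag: "adapted D U' g" and x: "x \<in> U \<inter> U'"
  shows "moebius_near U f U' g x"
proof -
  obtain u w \<alpha> \<beta> where fr: "frame2 u w \<alpha> \<beta>" and xf: "x \<in> affine_dom U f \<alpha>" and h0: "(affine_coord \<alpha> \<beta> \<circ> f) x = 0"
    using centered_frame[OF f] x by blast
  obtain u' w' \<alpha>' \<beta>' where fr': "frame2 u' w' \<alpha>' \<beta>'" and xg: "x \<in> affine_dom U' g \<alpha>'"
    and k0: "(affine_coord \<alpha>' \<beta>' \<circ> g) x = 0"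
    using centered_frame[OF g] x by blast
  define h k where "h = affine_coord \<alpha> \<beta> \<circ> f" and "k = affine_coord \<alpha>' \<beta>' \<circ> g"
  let ?W = "affine_dom U f \<alpha>" and ?W' = "affine_dom U' g \<alpha>'"
  have lf: "local_coord ?W h" and lg: "local_coord ?W' k"
    unfolding h_def k_def by (rule embedding_local_coord[OF f fr], rule embedding_local_coord[OF g fr'])
  have hx: "h x = 0" and kx: "k x = 0" using h0 k0 by (simp_all add: h_def k_def)
  have flf: "flat D ?W (jet 2 (hfield h i))" and flg: "flat D ?W' (jet 2 (hfield k i))" if "i < 3" for i
    unfolding h_def k_def using adapted_imp_flat[OF D f af fr that] adapted_imp_flat[OF D g ag fr' that] by auto
  have ff: "flat_frame D ?W (\<lambda>i. jet 2 (hfield h i))"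
    unfolding flat_frame_def using frame_hfield[OF lf] flf by blast
  obtain c where c: "c \<in> charts_at x"
    using chart_exists[OF local_coordD(3)[OF lf]] xf by blast
  have p: "cd c h x \<noteq> 0" and p': "cd c k x \<noteq> 0" by (rule local_coordD(2)[OF lf xf c], rule local_coordD(2)[OF lg xg c])
  note jh = hfield_jet[OF lf xf c, unfolded hx, simplified] and jk = hfield_jet[OF lg xg c, unfolded kx, simplified]
  have flk: "flat D ?W' (jet 2 (hfield k 1))" "flat D ?W' (jet 2 (hfield k 2))" by (rule flg, simp)+
  obtain N1 a where N1: "openin X N1" "x \<in> N1" "N1 \<subseteq> ?W \<inter> ?W'"
    "\<forall>y\<in>N1. jet 2 (hfield k 1) y = (\<lambda>d m. \<Sum>i<3. a i * jet 2 (hfield h i) y d m)"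
    using flat_const_comb[OF D ff flk(1) xf xg] by (elim exE conjE)
  obtain N2 b where N2: "openin X N2" "x \<in> N2" "N2 \<subseteq> ?W \<inter> ?W'"
    "\<forall>y\<in>N2. jet 2 (hfield k 2) y = (\<lambda>d m. \<Sum>i<3. b i * jet 2 (hfield h i) y d m)"
    using flat_const_comb[OF D ff flk(2) xf xg] by (elim exE conjE)
  have e1: "jet 2 (hfield k (Suc 0)) x c m = a 0 * jet 2 (hfield h 0) x c m + a (Suc 0) * jet 2 (hfield h (Suc 0)) x c m
      + a 2 * jet 2 (hfield h 2) x c m" for m
    using N1(2,4) by (simp add: sum_lessThan_3)
  have e2: "jet 2 (hfield k 2) x c m = b 0 * jet 2 (hfield h 0) x c m + b (Suc 0) * jet 2 (hfield h (Suc 0)) x c m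
      + b 2 * jet 2 (hfield h 2) x c m" for m
    using N2(2,4) by (simp add: sum_lessThan_3)
  \<comment> \<open>The jets at x are compared order by order. There k d/dk has value 0 and first
    derivative 1 in any coordinate, while k^2 d/dk has only a second derivative, namely 2
    k'.\<close>
  have a0: "a 0 = 0" using e1[of 0] p by (simp add: jh jk)
  have a1: "a (Suc 0) = 1" using e1[of "Suc 0"] a0 by (simp add: jh jk)
  have b0: "b 0 = 0" using e2[of 0] p by (simp add: jh jk)
  have b1: "b (Suc 0) = 0" using e2[of "Suc 0"] b0 by (simp add: jh jk)
  have b2: "b 2 \<noteq> 0" using e2[of 2] b0 b1 p' by (auto simp: jh jk)
  let ?N = "N1 \<inter> N2"
  have op: "openin X ?N" using N1(1) N2(1) by blast
  have NU: "?N \<subseteq> U \<inter> U'" using N1(3) by (auto simp: affine_dom_def)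
  \<comment> \<open>A factor h is cancelled below, so its zeros are treated apart; by injectivity
    the only one is x.\<close>
  have rel: "k y * (1 + a 2 * h y) = b 2 * h y" if y: "y \<in> ?N" for y
  proof (cases "h y = 0")
    case True
    then have "y = x"
      using inj_onD[OF embedding_coord_inj[OF f fr], of y x] y N1(3) xf hx by (auto simp: h_def)
    then show ?thesis using hx kx by simp
  next
    case False
    have yW: "y \<in> ?W" "y \<in> ?W'" using y N1(3) by auto
    obtain d where d: "d \<in> charts_at y"
      using chart_exists[OF op] y by blast
    have q: "cd d h y \<noteq> 0" "cd d k y \<noteq> 0" by (rule local_coordD(2)[OF lf yW(1) d], rule local_coordD(2)[OF lg yW(2) d])
    have "jet 2 (hfield k 1) y d 0 = (\<Sum>i<3. a i * jet 2 (hfield h i) y d 0)"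
      "jet 2 (hfield k 2) y d 0 = (\<Sum>i<3. b i * jet 2 (hfield h i) y d 0)"
      using N1(4) N2(4) y by auto
    then have 1: "k y / cd d k y = (h y + a 2 * (h y * h y)) / cd d h y"
      and 2: "k y * k y / cd d k y = b 2 * (h y * h y) / cd d h y"
      using d by (simp_all add: jet_0[OF d] sum_lessThan_3 hfield_def a0 a1 b0 b1 power2_eq_square add_divide_distrib)
    have "k y * ((h y + a 2 * (h y * h y)) / cd d h y) = b 2 * (h y * h y) / cd d h y"
      using 2 unfolding 1[symmetric] by simp
    then have "h y * (k y * (1 + a 2 * h y)) = h y * (b 2 * h y)"
      using q by (simp add: field_simps)
    then show ?thesis using False by simp
  qed
  define G where "G = (\<lambda>z. sc (\<alpha> z + a 2 * \<beta> z) u' + sc (b 2 * \<beta> z) w')"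
  have G: "projectivity G" unfolding G_def by (rule projectivity_of_frames[OF fr fr' b2])
  have "g y = G ` f y" if y: "y \<in> ?N" for y
  proof -
    have yW: "y \<in> ?W" "y \<in> ?W'" using y N1(3) by auto
    note fd = frame2D[OF fr]
    \<comment> \<open>Otherwise \<open>rel\<close> would give \<open>b 2 * h y = 0\<close> with
      \<open>b 2\<close> nonzero, hence h = 0 at y and 1 = 0.\<close>
    have nz: "1 + a 2 * h y \<noteq> 0"
    proof
      assume z: "1 + a 2 * h y = 0"
      then have "h y = 0" using rel[OF y] b2 by simp
      then show False using z by simp
    qed
    have Gz: "G (u + sc (h y) w) = sc (1 + a 2 * h y) (u' + sc (k y) w')"
      using rel[OF y] by (simp add: G_def functional_simps[OF fd(1)] functional_simps[OF fd(2)] fd(4-7)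
          scale_right_distrib mult.commute)
    have fy: "f y = line (u + sc (h y) w)" unfolding h_def by (rule embedding_line[OF f fr yW(1)])
    have "G ` f y = line (G (u + sc (h y) w))"
      unfolding fy by (rule line_image[OF projectivityD(1)[OF G]])
    also have "\<dots> = line (u' + sc (k y) w')" unfolding Gz by (rule line_scale[OF nz])
    also have "\<dots> = g y" unfolding k_def using embedding_line[OF g fr' yW(2)] by simp
    finally show ?thesis by simp
  qed
  then show ?thesis
    unfolding moebius_near_def using op N1(2) N2(2) NU G by (intro exI[of _ ?N] exI[of _ G]) simp
qed

end

context riemann_surface
begin

section \<open>Local normal form of the connection\<close>

lemma flat_scale:
  assumes D: "holomorphic_connection D" and \<sigma>: "flat D W \<sigma>"
  shows "flat D W (\<lambda>y c k. a * \<sigma> y c k)"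
proof -
  have "flat D W (\<lambda>y c k. \<Sum>i<3. (if i = (0::nat) then a else 0) * \<sigma> y c k)"
    by (rule flat_comb[OF D flatD(3)[OF \<sigma>] \<sigma>])
  then show ?thesis by (simp add: sum_lessThan_3)
qed

text \<open>The products of first derivatives cancel in (s t' - t s')' = s t'' - t s''. The second
  derivative contains third derivatives of s and t, written as derivatives of the entry of order
  2.\<close>

lemma bracket_jet:
  assumes s: "holo_vf W s" and t: "holo_vf W t" and x: "x \<in> W" and c: "c \<in> charts_at x"
  shows "jet 2 (lie_bracket s t) x c 0 = jet 2 s x c 0 * jet 2 t x c (Suc 0) - jet 2 t x c 0 * jet 2 s x c (Suc 0)"
    "jet 2 (lie_bracket s t) x c (Suc 0) = jet 2 s x c 0 * jet 2 t x c 2 - jet 2 t x c 0 * jet 2 s x c 2"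
    "jet 2 (lie_bracket s t) x c 2 = jet 2 s x c (Suc 0) * jet 2 t x c 2 + jet 2 s x c 0 * cd c (\<lambda>y. jet 2 t y c 2) x
       - jet 2 t x c (Suc 0) * jet 2 s x c 2 - jet 2 t x c 0 * cd c (\<lambda>y. jet 2 s y c 2) x"
proof -
  have cA: "c \<in> A" "x \<in> fst c" using c by auto
  let ?N = "W \<inter> fst c"
  have op: "openin X ?N" by (rule openin_chart_Int[OF holo_vfD(1)[OF s] cA(1)])
  have ch: "c \<in> charts_at y" if "y \<in> ?N" for y using that cA by (simp add: charts_at_iff)
  have xN: "x \<in> ?N" using x cA by simp
  have h: "holo_fun ?N (\<lambda>y. jet 2 s y c i)" "holo_fun ?N (\<lambda>y. jet 2 t y c i)" if "i \<le> 2" for i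
    using holo_sectionD(3)[OF holo_section_jet[OF s] cA(1) that] holo_sectionD(3)[OF holo_section_jet[OF t] cA(1) that] by auto
  have 0: "lie_bracket s t y c = jet 2 s y c 0 * jet 2 t y c (Suc 0) - jet 2 t y c 0 * jet 2 s y c (Suc 0)"
    if "y \<in> ?N" for y by (rule lie_bracket_jet[OF ch[OF that]])
  have 1: "cd c (\<lambda>y. lie_bracket s t y c) y = jet 2 s y c 0 * jet 2 t y c 2 - jet 2 t y c 0 * jet 2 s y c 2"
    if y: "y \<in> ?N" for y
  proof -
    have "cd c (\<lambda>y. lie_bracket s t y c) y
        = cd c (\<lambda>y. jet 2 s y c 0 * jet 2 t y c (Suc 0) - jet 2 t y c 0 * jet 2 s y c (Suc 0)) y"
      by (rule cd_cong[OF op y ch[OF y] 0])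
    also have "\<dots> = jet 2 s y c 0 * jet 2 t y c 2 - jet 2 t y c 0 * jet 2 s y c 2"
      by (simp add: cd_diff[OF _ _ y ch[OF y]] cd_mult[OF _ _ y ch[OF y]] holo_fun_mult h cd_jet[OF ch[OF y]])
    finally show ?thesis .
  qed
  have "cd c (cd c (\<lambda>y. lie_bracket s t y c)) x = cd c (\<lambda>y. jet 2 s y c 0 * jet 2 t y c 2 - jet 2 t y c 0 * jet 2 s y c 2) x"
    by (rule cd_cong[OF op xN c 1])
  also have "\<dots> = jet 2 s x c (Suc 0) * jet 2 t x c 2 + jet 2 s x c 0 * cd c (\<lambda>y. jet 2 t y c 2) x
       - jet 2 t x c (Suc 0) * jet 2 s x c 2 - jet 2 t x c 0 * cd c (\<lambda>y. jet 2 s y c 2) x"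
    by (simp add: cd_diff[OF _ _ xN c] cd_mult[OF _ _ xN c] holo_fun_mult h cd_jet[OF c])
  finally show "jet 2 (lie_bracket s t) x c 2 = jet 2 s x c (Suc 0) * jet 2 t x c 2 + jet 2 s x c 0 * cd c (\<lambda>y. jet 2 t y c 2) x
       - jet 2 t x c (Suc 0) * jet 2 s x c 2 - jet 2 t x c 0 * cd c (\<lambda>y. jet 2 s y c 2) x"
    by (simp add: jet_2[OF c])
  show "jet 2 (lie_bracket s t) x c 0 = jet 2 s x c 0 * jet 2 t x c (Suc 0) - jet 2 t x c 0 * jet 2 s x c (Suc 0)"
    using 0[OF xN] by (simp add: jet_0[OF c])
  show "jet 2 (lie_bracket s t) x c (Suc 0) = jet 2 s x c 0 * jet 2 t x c 2 - jet 2 t x c 0 * jet 2 s x c 2"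
    using 1[OF xN] by (simp add: jet_1[OF c])
qed

context
  fixes D :: "'a connection"
  assumes D: "holomorphic_connection D"
    and F_id: "\<And>x j. x \<in> topspace X \<Longrightarrow> j \<in> J 2 x \<Longrightarrow> F_endo D x j = j"
begin

text \<open>
  If no flat section passes through \<open>j\<close>, the description defining \<open>F_endo D x j\<close> is empty and its
  value is a constant that does not depend on \<open>j\<close>.  So the identity \<open>F_endo D x j = j\<close> yields flat
  sections through all \<open>j\<close> but one, hence through all multiples of these.
\<close>

lemma flat_through:
  assumes j: "j \<in> J 2 x" and nz: "j \<noteq> (\<lambda>_ _. 0)"
  shows "\<exists>W \<sigma>. x \<in> W \<and> flat D W \<sigma> \<and> \<sigma> x = j"
proof -
  have xX: "x \<in> topspace X" using j by (rule J_topspace)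
  define e :: "'a jet" where "e = (THE k. False)"
  have 1: "\<exists>W \<sigma>. x \<in> W \<and> flat D W \<sigma> \<and> \<sigma> x = k" if k: "k \<in> J 2 x" "k \<noteq> e" for k
  proof (rule ccontr)
    assume "\<not> (\<exists>W \<sigma>. x \<in> W \<and> flat D W \<sigma> \<and> \<sigma> x = k)"
    then have "(\<lambda>l. \<exists>W \<sigma>. x \<in> W \<and> flat D W \<sigma> \<and> \<sigma> x = k \<and> l = jet 2 (\<lambda>y. p0 (\<sigma> y)) x) = (\<lambda>_. False)"
      by (intro ext) blast
    then have "F_endo D x k = e" unfolding F_endo_def e_def by (rule arg_cong)
    then show False using F_id[OF xX k(1)] k(2) by simp
  qed
  show ?thesis
  proof (cases "j = e")
    case False
    then show ?thesis using 1[OF j] by blast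
  next
    case True
    let ?k = "\<lambda>c i. 2 * j c i"
    have "?k \<noteq> j"
    proof
      assume eq: "?k = j"
      have "j c i = 0" for c i using fun_cong[OF fun_cong[OF eq, of c], of i] by simp
      then show False using nz by blast
    qed
    then have "\<exists>W \<sigma>. x \<in> W \<and> flat D W \<sigma> \<and> \<sigma> x = ?k" using 1[OF J_scale[OF j]] True by simp
    then obtain W \<sigma> where \<sigma>: "x \<in> W" "flat D W \<sigma>" "\<sigma> x = ?k" by (elim exE conjE)
    show ?thesis
      by (rule exI[of _ W], rule exI[of _ "\<lambda>y c k. (1/2) * \<sigma> y c k"])
         (use \<sigma> flat_scale[OF D \<sigma>(2), of "1/2"] in simp)
  qed
qed

text \<open>Flat sections through three independent jets stay independent where their determinant
  does not vanish; the determinant in one chart decides, by \<open>det3_transition\<close>.\<close>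

lemma flat_frame_through:
  assumes c: "c \<in> charts_at x" and j: "\<And>i. i < 3 \<Longrightarrow> j i \<in> J 2 x" "\<And>i. i < 3 \<Longrightarrow> j i \<noteq> (\<lambda>_ _. 0)"
    and det: "det3 c (j 0) (j 1) (j 2) \<noteq> 0"
  shows "\<exists>W S. x \<in> W \<and> flat_frame D W S \<and> (\<forall>i<3. S i x = j i)"
proof -
  have cA: "c \<in> A" "x \<in> fst c" using c by auto
  obtain W0 S0 where 0: "x \<in> W0" "flat D W0 S0" "S0 x = j 0"
    using flat_through[OF j(1)[of 0] j(2)[of 0]] by auto
  obtain W1 S1 where 1: "x \<in> W1" "flat D W1 S1" "S1 x = j 1"
    using flat_through[OF j(1)[of 1] j(2)[of 1]] by auto
  obtain W2 S2 where 2: "x \<in> W2" "flat D W2 S2" "S2 x = j 2"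
    using flat_through[OF j(1)[of 2] j(2)[of 2]] by auto
  let ?V = "W0 \<inter> W1 \<inter> W2"
  have opV: "openin X ?V" using flatD(3)[OF 0(2)] flatD(3)[OF 1(2)] flatD(3)[OF 2(2)] by blast
  have fl: "flat D ?V S0" "flat D ?V S1" "flat D ?V S2"
    by (rule flat_subset[OF 0(2) opV], blast, rule flat_subset[OF 1(2) opV], blast, rule flat_subset[OF 2(2) opV], blast)
  let ?F = "\<lambda>y. det3 c (S0 y) (S1 y) (S2 y)"
  define W where "W = {y \<in> ?V \<inter> fst c. ?F y \<noteq> 0}"
  have opW: "openin X W"
    unfolding W_def by (rule holo_fun_open_nonzero[OF holo_fun_det3[OF cA(1) flatD(1)[OF fl(1)] flatD(1)[OF fl(2)] flatD(1)[OF fl(3)]]])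
  define S where "S = (\<lambda>i::nat. if i = 0 then S0 else if i = 1 then S1 else S2)"
  have "W \<subseteq> ?V" by (auto simp: W_def)
  then have flS: "flat D W (S i)" for i
    using flat_subset[OF fl(1) opW] flat_subset[OF fl(2) opW] flat_subset[OF fl(3) opW] by (simp add: S_def)
  have "frame W S"
    unfolding frame_def
  proof (intro conjI allI impI ballI)
    show "holo_section W (S i)" for i by (rule flatD(1)[OF flS])
    fix y d assume y: "y \<in> W" and d: "d \<in> charts_at y"
    have cy: "c \<in> charts_at y" using y cA by (simp add: W_def charts_at_iff)
    have "S i y \<in> J 2 y" for i by (rule holo_sectionD(2)[OF flatD(1)[OF flS] y])
    then have "det3 d (S 0 y) (S 1 y) (S 2 y) = det3 c (S 0 y) (S 1 y) (S 2 y)"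
      by (intro det3_transition[OF _ _ _ cy d])
    then show "det3 d (S 0 y) (S 1 y) (S 2 y) \<noteq> 0" using y by (simp add: S_def W_def)
  qed
  then have "flat_frame D W S" using flS by (simp add: flat_frame_def)
  moreover have "x \<in> W" using det 0 1 2 cA by (simp add: W_def)
  moreover have "\<forall>i<3. S i x = j i" unfolding all_lessThan_3 using 0 1 2 by (simp add: S_def)
  ultimately show ?thesis by blast
qed

lemma flat_frame_exists:
  assumes x: "x \<in> topspace X"
  shows "\<exists>W S. x \<in> W \<and> flat_frame D W S"
proof -
  obtain c where c: "c \<in> charts_at x" using charts_at_nonempty[OF x] by blast
  define j where "j = (\<lambda>i::nat. jet_of c (if i = 0 then 1 else 0) (if i = 1 then 1 else 0) (if i = 2 then 1 else 0) x)"
  have "j i \<noteq> (\<lambda>_ _. 0)" if i: "i < 3" for i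
  proof
    assume z: "j i = (\<lambda>_ _. 0)"
    have "i = 0 \<or> i = 1 \<or> i = 2" using i by linarith
    then have "j i c i = 1" by (elim disjE) (simp_all add: j_def jet_of_self[OF c])
    then show False by (simp add: z)
  qed
  moreover have "j i \<in> J 2 x" for i unfolding j_def by (rule jet_of_in_J[OF c])
  moreover have "det3 c (j 0) (j 1) (j 2) \<noteq> 0" by (simp add: det3_def j_def jet_of_self[OF c])
  ultimately have "\<exists>W S. x \<in> W \<and> flat_frame D W S \<and> (\<forall>i<3. S i x = j i)"
    by (intro flat_frame_through[OF c])
  then show ?thesis by (elim exE conjE) (intro exI conjI)
qed

lemma flat_eq_near:
  assumes "flat D W1 \<sigma>" "flat D W2 \<tau>" "x \<in> W1" "x \<in> W2" "\<sigma> x = \<tau> x"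
  shows "\<exists>N. openin X N \<and> x \<in> N \<and> N \<subseteq> W1 \<inter> W2 \<and> (\<forall>y\<in>N. \<sigma> y = \<tau> y)"
proof -
  have "x \<in> topspace X" using openin_subset[OF flatD(3)[OF assms(1)]] assms(3) by blast
  then obtain W S where W: "x \<in> W" "flat_frame D W S" using flat_frame_exists by blast
  obtain N where "openin X N" "x \<in> N" "N \<subseteq> W \<inter> W1 \<inter> W2" "\<forall>y\<in>N. \<sigma> y = \<tau> y"
    using flat_eq[OF D W(2) assms(1,2) W(1) assms(3-5)] by (elim exE conjE)
  then show ?thesis by (intro exI[of _ N]) auto
qed

text \<open>Flat sections with the same value at x agree nearby, so the description in
  \<open>F_endo\<close> is single-valued and \<open>F_id\<close> speaks about the given
  section.\<close>

lemma flat_is_jet: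
  assumes \<sigma>: "flat D W \<sigma>" and x: "x \<in> W"
  shows "jet 2 (\<lambda>y. p0 (\<sigma> y)) x = \<sigma> x"
proof -
  have "F_endo D x (\<sigma> x) = jet 2 (\<lambda>y. p0 (\<sigma> y)) x"
    unfolding F_endo_def
  proof (rule the_equality)
    show "\<exists>W' \<sigma>'. x \<in> W' \<and> flat D W' \<sigma>' \<and> \<sigma>' x = \<sigma> x \<and> jet 2 (\<lambda>y. p0 (\<sigma> y)) x = jet 2 (\<lambda>y. p0 (\<sigma>' y)) x"
      by (rule exI[of _ W], rule exI[of _ \<sigma>]) (simp add: x \<sigma>)
    fix k assume "\<exists>W' \<sigma>'. x \<in> W' \<and> flat D W' \<sigma>' \<and> \<sigma>' x = \<sigma> x \<and> k = jet 2 (\<lambda>y. p0 (\<sigma>' y)) x"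
    then obtain W' \<sigma>' where \<sigma>': "x \<in> W'" "flat D W' \<sigma>'" "\<sigma>' x = \<sigma> x" "k = jet 2 (\<lambda>y. p0 (\<sigma>' y)) x"
      by (elim exE conjE)
    obtain N where N: "openin X N" "x \<in> N" "\<forall>y\<in>N. \<sigma>' y = \<sigma> y"
      using flat_eq_near[OF \<sigma>'(2) \<sigma> \<sigma>'(1) x \<sigma>'(3)] by (elim exE conjE)
    show "k = jet 2 (\<lambda>y. p0 (\<sigma> y)) x"
      unfolding \<sigma>'(4) by (rule jet_cong[OF N(1,2)]) (use N(3) in simp)
  qed
  moreover have "x \<in> topspace X" using openin_subset[OF flatD(3)[OF \<sigma>]] x by blast
  ultimately show ?thesis using F_id[OF _ holo_sectionD(2)[OF flatD(1)[OF \<sigma>] x]] by simp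
qed

text \<open>
  The jets of \<open>s 0\<close>, \<open>s 1\<close>, \<open>s 2\<close> at the base point are those of \<open>1 + \<mu> z\<^sup>2 / 2\<close>, \<open>z\<close>, \<open>z\<^sup>2\<close>; the
  choice of \<open>\<mu>\<close> makes \<open>[s 0, s 1] = s 0\<close>, and constancy of the Wronskian gives \<open>[s 0, s 2] = 2 s 1\<close>.
  Then \<open>h = s 1 / s 0\<close> satisfies \<open>h' = [s 0, s 1] / (s 0)\<^sup>2 = 1 / s 0\<close> and
  \<open>(s 2 / s 0)' = [s 0, s 2] / (s 0)\<^sup>2 = (h\<^sup>2)'\<close>, so that \<open>s i = h\<^sup>i / h'\<close>.
\<close>

lemma normal_frame:
  assumes x: "x \<in> topspace X" and c: "c \<in> charts_at x"
    and triv: "induces_trivial_det D" and br: "flat_fields_bracket_closed D"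
  shows "\<exists>W (s :: nat \<Rightarrow> 'a \<Rightarrow> 'a tvec). openin X W \<and> x \<in> W \<and> (\<forall>i<3. holo_vf W (s i) \<and> flat D W (jet 2 (s i))) \<and>
    s 0 x c = 1 \<and> s 1 x c = 0 \<and> s 2 x c = 0 \<and>
    (\<forall>y\<in>W. \<forall>d\<in>charts_at y. lie_bracket (s 0) (s 1) y d = s 0 y d \<and> lie_bracket (s 0) (s 2) y d = 2 * s 1 y d)"
proof -
  have cA: "c \<in> A" "x \<in> fst c" using c by auto
  have nz: "jet_of c a0 a1 a2 x \<noteq> (\<lambda>_ _. 0)" if "a0 \<noteq> 0 \<or> a1 \<noteq> 0 \<or> a2 \<noteq> 0" for a0 a1 a2
  proof
    assume z: "jet_of c a0 a1 a2 x = (\<lambda>_ _. 0)"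
    show False using jet_of_self[OF c, of a0 a1 a2] that unfolding z by simp
  qed
  obtain V \<sigma>1 where \<sigma>1: "x \<in> V" "flat D V \<sigma>1" "\<sigma>1 x = jet_of c 0 1 0 x"
    using flat_through[OF jet_of_in_J[OF c] nz, of 0 1 0] by auto
  define T1 where "T1 = cd c (\<lambda>y. \<sigma>1 y c 2) x"
  \<comment> \<open>T1 is the third derivative at x of the flat field with jet z. The second
    derivative of [s 0, s 1] at x is T1 - \<mu>, and it has to equal \<mu>; hence \<mu> = T1 /
    2.\<close>
  define j where "j = (\<lambda>i::nat. if i = 0 then jet_of c 1 0 (T1 / 2) x
     else if i = 1 then jet_of c 0 1 0 x else jet_of c 0 0 2 x)"
  have j_in: "j i \<in> J 2 x" and j_nz: "j i \<noteq> (\<lambda>_ _. 0)" for i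
    using jet_of_in_J[OF c] nz by (auto simp: j_def)
  have "det3 c (j 0) (j 1) (j 2) \<noteq> 0" by (simp add: j_def det3_def jet_of_self[OF c])
  then have "\<exists>W S. x \<in> W \<and> flat_frame D W S \<and> (\<forall>i<3. S i x = j i)"
    using j_in j_nz by (intro flat_frame_through[OF c])
  then obtain W S where W: "x \<in> W" "flat_frame D W S" "\<forall>i<3. S i x = j i"
    by (elim exE conjE)
  have flS: "flat D W (S i)" if "i < 3" for i using W(2) that by (simp add: flat_frame_def)
  have Sx: "S 0 x = jet_of c 1 0 (T1 / 2) x" "S (Suc 0) x = jet_of c 0 1 0 x" "S 2 x = jet_of c 0 0 2 x"
    using W(3) by (simp_all add: j_def)
  have opW: "openin X W" using flatD(3)[OF flS[of 0]] by simp
  define s where "s = (\<lambda>i y. p0 (S i y))"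
  have s: "holo_vf W (s i)" if "i < 3" for i
    unfolding s_def by (rule holo_vf_p0[OF flatD(1)[OF flS[OF that]]])
  have js: "jet 2 (s i) y = S i y" if "i < 3" "y \<in> W" for i y
    unfolding s_def by (rule flat_is_jet[OF flS[OF that(1)] that(2)])
  have fls: "flat D W (jet 2 (s i))" if "i < 3" for i
    by (rule flat_cong[OF D flS[OF that]]) (rule js[OF that])
  have js0: "jet 2 (s 0) x = jet_of c 1 0 (T1 / 2) x" and js1: "jet 2 (s (Suc 0)) x = jet_of c 0 1 0 x"
    and js2: "jet 2 (s 2) x = jet_of c 0 0 2 x"
    using js[OF _ W(1)] Sx by simp_all
  \<comment> \<open>\<open>S (Suc 0)\<close> and \<sigma>1 agree near x, so T1 is also the third
    derivative of s 1.\<close>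
  have "flat D W (S (Suc 0))" by (rule flS) simp
  from flat_eq_near[OF this \<sigma>1(2) W(1) \<sigma>1(1)] obtain N where N: "openin X N" "x \<in> N" "N \<subseteq> W \<inter> V" "\<forall>y\<in>N. S (Suc 0) y = \<sigma>1 y"
    using Sx \<sigma>1(3) by auto
  have T1: "cd c (\<lambda>y. jet 2 (s (Suc 0)) y c 2) x = T1"
    unfolding T1_def by (rule cd_cong[OF N(1,2) c]) (use N(3,4) js[of "Suc 0"] in auto)
  define T where "T = (\<lambda>i. cd c (\<lambda>y. jet 2 (s i) y c 2) x)"
  \<comment> \<open>With these jets at x the derivative of the Wronskian is the third derivative of
    s 2, and condition (3) makes it 0.\<close>
  have T2: "T 2 = 0"
  proof -
    have h: "holo_section W (jet 2 (s 0))" "holo_section W (jet 2 (s (Suc 0)))" "holo_section W (jet 2 (s 2))"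
      by (rule holo_section_jet[OF s], simp)+
    have v: "coord_vec c x \<in> tangent x" by (rule coord_vec_tangent[OF c])
    have Dz: "D (jet 2 (s i)) x (coord_vec c x) = (\<lambda>_ _. 0)" if "i < 3" for i
      by (rule flatD(2)[OF fls[OF that] W(1) v])
    let ?G = "\<lambda>y. det3 c (jet 2 (s 0) y) (jet 2 (s (Suc 0)) y) (jet 2 (s 2) y)"
    let ?F = "\<lambda>y. det_triv y (jet 2 (s 0) y) (jet 2 (s (Suc 0)) y) (jet 2 (s 2) y)"
    have opc: "openin X (W \<inter> fst c)" by (rule openin_chart_Int[OF opW cA(1)])
    have xc: "x \<in> W \<inter> fst c" using W(1) cA by simp
    have FG: "?F y = - ?G y" if "y \<in> W \<inter> fst c" for y
      using det_triv_eq[of c y] holo_sectionD(2)[OF h(1), of y] holo_sectionD(2)[OF h(2), of y]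
        holo_sectionD(2)[OF h(3), of y] that cA by (simp add: charts_at_iff)
    have G: "holo_fun (W \<inter> fst c) ?G" by (rule holo_fun_det3[OF cA(1) h])
    have F: "holo_fun (W \<inter> fst c) ?F" by (rule holo_fun_cong[OF holo_fun_uminus[OF G]]) (simp add: FG)
    have xJ: "(\<lambda>_ _. 0) \<in> J 2 x" by (rule J_zero[OF x])
    have z: "det_triv x (\<lambda>_ _. 0) j k = 0" "det_triv x j (\<lambda>_ _. 0) k = 0" "det_triv x j k (\<lambda>_ _. 0) = 0"
      if "j \<in> J 2 x" "k \<in> J 2 x" for j k
      using det_triv_eq[OF c] that xJ by (simp_all add: det3_def)
    have "differential ?F x (coord_vec c x) = 0"
      using triv[unfolded induces_trivial_det_def, rule_format, OF h W(1) v]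
        holo_sectionD(2)[OF h(1) W(1)] holo_sectionD(2)[OF h(2) W(1)] holo_sectionD(2)[OF h(3) W(1)]
      by (simp add: Dz z)
    then have "cd c ?F x = 0"
      using differential_eq[OF F xc v c] coord_vec_self[OF c] by simp
    moreover have "cd c ?F x = cd c (\<lambda>y. - ?G y) x" by (rule cd_cong[OF opc xc c FG])
    ultimately have G0: "cd c ?G x = 0" using cd_uminus[OF G xc c] by simp
    have "cd c ?G x = T 2"
      unfolding cd_det3[OF h W(1) c]
      by (simp add: det3_def cd_jet[OF c] js0 js1 js2 jet_of_self[OF c]) (simp add: T_def)
    then show ?thesis using G0 by simp
  qed
  have s': "holo_vf W (s 0)" "holo_vf W (s (Suc 0))" "holo_vf W (s 2)" and fls': "flat D W (jet 2 (s 0))"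
    "flat D W (jet 2 (s (Suc 0)))" "flat D W (jet 2 (s 2))"
    by (rule s, simp)+ (rule fls, simp)+
  let ?b1 = "lie_bracket (s 0) (s (Suc 0))" and ?b2 = "lie_bracket (s 0) (s 2)"
  have fb: "flat D W (jet 2 ?b1)" "flat D W (jet 2 ?b2)"
    using br s' fls' unfolding flat_fields_bracket_closed_def by blast+
  have b1: "jet 2 ?b1 x c 0 = jet 2 (s 0) x c 0" "jet 2 ?b1 x c (Suc 0) = jet 2 (s 0) x c (Suc 0)"
    "jet 2 ?b1 x c 2 = jet 2 (s 0) x c 2"
    unfolding bracket_jet[OF s'(1,2) W(1) c] js0 js1 T1 by (simp_all add: jet_of_self[OF c])
  have b2: "jet 2 ?b2 x c 0 = 2 * jet 2 (s (Suc 0)) x c 0" "jet 2 ?b2 x c (Suc 0) = 2 * jet 2 (s (Suc 0)) x c (Suc 0)"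
    "jet 2 ?b2 x c 2 = 2 * jet 2 (s (Suc 0)) x c 2"
    unfolding bracket_jet[OF s'(1,3) W(1) c] js0 js1 js2 T2[unfolded T_def] by (simp_all add: jet_of_self[OF c])
  \<comment> \<open>The brackets have flat jets by condition (4), so agreement of jets at x extends
    to a neighbourhood.\<close>
  have "jet 2 ?b1 x = jet 2 (s 0) x"
    by (rule J_eqI[OF _ _ c]) (rule holo_sectionD(2)[OF flatD(1)[OF fb(1)] W(1)]
        holo_sectionD(2)[OF flatD(1)[OF fls'(1)] W(1)] b1)+
  from flat_eq_near[OF fb(1) fls'(1) W(1) W(1) this]
  obtain N1 where N1: "openin X N1" "x \<in> N1" "N1 \<subseteq> W \<inter> W" "\<forall>y\<in>N1. jet 2 ?b1 y = jet 2 (s 0) y"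
    by (elim exE conjE)
  have f2: "flat D W (\<lambda>y d k. 2 * jet 2 (s (Suc 0)) y d k)" by (rule flat_scale[OF D fls'(2)])
  have "jet 2 ?b2 x = (\<lambda>d k. 2 * jet 2 (s (Suc 0)) x d k)"
    by (rule J_eqI[OF _ _ c]) (rule holo_sectionD(2)[OF flatD(1)[OF fb(2)] W(1)]
        holo_sectionD(2)[OF flatD(1)[OF f2] W(1)] b2)+
  from flat_eq_near[OF fb(2) f2 W(1) W(1) this]
  obtain N2 where N2: "openin X N2" "x \<in> N2" "N2 \<subseteq> W \<inter> W" "\<forall>y\<in>N2. jet 2 ?b2 y = (\<lambda>d k. 2 * jet 2 (s (Suc 0)) y d k)"
    by (elim exE conjE)
  let ?N = "N1 \<inter> N2"
  have op: "openin X ?N" using N1(1) N2(1) by blast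
  have NW: "?N \<subseteq> W" using N1(3) by blast
  have e: "?b1 y d = s 0 y d" "?b2 y d = 2 * s 1 y d" if y: "y \<in> ?N" and d: "d \<in> charts_at y" for y d
  proof -
    have "jet 2 ?b1 y d 0 = jet 2 (s 0) y d 0" "jet 2 ?b2 y d 0 = 2 * jet 2 (s (Suc 0)) y d 0"
      using N1(4) N2(4) y by auto
    then show "?b1 y d = s 0 y d" "?b2 y d = 2 * s 1 y d" by (simp_all add: jet_0[OF d])
  qed
  have "s 0 x c = 1" "s 1 x c = 0" "s 2 x c = 0"
    using jet_0[OF c, of 2 "s 0"] jet_0[OF c, of 2 "s 1"] jet_0[OF c, of 2 "s 2"] js0 js1 js2
    by (simp_all add: jet_of_self[OF c])
  moreover have "holo_vf ?N (s i) \<and> flat D ?N (jet 2 (s i))" if "i < 3" for i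
    using holo_vf_subset[OF s[OF that] op NW] flat_subset[OF fls[OF that] op NW] by blast
  ultimately show ?thesis
    using op N1(2) N2(2) e by (intro exI[of _ ?N] exI[of _ s]) simp
qed

lemma flat_local_coord:
  assumes x: "x \<in> topspace X" and triv: "induces_trivial_det D" and br: "flat_fields_bracket_closed D"
  shows "\<exists>W h. x \<in> W \<and> local_coord W h \<and> inj_on h W \<and> (\<forall>i<3. flat D W (jet 2 (hfield h i)))"
proof -
  obtain c where c: "c \<in> charts_at x" using charts_at_nonempty[OF x] by blast
  have cA: "c \<in> A" "x \<in> fst c" using c by auto
  obtain W and s :: "nat \<Rightarrow> 'a \<Rightarrow> 'a tvec" where W: "openin X W" "x \<in> W" "\<forall>i<3. holo_vf W (s i) \<and> flat D W (jet 2 (s i))"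
    and sx: "s 0 x c = 1" "s 1 x c = 0" "s 2 x c = 0"
    and br': "\<forall>y\<in>W. \<forall>d\<in>charts_at y. lie_bracket (s 0) (s 1) y d = s 0 y d \<and> lie_bracket (s 0) (s 2) y d = 2 * s 1 y d"
    using normal_frame[OF x c triv br] by (elim exE conjE)
  have s: "holo_vf W (s i)" and fl: "flat D W (jet 2 (s i))" if "i < 3" for i using W(3) that by auto
  have hs: "holo_fun (W \<inter> fst c) (\<lambda>y. s i y c)" if "i < 3" for i by (rule holo_vfD(3)[OF s[OF that] cA(1)])
  define V where "V = {y \<in> W \<inter> fst c. s 0 y c \<noteq> 0}"
  have opV: "openin X V" unfolding V_def by (rule holo_fun_open_nonzero[OF hs]) simp
  have xV: "x \<in> V" using W(2) cA sx by (simp add: V_def)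
  have VW: "V \<subseteq> W \<inter> fst c" by (auto simp: V_def)
  have ch: "c \<in> charts_at y" if "y \<in> V" for y using that VW cA by (auto simp: charts_at_iff)
  have hV: "holo_fun V (\<lambda>y. s i y c)" if "i < 3" for i by (rule holo_fun_subset[OF hs[OF that] opV VW])
  have s0: "s 0 y c \<noteq> 0" if "y \<in> V" for y using that by (simp add: V_def)
  have quot: "holo_fun V (\<lambda>y. s i y c / s 0 y c)" if "i < 3" for i
    using s0 by (intro holo_fun_divide hV that) simp_all
  have dquot: "cd c (\<lambda>y. s i y c / s 0 y c) y = lie_bracket (s 0) (s i) y c / (s 0 y c * s 0 y c)"
    if "i < 3" "y \<in> V" for i y
    using cd_divide[OF hV[OF that(1)] hV[of 0] that(2) ch[OF that(2)] s0[OF that(2)]] ch[OF that(2)]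
    by (simp add: lie_bracket_def cd_def[symmetric] algebra_simps)
  define h where "h = (\<lambda>y. s 1 y c / s 0 y c)"
  have h: "holo_fun V h" unfolding h_def by (rule quot) simp
  have brV: "lie_bracket (s 0) (s 1) y c = s 0 y c" "lie_bracket (s 0) (s 2) y c = 2 * s 1 y c" if "y \<in> V" for y
    using br' ch[OF that] VW that by auto
  have dh: "cd c h y = 1 / s 0 y c" if y: "y \<in> V" for y
    unfolding h_def using dquot[of 1, OF _ y] brV[OF y] s0[OF y] by simp
  have lc: "local_coord V h"
    unfolding local_coord_def
  proof (intro conjI ballI h)
    fix y d assume y: "y \<in> V" and d: "d \<in> charts_at y"
    have "cd c h y \<noteq> 0" using dh[OF y] s0[OF y] by simp
    then show "cd d h y \<noteq> 0" using cd_chain[OF h y ch[OF y] d] by auto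
  qed
  have hh: "holo_fun V (\<lambda>y. s 2 y c / s 0 y c - h y * h y)"
    by (intro holo_fun_diff holo_fun_mult h quot) simp
  have q2: "holo_fun V (\<lambda>y. s 2 y c / s 0 y c)" by (rule quot) simp
  have z: "cd c (\<lambda>y. s 2 y c / s 0 y c - h y * h y) y = 0" if y: "y \<in> V" "y \<in> fst c" for y
    unfolding cd_diff[OF q2 holo_fun_mult[OF h h] y(1) ch[OF y(1)]] cd_mult[OF h h y(1) ch[OF y(1)]]
    using dquot[of 2, OF _ y(1)] brV[OF y(1)] s0[OF y(1)] dh[OF y(1)]
    by (simp add: h_def)
  have "\<exists>N. openin X N \<and> x \<in> N \<and> N \<subseteq> V \<and>
    (\<forall>y\<in>N. s 2 y c / s 0 y c - h y * h y = s 2 x c / s 0 x c - h x * h x)"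
    by (rule cd_zero_imp_const[OF hh xV c z])
  then obtain N where N: "openin X N" "x \<in> N" "N \<subseteq> V"
    "\<forall>y\<in>N. s 2 y c / s 0 y c - h y * h y = s 2 x c / s 0 x c - h x * h x"
    by (elim exE conjE)
  \<comment> \<open>The constant is 0, since s 1 and s 2 vanish at x.\<close>
  have s2: "s 2 y c / s 0 y c = h y * h y" if "y \<in> N" for y
    using N(4) that sx by (simp add: h_def)
  let ?Z = "snd c ` (N \<inter> fst c)"
  have opZ: "open ?Z" by (rule open_chart_image[OF cA(1) N(1)])
  have hol: "in_chart c h holomorphic_on ?Z"
    by (rule holo_funD(2)[OF holo_fun_subset[OF h N(1,3)] cA(1)])
  have xZ: "snd c x \<in> ?Z" using N(2) cA by blast
  \<comment> \<open>h' = 1 / s 0 = 1 at x, so h is injective near x, as a chart into the projective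
    line has to be.\<close>
  have "deriv (in_chart c h) (snd c x) \<noteq> 0"
    using dh[OF xV] sx by (simp add: cd_def)
  then obtain r where r: "r > 0" "ball (snd c x) r \<subseteq> ?Z" "inj_on (in_chart c h) (ball (snd c x) r)"
    using has_complex_derivative_locally_injective[OF hol xZ opZ] by blast
  let ?M = "{y \<in> fst c. snd c y \<in> ball (snd c x) r} \<inter> N"
  have opM: "openin X ?M" by (intro openin_Int open_chart_preimage[OF cA(1)] N(1)) simp
  have xM: "x \<in> ?M" using N(2) cA r(1) by simp
  have MV: "?M \<subseteq> V" using N(3) by blast
  have MW: "?M \<subseteq> W" using MV VW by blast
  have "inj_on h ?M"
  proof (rule inj_onI)
    fix y z assume y: "y \<in> ?M" and z: "z \<in> ?M" and "h y = h z"
    then have "in_chart c h (snd c y) = in_chart c h (snd c z)" using cA by simp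
    then have "snd c y = snd c z" by (rule inj_onD[OF r(3)]) (use y z in auto)
    then show "y = z" using inj_onD[OF inj_on_chart[OF cA(1)]] y z by blast
  qed
  moreover have lM: "local_coord ?M h" by (rule local_coord_subset[OF lc opM MV])
  moreover have "\<forall>i<3. flat D ?M (jet 2 (hfield h i))"
  proof (intro allI impI)
    fix i :: nat assume i: "i < 3"
    show "flat D ?M (jet 2 (hfield h i))"
    proof -
      \<comment> \<open>Tangent spaces are one-dimensional, so it is enough to compare components in
        \<open>c\<close>.\<close>
      have eq: "hfield h i y = s i y" if y: "y \<in> ?M" for y
      proof (rule tangent_eqI[OF _ _ ch])
        show "hfield h i y \<in> tangent y" by (rule holo_vfD(2)[OF holo_vf_hfield[OF lM] y])
        show "s i y \<in> tangent y" by (rule holo_vfD(2)[OF s[OF i]]) (use y MW in blast)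
        show yV: "y \<in> V" using y MV by blast
        have n: "s 0 y c \<noteq> 0" by (rule s0[OF yV])
        have "s 2 y c = h y * h y * s 0 y c" using s2[of y] y n by (simp add: field_simps)
        moreover have "s 1 y c = h y * s 0 y c" using n by (simp add: h_def)
        moreover have "i = 0 \<or> i = 1 \<or> i = 2" using i by linarith
        ultimately show "hfield h i y c = s i y c"
          using ch[OF yV] n dh[OF yV] by (auto simp: hfield_def power2_eq_square)
      qed
      have "flat D ?M (jet 2 (s i))" by (rule flat_subset[OF fl[OF i] opM MW])
      then show ?thesis
        by (rule flat_cong[OF D]) (rule jet_cong[OF opM _ eq])
    qed
  qed
  ultimately show ?thesis using xM by (intro exI[of _ ?M] exI[of _ h] conjI)
qed

end

end

context projective_surface
begin

text \<open>The converse of \<open>embedding_local_coord\<close>, producing a chart whose image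
  avoids the point at infinity, the line of w.\<close>

lemma local_coord_embedding:
  assumes h: "local_coord W h" and inj: "inj_on h W" and fr: "frame2 u w \<alpha> \<beta>"
  defines "f \<equiv> \<lambda>y. line (u + sc (h y) w)"
  shows "holo_embedding sc W f" "affine_dom W f \<alpha> = W" "affine_coord \<alpha> \<beta> \<circ> f = h"
proof -
  note fd = frame2D[OF fr]
  note hh = local_coordD(1)[OF h]
  have W: "openin X W" by (rule local_coordD(3)[OF h])
  show ac: "affine_coord \<alpha> \<beta> \<circ> f = h"
    by (rule ext) (simp add: f_def affine_coord_frame(1)[OF fr])
  have nzA: "\<exists>z\<in>f y. \<alpha> z \<noteq> 0" for y
    unfolding f_def line_nonvanishing[OF fd(1)] affine_coord_frame(2)[OF fr] by simp
  then show "affine_dom W f \<alpha> = W" by (auto simp: affine_dom_def)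
  have nz: "(\<exists>z\<in>f y. \<gamma> z \<noteq> 0) \<longleftrightarrow> \<gamma> u + h y * \<gamma> w \<noteq> 0" if "functional sc \<gamma>" for \<gamma> y
    unfolding f_def line_nonvanishing[OF that] by (simp add: functional_simps[OF that])
  show "holo_embedding sc W f"
    unfolding holo_embedding_def
  proof (intro conjI allI impI ballI W)
    show "f ` W \<subseteq> projective_line sc"
      using line_in_projective_line line_vector_nonzero[OF fr] by (auto simp: f_def)
    show "inj_on f W"
    proof (rule inj_onI)
      fix y z assume yz: "y \<in> W" "z \<in> W" "f y = f z"
      have "h y = h z" using fun_cong[OF ac, of y] fun_cong[OF ac, of z] yz(3) by simp
      then show "y = z" using inj_onD[OF inj] yz by blast
    qed
  next
    fix \<gamma> \<delta> assume g: "functional sc \<gamma>" and d: "functional sc \<delta>"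
    have eq: "{x \<in> W. \<exists>z\<in>f x. \<gamma> z \<noteq> 0} = {x \<in> W. \<gamma> u + h x * \<gamma> w \<noteq> 0}" using nz[OF g] by blast
    have hl: "holo_fun W (\<lambda>y. r + h y * q)" for r q
      by (intro holo_fun_add holo_fun_mult holo_fun_const[OF W] hh)
    have op: "openin X {x \<in> W. \<gamma> u + h x * \<gamma> w \<noteq> 0}" by (rule holo_fun_open_nonzero[OF hl])
    have "holo_fun {x \<in> W. \<gamma> u + h x * \<gamma> w \<noteq> 0} (\<lambda>y. (\<delta> u + h y * \<delta> w) / (\<gamma> u + h y * \<gamma> w))"
      by (intro holo_fun_divide holo_fun_subset[OF hl op]) auto
    then show "holo_fun {x \<in> W. \<exists>z\<in>f x. \<gamma> z \<noteq> 0} (affine_coord \<gamma> \<delta> \<circ> f)"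
      unfolding eq
      by (rule holo_fun_cong) (simp add: f_def affine_coord_line[OF g d] functional_simps[OF g] functional_simps[OF d])
  next
    fix x assume x: "x \<in> W"
    obtain c where c: "c \<in> charts_at x" using chart_exists[OF W] x by blast
    have "differential h x (coord_vec c x) \<noteq> 0"
      using differential_eq[OF hh x coord_vec_tangent[OF c] c] coord_vec_self[OF c] local_coordD(2)[OF h x c] by simp
    then show "\<exists>\<alpha> \<beta>. functional sc \<alpha> \<and> functional sc \<beta> \<and> (\<exists>w\<in>f x. \<alpha> w \<noteq> 0) \<and>
        (\<exists>v\<in>tangent x. differential (affine_coord \<alpha> \<beta> \<circ> f) x v \<noteq> 0)"
      using fd(1,2) nzA[of x] coord_vec_tangent[OF c] ac
      by (intro exI[of _ \<alpha>] exI[of _ \<beta>] conjI bexI[of _ "coord_vec c x"]) simp_all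
  qed
qed

section \<open>The bijection\<close>

lemma projective_atlas_iff:
  "projective_atlas sc P \<longleftrightarrow> (\<Union>(U, f)\<in>P. U) = topspace X \<and> (\<forall>(U, f)\<in>P. holo_embedding sc U f) \<and>
     (\<forall>(U, f)\<in>P. \<forall>(U', g)\<in>P. \<forall>x\<in>U \<inter> U'. moebius_near U f U' g x)"
proof (cases "\<forall>(U, f)\<in>P. holo_embedding sc U f")
  case True
  have emb: "holo_embedding sc U f" if "(U, f) \<in> P" for U f using True that by blast
  have "(\<forall>(U, f)\<in>P. \<forall>(U', g)\<in>P. \<forall>C\<in>connected_components_of (subtopology X (U \<inter> U')).
        \<exists>T\<in>PGL sc. \<forall>L\<in>f ` C. (g \<circ> inv_into U f) L = T L) \<longleftrightarrow>
     (\<forall>(U, f)\<in>P. \<forall>(U', g)\<in>P. \<forall>x\<in>U \<inter> U'. moebius_near U f U' g x)" (is "(\<forall>p\<in>P. ?L p) \<longleftrightarrow> (\<forall>p\<in>P. ?R p)")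
  proof (rule ball_cong[OF refl])
    fix p assume p: "p \<in> P"
    obtain U f where pU: "p = (U, f)" by (cases p)
    show "?L p \<longleftrightarrow> ?R p"
      unfolding pU prod.case
    proof (rule ball_cong[OF refl])
      fix q assume q: "q \<in> P"
      obtain U' g where qU: "q = (U', g)" by (cases q)
      show "(case q of (U', g) \<Rightarrow> \<forall>C\<in>connected_components_of (subtopology X (U \<inter> U')).
          \<exists>T\<in>PGL sc. \<forall>L\<in>f ` C. (g \<circ> inv_into U f) L = T L) \<longleftrightarrow>
        (case q of (U', g) \<Rightarrow> \<forall>x\<in>U \<inter> U'. moebius_near U f U' g x)"
        unfolding qU prod.case using p q by (intro transition_iff emb) (simp_all add: pU qU)
    qed
  qed
  then show ?thesis unfolding projective_atlas_def by (simp only:)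
next
  case False
  then show ?thesis unfolding projective_atlas_def by (simp only: simp_thms)
qed

lemma atlasD:
  assumes P: "projective_atlas sc P"
  shows "(\<Union>(U, f)\<in>P. U) = topspace X" "(U, f) \<in> P \<Longrightarrow> holo_embedding sc U f"
    "(U, f) \<in> P \<Longrightarrow> (U', g) \<in> P \<Longrightarrow> x \<in> U \<Longrightarrow> x \<in> U' \<Longrightarrow> moebius_near U f U' g x"
  using P[unfolded projective_atlas_iff, THEN conjunct1]
    P[unfolded projective_atlas_iff, THEN conjunct2, THEN conjunct1]
    P[unfolded projective_atlas_iff, THEN conjunct2, THEN conjunct2] by blast+

lemma atlasI:
  assumes "(\<Union>(U, f)\<in>P. U) = topspace X" "\<And>U f. (U, f) \<in> P \<Longrightarrow> holo_embedding sc U f"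
    "\<And>U f U' g x. (U, f) \<in> P \<Longrightarrow> (U', g) \<in> P \<Longrightarrow> x \<in> U \<inter> U' \<Longrightarrow> moebius_near U f U' g x"
  shows "projective_atlas sc P"
  unfolding projective_atlas_iff
proof (intro conjI ballI)
  show "case p of (U, f) \<Rightarrow> holo_embedding sc U f" if "p \<in> P" for p
    using assms(2) that by (cases p) simp
  show "case p of (U, f) \<Rightarrow> \<forall>(U', g)\<in>P. \<forall>x\<in>U \<inter> U'. moebius_near U f U' g x" if "p \<in> P" for p
    using assms(3) that by (cases p) auto
qed (rule assms(1))

definition adapted_to :: "'a connection \<Rightarrow> ('a set \<times> ('a \<Rightarrow> 'v set)) set \<Rightarrow> bool" where
  "adapted_to D P \<longleftrightarrow> holomorphic_connection D \<and> (\<forall>(U, f)\<in>P. adapted D U f)"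

lemma atlas_cover:
  assumes P: "projective_atlas sc P" and x: "x \<in> topspace X"
  shows "\<exists>U f u w \<alpha> \<beta>. (U, f) \<in> P \<and> holo_embedding sc U f \<and> frame2 u w \<alpha> \<beta> \<and> x \<in> affine_dom U f \<alpha>"
proof -
  have "x \<in> (\<Union>(U, f)\<in>P. U)" using atlasD(1)[OF P] x by simp
  then obtain U f where U: "(U, f) \<in> P" "x \<in> U" by blast
  then have emb: "holo_embedding sc U f" using atlasD(2)[OF P] by simp
  show ?thesis using centered_frame[OF emb U(2)] U(1) emb by blast
qed

lemma adapted_sl2_frame:
  assumes P: "projective_atlas sc P" and D: "adapted_to D P" and x: "x \<in> topspace X"
  shows "\<exists>W s. x \<in> W \<and> sl2_frame D W s"
proof -
  obtain U f u w \<alpha> \<beta> where U: "(U, f) \<in> P" "holo_embedding sc U f" "frame2 u w \<alpha> \<beta>" "x \<in> affine_dom U f \<alpha>"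
    using atlas_cover[OF P x] by blast
  have "holomorphic_connection D" "adapted D U f" using D U(1) by (auto simp: adapted_to_def)
  then show ?thesis
    using sl2_frame_hfield[OF embedding_local_coord[OF U(2,3)]] adapted_imp_flat[OF _ U(2) _ U(3)] U(4) by blast
qed

text \<open>The frames of the fields h^i d/dh cover the surface and are flat for both
  connections.\<close>

lemma adapted_unique:
  assumes P: "projective_atlas sc P" and D: "adapted_to D P" and D': "adapted_to D' P"
  shows "D = D'"
proof (rule conn_unique)
  show h: "holomorphic_connection D" "holomorphic_connection D'" using D D' by (auto simp: adapted_to_def)
  fix x assume x: "x \<in> topspace X"
  obtain U f u w \<alpha> \<beta> where U: "(U, f) \<in> P" "holo_embedding sc U f" "frame2 u w \<alpha> \<beta>" "x \<in> affine_dom U f \<alpha>"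
    using atlas_cover[OF P x] by blast
  have ad: "adapted D U f" "adapted D' U f" using D D' U(1) by (auto simp: adapted_to_def)
  let ?S = "\<lambda>i. jet 2 (hfield (affine_coord \<alpha> \<beta> \<circ> f) i)"
  have "frame (affine_dom U f \<alpha>) ?S" by (rule frame_hfield[OF embedding_local_coord[OF U(2,3)]])
  then have "flat_frame D (affine_dom U f \<alpha>) ?S" "flat_frame D' (affine_dom U f \<alpha>) ?S"
    using adapted_imp_flat[OF h(1) U(2) ad(1) U(3)] adapted_imp_flat[OF h(2) U(2) ad(2) U(3)]
    by (simp_all add: flat_frame_def)
  then show "\<exists>W S. x \<in> W \<and> flat_frame D W S \<and> flat_frame D' W S"
    using U(4) by (intro exI[of _ "affine_dom U f \<alpha>"] exI[of _ ?S]) simp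
qed

text \<open>All affine coordinates of all charts enter the family \<open>FR\<close>. Compatibility
  of the atlas makes the changes of frame locally constant, so the frames glue to a connection for
  which all of them are flat.\<close>

lemma adapted_exists:
  assumes P: "projective_atlas sc P"
  shows "\<exists>D. adapted_to D P"
proof -
  define FR where "FR = {(W, S). \<exists>U f u w \<alpha> \<beta>. (U, f) \<in> P \<and> frame2 u w \<alpha> \<beta> \<and> W = affine_dom U f \<alpha> \<and>
    S = (\<lambda>i. jet 2 (hfield (affine_coord \<alpha> \<beta> \<circ> f) i))}"
  have emb: "holo_embedding sc U f" if "(U, f) \<in> P" for U f
    by (rule atlasD(2)[OF P that])
  have rel: "moebius_near U f U' g x" if "(U, f) \<in> P" "(U', g) \<in> P" "x \<in> U" "x \<in> U'" for U f U' g x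
    by (rule atlasD(3)[OF P that])
  have FR_I: "(affine_dom U f \<alpha>, \<lambda>i. jet 2 (hfield (affine_coord \<alpha> \<beta> \<circ> f) i)) \<in> FR"
    if "(U, f) \<in> P" "frame2 u w \<alpha> \<beta>" for U f u w \<alpha> \<beta>
    unfolding FR_def using that by blast
  have "\<exists>D. holomorphic_connection D \<and> (\<forall>(W, S)\<in>FR. \<forall>i<3. flat D W (S i))"
  proof (rule glued_connection)
    fix x assume "x \<in> topspace X"
    then show "\<exists>W S. (W, S) \<in> FR \<and> x \<in> W" using atlas_cover[OF P] FR_I by blast
  next
    fix W S assume "(W, S) \<in> FR"
    then obtain U f u w \<alpha> \<beta> where U: "(U, f) \<in> P" "frame2 u w \<alpha> \<beta>" and WS: "W = affine_dom U f \<alpha>"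
      "S = (\<lambda>i. jet 2 (hfield (affine_coord \<alpha> \<beta> \<circ> f) i))"
      unfolding FR_def mem_Collect_eq prod.case by (elim exE conjE)
    show "frame W S"
      unfolding WS by (rule frame_hfield[OF embedding_local_coord[OF emb[OF U(1)] U(2)]])
  next
    fix W S W' S' x assume "(W, S) \<in> FR" "(W', S') \<in> FR" and x: "x \<in> W" "x \<in> W'"
    then obtain U f u w \<alpha> \<beta> U' g u' w' \<alpha>' \<beta>' where U: "(U, f) \<in> P" "frame2 u w \<alpha> \<beta>"
      and WS: "W = affine_dom U f \<alpha>" "S = (\<lambda>i. jet 2 (hfield (affine_coord \<alpha> \<beta> \<circ> f) i))"
      and U': "(U', g) \<in> P" "frame2 u' w' \<alpha>' \<beta>'"
      and WS': "W' = affine_dom U' g \<alpha>'" "S' = (\<lambda>i. jet 2 (hfield (affine_coord \<alpha>' \<beta>' \<circ> g) i))"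
      unfolding FR_def mem_Collect_eq prod.case by (elim exE conjE)
    show "\<exists>N a. openin X N \<and> x \<in> N \<and> N \<subseteq> W \<inter> W' \<and> (\<forall>y\<in>N. \<forall>i<3. S' i y = (\<lambda>d k. \<Sum>j<3. a i j * S j y d k))"
      unfolding WS WS'
      by (rule hfield_compatible[OF emb[OF U(1)] emb[OF U'(1)] U(2) U'(2)])
         (use x rel[OF U(1) U'(1), of x] in \<open>auto simp: WS WS' affine_dom_def\<close>)
  qed
  then obtain D where D: "holomorphic_connection D" "\<forall>(W, S)\<in>FR. \<forall>i<3. flat D W (S i)" by blast
  have "adapted D U f" if U: "(U, f) \<in> P" for U f
  proof (rule flat_imp_adapted[OF D(1) emb[OF U]])
    fix x assume "x \<in> U"
    then obtain u w \<alpha> \<beta> where fr: "frame2 u w \<alpha> \<beta>" and x: "x \<in> affine_dom U f \<alpha>"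
      using centered_frame[OF emb[OF U]] by blast
    have "\<forall>i<3. flat D (affine_dom U f \<alpha>) (jet 2 (hfield (affine_coord \<alpha> \<beta> \<circ> f) i))"
      using bspec[OF D(2) FR_I[OF U fr]] by simp
    then show "\<exists>W u w \<alpha> \<beta>. frame2 u w \<alpha> \<beta> \<and> openin X W \<and> x \<in> W \<and> W \<subseteq> affine_dom U f \<alpha> \<and>
      (\<forall>i<3. flat D W (jet 2 (hfield (affine_coord \<alpha> \<beta> \<circ> f) i)))"
      using fr x local_coordD(3)[OF embedding_local_coord[OF emb[OF U] fr]] by blast
  qed
  then show ?thesis using D(1) by (auto simp: adapted_to_def)
qed

text \<open>A connection adapted to the union is adapted to both parts, so uniqueness identifies it
  with each of the two. Conversely, charts adapted to one connection are Moebius related, whichever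
  atlas they come from.\<close>

lemma atlas_union_iff:
  assumes P: "projective_atlas sc P" and Q: "projective_atlas sc Q" and DP: "adapted_to D P" and DQ: "adapted_to D' Q"
  shows "projective_atlas sc (P \<union> Q) \<longleftrightarrow> D = D'"
proof
  assume "projective_atlas sc (P \<union> Q)"
  then obtain E where "adapted_to E (P \<union> Q)" using adapted_exists by blast
  then have "adapted_to E P" "adapted_to E Q" by (auto simp: adapted_to_def)
  then show "D = D'" using adapted_unique[OF P DP] adapted_unique[OF Q DQ] by blast
next
  assume eq: "D = D'"
  have D: "holomorphic_connection D" and ad: "\<And>U f. (U, f) \<in> P \<union> Q \<Longrightarrow> adapted D U f"
    using DP DQ eq by (auto simp: adapted_to_def)
  have emb: "holo_embedding sc U f" if "(U, f) \<in> P \<union> Q" for U f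
    using that atlasD(2)[OF P, of U f] atlasD(2)[OF Q, of U f] by blast
  have "(\<Union>(U, f)\<in>P \<union> Q. U) = topspace X" using atlasD(1)[OF P] atlasD(1)[OF Q] by (simp add: UN_Un)
  moreover have "moebius_near U f U' g x" if "(U, f) \<in> P \<union> Q" "(U', g) \<in> P \<union> Q" "x \<in> U \<inter> U'" for U f U' g x
    by (rule adapted_moebius[OF D emb[OF that(1)] emb[OF that(2)] ad[OF that(1)] ad[OF that(2)] that(3)])
  ultimately show "projective_atlas sc (P \<union> Q)" using emb by (intro atlasI)
qed

definition atlas_class :: "('a set \<times> ('a \<Rightarrow> 'v set)) set \<Rightarrow> ('a set \<times> ('a \<Rightarrow> 'v set)) set set" where
  "atlas_class P = {Q. projective_atlas sc Q \<and> projective_atlas sc (P \<union> Q)}"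

lemma projective_structures_eq: "projective_structures sc = atlas_class ` {P. projective_atlas sc P}"
  unfolding projective_structures_def quotient_def atlas_class_def by (auto simp: Image_def)

text \<open>The description quantifies over all atlases of the class. \<open>atlas_union_iff\<close>
  makes D adapted to each of them; uniqueness already follows from P, a member of its own
  class.\<close>

lemma structure_connection_eq:
  assumes P: "projective_atlas sc P" and D: "adapted_to D P"
  shows "structure_connection sc (atlas_class P) = D"
proof -
  have iff: "(holomorphic_connection E \<and> (\<forall>Q\<in>\<Q>. \<forall>(U, f)\<in>Q. \<forall>B s. Vector_Spaces.linear sc sc B \<longrightarrow> pulls_back sc U f B s \<longrightarrow>
        flat E U (jet 2 s))) \<longleftrightarrow> holomorphic_connection E \<and> (\<forall>Q\<in>\<Q>. adapted_to E Q)" for E \<Q>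
    unfolding adapted_to_def adapted_def by blast
  show ?thesis
    unfolding structure_connection_def iff
  proof (rule the_equality)
    have "adapted_to D Q" if Q: "Q \<in> atlas_class P" for Q
    proof -
      have Q': "projective_atlas sc Q" "projective_atlas sc (P \<union> Q)" using Q by (auto simp: atlas_class_def)
      obtain E where E: "adapted_to E Q" using adapted_exists[OF Q'(1)] by blast
      have "D = E" using atlas_union_iff[OF P Q'(1) D E] Q'(2) by blast
      then show ?thesis using E by simp
    qed
    then show "holomorphic_connection D \<and> (\<forall>Q\<in>atlas_class P. adapted_to D Q)"
      using D by (auto simp: adapted_to_def)
  next
    fix E assume E: "holomorphic_connection E \<and> (\<forall>Q\<in>atlas_class P. adapted_to E Q)"
    have "P \<in> atlas_class P" using P by (simp add: atlas_class_def)
    then show "E = D" using E adapted_unique[OF P _ D] by blast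
  qed
qed

lemma adapted_conditions:
  assumes P: "projective_atlas sc P" and D: "adapted_to D P"
  shows "oper_connection D" "\<And>x j. j \<in> J 2 x \<Longrightarrow> F_endo D x j = j" "induces_trivial_det D"
    "flat_fields_bracket_closed D"
proof -
  have h: "holomorphic_connection D" using D by (simp add: adapted_to_def)
  note loc = adapted_sl2_frame[OF P D]
  show "oper_connection D" by (rule oper[OF h loc])
  show "F_endo D x j = j" if "j \<in> J 2 x" for x j by (rule F_endo_id[OF h loc that])
  show "induces_trivial_det D" by (rule trivial_det[OF h loc])
  show "flat_fields_bracket_closed D" by (rule bracket_closed[OF h loc])
qed

text \<open>The atlas is the largest possible one, consisting of all embeddings adapted to D. Its
  compatibility is \<open>adapted_moebius\<close>, and the flat local coordinates provide enough
  charts to cover.\<close>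

lemma conditions_adapted:
  assumes D: "holomorphic_connection D" and F: "\<And>x j. x \<in> topspace X \<Longrightarrow> j \<in> J 2 x \<Longrightarrow> F_endo D x j = j"
    and det: "induces_trivial_det D" and br: "flat_fields_bracket_closed D"
  shows "\<exists>P. projective_atlas sc P \<and> adapted_to D P"
proof -
  define P where "P = {(U, f). holo_embedding sc U f \<and> adapted D U f}"
  have cover: "\<exists>U f. (U, f) \<in> P \<and> x \<in> U" if x: "x \<in> topspace X" for x
  proof -
    obtain W h where W: "x \<in> W" "local_coord W h" "inj_on h W" "\<forall>i<3. flat D W (jet 2 (hfield h i))"
      using flat_local_coord[OF D F x det br] by blast
    obtain u :: 'v where "u \<noteq> 0" using nonzero_exists by blast
    then obtain w \<alpha> \<beta> where fr: "frame2 u w \<alpha> \<beta>" using frame2_exists by blast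
    let ?f = "\<lambda>y. line (u + sc (h y) w)"
    note e = local_coord_embedding[OF W(2,3) fr]
    have "adapted D W ?f"
    proof (rule flat_imp_adapted[OF D e(1)])
      fix y assume "y \<in> W"
      then show "\<exists>W' u w \<alpha> \<beta>. frame2 u w \<alpha> \<beta> \<and> openin X W' \<and> y \<in> W' \<and> W' \<subseteq> affine_dom W ?f \<alpha> \<and>
          (\<forall>i<3. flat D W' (jet 2 (hfield (affine_coord \<alpha> \<beta> \<circ> ?f) i)))"
        using fr W(4) e(2,3) local_coordD(3)[OF W(2)]
        by (intro exI[of _ W] exI[of _ u] exI[of _ w] exI[of _ \<alpha>] exI[of _ \<beta>]) simp
    qed
    then show ?thesis using e(1) W(1) unfolding P_def by blast
  qed
  have emb: "holo_embedding sc U f" and ad: "adapted D U f" if "(U, f) \<in> P" for U f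
    using that by (auto simp: P_def)
  have "(\<Union>(U, f)\<in>P. U) = topspace X"
    using cover openin_subset[OF embeddingD(1)[OF emb]] by fast
  moreover have "moebius_near U f U' g x" if "(U, f) \<in> P" "(U', g) \<in> P" "x \<in> U \<inter> U'" for U f U' g x
    by (rule adapted_moebius[OF D emb[OF that(1)] emb[OF that(2)] ad[OF that(1)] ad[OF that(2)] that(3)])
  ultimately have "projective_atlas sc P" using emb by (intro atlasI)
  moreover have "adapted_to D P" using D ad by (auto simp: adapted_to_def)
  ultimately show ?thesis by blast
qed

end

theorem corollary3p6:
  fixes X :: "'a topology" and A :: "'a chart set"
    and sc :: "complex \<Rightarrow> 'v::ab_group_add \<Rightarrow> 'v"
  assumes "riemann_surface X A" and "connected_space X"
    and "vector_space sc" and "vector_space.dim sc UNIV = 2"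
  shows "bij_betw (riemann_surface.structure_connection X A sc)
           (riemann_surface.projective_structures X A sc)
           {D. riemann_surface.holomorphic_connection X A D \<and>
               riemann_surface.oper_connection X A D \<and>
               (\<forall>x\<in>topspace X. \<forall>j\<in>riemann_surface.J X A 2 x.
                  riemann_surface.F_endo X A D x j = j) \<and>
               riemann_surface.induces_trivial_det X A D \<and>
               riemann_surface.flat_fields_bracket_closed X A D}"
proof -
  interpret projective_surface X A sc
    using assms by (simp add: projective_surface_def plane_def plane_axioms_def)
  let ?\<D> = "{D. holomorphic_connection D \<and> oper_connection D \<and>
    (\<forall>x\<in>topspace X. \<forall>j\<in>J 2 x. F_endo D x j = j) \<and> induces_trivial_det D \<and> flat_fields_bracket_closed D}"
  have "bij_betw (structure_connection sc) (projective_structures sc) ?\<D>"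
    unfolding bij_betw_def
  proof (intro conjI)
    show "inj_on (structure_connection sc) (projective_structures sc)"
    proof (rule inj_onI)
      fix \<PP> \<QQ> assume "\<PP> \<in> projective_structures sc" "\<QQ> \<in> projective_structures sc"
        and eq: "structure_connection sc \<PP> = structure_connection sc \<QQ>"
      then obtain P Q where P: "projective_atlas sc P" "\<PP> = atlas_class P"
        and Q: "projective_atlas sc Q" "\<QQ> = atlas_class Q"
        unfolding projective_structures_eq by blast
      obtain D where D: "adapted_to D P" using adapted_exists[OF P(1)] by blast
      obtain D' where D': "adapted_to D' Q" using adapted_exists[OF Q(1)] by blast
      have "D = D'"
        using eq structure_connection_eq[OF P(1) D] structure_connection_eq[OF Q(1) D'] P(2) Q(2) by simp
      \<comment> \<open>R lies in either class exactly if its own adapted connection is D; so the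
        classes have the same members.\<close>
      have "R \<in> atlas_class P \<longleftrightarrow> R \<in> atlas_class Q" for R
      proof (cases "projective_atlas sc R")
        case True
        then obtain E where E: "adapted_to E R" using adapted_exists by blast
        show ?thesis
          using atlas_union_iff[OF P(1) True D E] atlas_union_iff[OF Q(1) True D' E] \<open>D = D'\<close> True
          by (simp add: atlas_class_def)
      qed (simp add: atlas_class_def)
      then show "\<PP> = \<QQ>" using P(2) Q(2) by blast
    qed
    show "structure_connection sc ` projective_structures sc = ?\<D>"
    proof (intro equalityI subsetI)
      fix E assume "E \<in> structure_connection sc ` projective_structures sc"
      then obtain P where P: "projective_atlas sc P" "E = structure_connection sc (atlas_class P)"
        unfolding projective_structures_eq by blast
      obtain D where D: "adapted_to D P" using adapted_exists[OF P(1)] by blast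
      have "E = D" using P(2) structure_connection_eq[OF P(1) D] by simp
      moreover have "holomorphic_connection D" using D by (simp add: adapted_to_def)
      ultimately show "E \<in> ?\<D>" using adapted_conditions[OF P(1) D] by blast
    next
      fix D assume D: "D \<in> ?\<D>"
      then have "\<exists>P. projective_atlas sc P \<and> adapted_to D P" by (intro conditions_adapted) auto
      then obtain P where P: "projective_atlas sc P" "adapted_to D P" by blast
      then show "D \<in> structure_connection sc ` projective_structures sc"
        unfolding projective_structures_eq
        using structure_connection_eq[OF P] by (metis (mono_tags, lifting) imageI mem_Collect_eq)
    qed
  qed
  then show ?thesis .
qed

end
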